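(* Let $n\ge 1$ and $m\ge 1$ be integers. Suppose $T_n$ is a caterpillar on $n$ vertices and $H_m$ is an outerplanar graph on $m$ vertices which contains a Hamilton cycle. Then: (i) $R_c(T_n,H_m)=(n-1)(m-1)+1$. (ii) $R_g(T_n,H_m)\le \Delta\gamma m^2$, where $\Delta$ denotes the maximum degree of $T_n$ and $\gamma$ denotes the number of non-leaf vertices of $T_n$. (iii) Moreover, if $T_n$ has exactly two non-leaf vertices, then $R_g(T_n,H_m)=(n-1)(m-1)+1$.
   Context: A graph is outerplanar if it has a planar embedding in which every vertex is incident with the outer face. A Hamilton cycle is a cycle through all vertices. A caterpillar is a tree such that the subgraph induced by all its non-leaf vertices is a path. A finite set $P$ of points in the plane is in general position if no three of its points are collinear; it is in convex position if its points are the vertices of a convex polygon. $K_P$ denotes the complete geometric graph on $P$: its vertices are the points of $P$ and its edges are all straight line segments between two points of $P$. A subgraph of $K_P$ is non-crossing if no two of its edges cross each other. A 2-colouring of $K_P$ is a colouring of its edges with the colours red and blue; a subgraph is red (blue) if all its edges are red (blue). For outerplanar graphs $G_1,G_2$, $R_g(G_1,G_2)$ is the minimum integer $N$ such that for every set $P$ of $N$ points in the plane in general position and every 2-colouring of $K_P$, there is either a red non-crossing subgraph of $K_P$ isomorphic to $G_1$ or a blue non-crossing subgraph of $K_P$ isomorphic to $G_2$. $R_c(G_1,G_2)$ is defined in the same way, except that $P$ ranges over sets of $N$ points in convex position.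
   Formalization: Part (ii) is stated for n ≥ 3 only: for n = 1 (Δ = 0) and n = 2 (γ = 0) the bound Δγm² is 0, whereas R_g(T_n,H_m) ≥ 1, so the inequality fails there. *)

theory Defs
  imports "HOL-Analysis.Analysis" "HOL-Library.Extended_Nat"
begin

section \<open>Finite simple graphs\<close>

type_synonym 'a ugraph = "'a set \<times> 'a set set"

abbreviation verts :: "'a ugraph \<Rightarrow> 'a set" where "verts G \<equiv> fst G"
abbreviation edges :: "'a ugraph \<Rightarrow> 'a set set" where "edges G \<equiv> snd G"

definition simple_graph :: "'a ugraph \<Rightarrow> bool" where
  "simple_graph G \<longleftrightarrow> finite (verts G) \<and> (\<forall>e\<in>edges G. e \<subseteq> verts G \<and> card e = 2)"

definition subgraph :: "'a ugraph \<Rightarrow> 'a ugraph \<Rightarrow> bool" where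
  "subgraph S G \<longleftrightarrow> simple_graph S \<and> verts S \<subseteq> verts G \<and> edges S \<subseteq> edges G"

definition induced_subgraph :: "'a ugraph \<Rightarrow> 'a set \<Rightarrow> 'a ugraph" where
  "induced_subgraph G U = (U, {e \<in> edges G. e \<subseteq> U})"

definition graph_iso :: "'a ugraph \<Rightarrow> 'b ugraph \<Rightarrow> bool" where
  "graph_iso G H \<longleftrightarrow>
     (\<exists>f. bij_betw f (verts G) (verts H) \<and> (\<lambda>e. f ` e) ` edges G = edges H)"

definition degree :: "'a ugraph \<Rightarrow> 'a \<Rightarrow> nat" where
  "degree G v = card {e \<in> edges G. v \<in> e}"

definition max_degree :: "'a ugraph \<Rightarrow> nat" where
  "max_degree G = Max (degree G ` verts G)"

definition leaf :: "'a ugraph \<Rightarrow> 'a \<Rightarrow> bool" where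
  "leaf G v \<longleftrightarrow> v \<in> verts G \<and> degree G v = 1"

definition nonleaves :: "'a ugraph \<Rightarrow> 'a set" where
  "nonleaves G = {v \<in> verts G. \<not> leaf G v}"

definition connected_graph :: "'a ugraph \<Rightarrow> bool" where
  "connected_graph G \<longleftrightarrow>
     verts G \<noteq> {} \<and> (\<forall>u\<in>verts G. \<forall>v\<in>verts G. (u, v) \<in> {(x, y). {x, y} \<in> edges G}\<^sup>*)"

definition is_cycle :: "'a ugraph \<Rightarrow> 'a list \<Rightarrow> bool" where
  "is_cycle G xs \<longleftrightarrow> length xs \<ge> 3 \<and> distinct xs \<and> set xs \<subseteq> verts G \<and>
     (\<forall>i<length xs. {xs ! i, xs ! (Suc i mod length xs)} \<in> edges G)"

definition has_Hamilton_cycle :: "'a ugraph \<Rightarrow> bool" where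
  "has_Hamilton_cycle G \<longleftrightarrow> (\<exists>xs. is_cycle G xs \<and> set xs = verts G)"

definition tree :: "'a ugraph \<Rightarrow> bool" where
  "tree G \<longleftrightarrow> simple_graph G \<and> connected_graph G \<and> (\<nexists>xs. is_cycle G xs)"

text \<open>The list may be empty, so the null graph is a path; hence the one-edge tree, which has no
  non-leaf vertices, is a caterpillar below. The one-vertex tree is a caterpillar as well: its
  vertex has degree 0 and therefore is not a leaf.\<close>

definition path_graph :: "'a ugraph \<Rightarrow> bool" where
  "path_graph G \<longleftrightarrow> (\<exists>xs. distinct xs \<and> verts G = set xs \<and>
     edges G = {{xs ! i, xs ! Suc i} | i. Suc i < length xs})"

definition caterpillar :: "'a ugraph \<Rightarrow> bool" where
  "caterpillar G \<longleftrightarrow> tree G \<and> path_graph (induced_subgraph G (nonleaves G))"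

section \<open>Outerplanar graphs\<close>

type_synonym plane = "real ^ 2"

text \<open>Vertices are drawn as distinct points, each edge as a simple arc between its end vertices;
  an arc contains no further vertex, and two arcs meet only in common end vertices.\<close>

definition planar_embedding ::
  "'a ugraph \<Rightarrow> ('a \<Rightarrow> plane) \<Rightarrow> ('a set \<Rightarrow> real \<Rightarrow> plane) \<Rightarrow> bool" where
  "planar_embedding G f g \<longleftrightarrow>
     inj_on f (verts G) \<and>
     (\<forall>e\<in>edges G. arc (g e) \<and> {pathstart (g e), pathfinish (g e)} = f ` e \<and>
        path_image (g e) \<inter> f ` verts G = f ` e) \<and>
     (\<forall>e\<in>edges G. \<forall>e'\<in>edges G. e \<noteq> e' \<longrightarrow>
        path_image (g e) \<inter> path_image (g e') \<subseteq> f ` (e \<inter> e'))"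

definition drawing ::
  "'a ugraph \<Rightarrow> ('a \<Rightarrow> plane) \<Rightarrow> ('a set \<Rightarrow> real \<Rightarrow> plane) \<Rightarrow> plane set" where
  "drawing G f g = f ` verts G \<union> (\<Union>e\<in>edges G. path_image (g e))"

text \<open>As the drawing of a finite graph is compact, \<^const>\<open>outside\<close> of it is its unique
  unbounded face.\<close>

definition outerplanar :: "'a ugraph \<Rightarrow> bool" where
  "outerplanar G \<longleftrightarrow> simple_graph G \<and>
     (\<exists>f g. planar_embedding G f g \<and>
        (\<forall>v\<in>verts G. f v \<in> frontier (outside (drawing G f g))))"

section \<open>Point sets and complete geometric graphs\<close>

definition general_position :: "plane set \<Rightarrow> bool" where
  "general_position P \<longleftrightarrow> finite P \<and> (\<forall>A\<subseteq>P. card A = 3 \<longrightarrow> \<not> collinear A)"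

text \<open>Degenerate polygons are allowed, so every set of at most two points is in convex
  position. (Otherwise every statement about all convex point sets of size 0 would be vacuously
  true.)\<close>

definition convex_position :: "plane set \<Rightarrow> bool" where
  "convex_position P \<longleftrightarrow> finite P \<and> (\<exists>Q. polytope Q \<and> P = {v. v extreme_point_of Q})"

definition complete_geometric_graph :: "plane set \<Rightarrow> plane ugraph" where
  "complete_geometric_graph P = (P, {{p, q} | p q. p \<in> P \<and> q \<in> P \<and> p \<noteq> q})"

definition edges_cross :: "plane set \<Rightarrow> plane set \<Rightarrow> bool" where
  "edges_cross e e' \<longleftrightarrow> e \<noteq> e' \<and>
     (\<exists>p q r s. e = {p, q} \<and> e' = {r, s} \<and> open_segment p q \<inter> open_segment r s \<noteq> {})"

definition non_crossing :: "plane ugraph \<Rightarrow> bool" where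
  "non_crossing S \<longleftrightarrow> (\<forall>e\<in>edges S. \<forall>e'\<in>edges S. \<not> edges_cross e e')"

datatype colour = Red | Blue

definition has_mono_non_crossing_copy ::
  "plane set \<Rightarrow> (plane set \<Rightarrow> colour) \<Rightarrow> colour \<Rightarrow> 'a ugraph \<Rightarrow> bool" where
  "has_mono_non_crossing_copy P c k G \<longleftrightarrow>
     (\<exists>S. subgraph S (complete_geometric_graph P) \<and> non_crossing S \<and>
        (\<forall>e\<in>edges S. c e = k) \<and> graph_iso S G)"

section \<open>Geometric and convex Ramsey numbers\<close>

definition ramsey_forcing ::
  "(plane set \<Rightarrow> bool) \<Rightarrow> 'a ugraph \<Rightarrow> 'b ugraph \<Rightarrow> nat \<Rightarrow> bool" where
  "ramsey_forcing pos G\<^sub>1 G\<^sub>2 N \<longleftrightarrow>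
     (\<forall>P c. finite P \<and> card P = N \<and> pos P \<longrightarrow>
        has_mono_non_crossing_copy P c Red G\<^sub>1 \<or> has_mono_non_crossing_copy P c Blue G\<^sub>2)"

text \<open>The minimum is taken in \<^typ>\<open>enat\<close>, so it is infinite if no such \<open>N\<close> exists; finiteness
  is thus part of any upper bound.\<close>

definition R_g :: "'a ugraph \<Rightarrow> 'b ugraph \<Rightarrow> enat" where
  "R_g G\<^sub>1 G\<^sub>2 = (INF N \<in> {N. ramsey_forcing general_position G\<^sub>1 G\<^sub>2 N}. enat N)"

definition R_c :: "'a ugraph \<Rightarrow> 'b ugraph \<Rightarrow> enat" where
  "R_c G\<^sub>1 G\<^sub>2 = (INF N \<in> {N. ramsey_forcing convex_position G\<^sub>1 G\<^sub>2 N}. enat N)"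

end

theory Submission
  imports Defs
begin

text \<open>The two colours are treated separately, and a blue clique is all that is needed on the blue side.
  If \<open>H\<close> is outerplanar with a Hamilton cycle, then by the Jordan curve theorem no two of its edges
  interleave along that cycle (\<open>outerplanar_Hamilton_chords_not_interleaved\<close>), and a graph without
  interleaving edges can be drawn with straight non-crossing edges on every set of sufficiently many
  points in general position (\<open>noncrossing_embedding_on_points\<close>). Hence \<open>m\<close> points that span only
  blue edges carry a blue copy of \<open>H\<close> (\<open>mono_clique_has_outerplanar_copy\<close>).

  Without a blue clique on \<open>m\<close> points the red graph is rich: among more than \<open>k * (m - 1)\<close>
  points there is a nonempty subset in which every point has at least \<open>k\<close> red neighbours, since
  otherwise points of small red degree could be picked greedily until they form a blue clique
  (\<open>sparse_has_independent_set\<close>, \<open>dense_red_subset\<close>). It remains to find a red non-crossing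
  caterpillar. Its vertices are listed along the spine, each spine vertex followed by its leaves;
  every vertex is then joined either to the vertex to which its predecessor was joined or to its
  predecessor itself, and the caterpillar becomes a zigzag that is steered by a list of Booleans
  (\<open>caterpillar_zigzag\<close>).

  \<^item> In convex position, take \<open>k = n - 1\<close>. Following an argument of Perles, a zigzag is drawn by
    always rotating inwards, so that its edges are nested and cannot cross. For each of the
    \<open>n - 2\<close> steps one discards at every point the last edge in rotation order; there are more
    than \<open>n - 2\<close> oriented edges per point, so some edge survives and starts a zigzag
    (\<open>dense_convex_graph_contains_zigzag\<close>).

  \<^item> In general position, the zigzag is drawn from left to right. The stars at the spine vertices
    then lie in disjoint vertical slabs. Let a point survive a round if it has at least \<open>\<Delta>\<close>
    surviving red neighbours to its right. The points lost in one round span a sparse red graph, so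
    there are at most \<open>\<Delta> * (m - 1)\<close> of them, and a point that survives \<open>\<gamma>\<close> rounds starts the
    caterpillar (\<open>large_set_contains_sorted_zigzag\<close>).

  \<^item> If the caterpillar is a double star with \<open>a\<close> and \<open>b\<close> leaves, take \<open>k = a + b + 1\<close>. Let \<open>u\<close> be
    an exposed point and \<open>v\<close> its red neighbour number \<open>a + 1\<close> in angular order. The line
    \<open>u v\<close> has \<open>a\<close> neighbours of \<open>u\<close> on one side and at least \<open>b\<close> on the other; whichever side has
    enough neighbours of \<open>v\<close>, the leaves of the two centres can be taken on opposite sides
    (\<open>dense_graph_contains_double_star\<close>).

  For the lower bounds, at most \<open>(n - 1) * (m - 1)\<close> points on a parabola are cut into \<open>m - 1\<close> runs of
  at most \<open>n - 1\<close> consecutive points, with red edges inside the runs and blue edges between them.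
  Red components are too small for \<open>T\<close>. A blue copy of \<open>H\<close> would have two points in one run, hence two
  consecutive ones, and a non-crossing Hamilton cycle joins consecutive points
  (\<open>noncrossing_cycle_joins_neighbours\<close>). Points on a parabola are in convex position, so this bounds
  both Ramsey numbers.\<close>

section \<open>Orientation, general position and segments\<close>

text \<open>Twice the signed area of the triangle \<open>a b c\<close>, positive if it is traversed counterclockwise.\<close>

definition orient :: "plane \<Rightarrow> plane \<Rightarrow> plane \<Rightarrow> real" where
  "orient a b c = (b $ 1 - a $ 1) * (c $ 2 - a $ 2) - (b $ 2 - a $ 2) * (c $ 1 - a $ 1)"

lemma orient_swap: "orient b a c = - orient a b c"
  by (simp add: orient_def algebra_simps)

lemma orient_swap23: "orient a c b = - orient a b c"
  by (simp add: orient_def algebra_simps)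

lemma orient_same [simp]: "orient a a c = 0" "orient a b a = 0" "orient a b b = 0"
  by (simp_all add: orient_def algebra_simps)

lemma plane_eq_iff: "(a::plane) = b \<longleftrightarrow> a $ 1 = b $ 1 \<and> a $ 2 = b $ 2"
  by (metis exhaust_2 vec_eq_iff)

lemma collinear_orient: "collinear {a, b, c} \<longleftrightarrow> orient a b c = 0"
proof -
  have "collinear {a, b, c} \<longleftrightarrow> collinear {b, a, c}" by (simp add: insert_commute)
  also have "\<dots> \<longleftrightarrow> collinear {0, b - a, c - a}" by (rule collinear_3) (simp add: NO_MATCH_def)
  also have "\<dots> \<longleftrightarrow> orient a b c = 0" (is "?L = ?R")
  proof
    assume ?L
    then consider "b = a" | "c = a" | r where "c - a = r *\<^sub>R (b - a)" by (auto simp: collinear_lemma)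
    then show ?R
    proof cases
      case (3 r)
      then have "(c - a) $ 1 = r * (b - a) $ 1" "(c - a) $ 2 = r * (b - a) $ 2" by simp_all
      then show ?thesis by (simp add: orient_def)
    qed auto
  next
    assume R: ?R
    show ?L
    proof (cases "b = a")
      case False
      then have n: "(b $ 1 - a $ 1)^2 + (b $ 2 - a $ 2)^2 \<noteq> 0" (is "?n \<noteq> 0")
        by (simp add: plane_eq_iff sum_power2_eq_zero_iff)
      define r where "r = ((c $ 1 - a $ 1) * (b $ 1 - a $ 1) + (c $ 2 - a $ 2) * (b $ 2 - a $ 2)) / ?n"
      have rn: "r * ?n = (c $ 1 - a $ 1) * (b $ 1 - a $ 1) + (c $ 2 - a $ 2) * (b $ 2 - a $ 2)"
        using n by (simp add: r_def)
      have "?n * (c $ 1 - a $ 1) = ?n * (r * (b $ 1 - a $ 1))" "?n * (c $ 2 - a $ 2) = ?n * (r * (b $ 2 - a $ 2))"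
        using R rn unfolding orient_def by algebra+
      then have "c - a = r *\<^sub>R (b - a)" using n by (auto simp: plane_eq_iff)
      then show ?thesis by (auto simp: collinear_lemma)
    qed (simp add: collinear_lemma)
  qed
  finally show ?thesis .
qed

text \<open>General position in determinantal form, the form in which it is used throughout.\<close>

lemma general_position_orient:
  "general_position P \<longleftrightarrow> finite P \<and> (\<forall>a\<in>P. \<forall>b\<in>P. \<forall>c\<in>P. a \<noteq> b \<longrightarrow> a \<noteq> c \<longrightarrow> b \<noteq> c \<longrightarrow> orient a b c \<noteq> 0)"
proof -
  have "(\<forall>A\<subseteq>P. card A = 3 \<longrightarrow> \<not> collinear A) \<longleftrightarrow>
     (\<forall>a\<in>P. \<forall>b\<in>P. \<forall>c\<in>P. a \<noteq> b \<longrightarrow> a \<noteq> c \<longrightarrow> b \<noteq> c \<longrightarrow> \<not> collinear {a, b, c})" (is "?L \<longleftrightarrow> ?R")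
  proof
    assume L: ?L
    show ?R
    proof (intro ballI impI)
      fix a b c assume "a \<in> P" "b \<in> P" "c \<in> P" "a \<noteq> b" "a \<noteq> c" "b \<noteq> c"
      then show "\<not> collinear {a, b, c}" using L[rule_format, of "{a, b, c}"] by simp
    qed
  qed (auto simp: card_3_iff)
  then show ?thesis unfolding general_position_def by (simp add: collinear_orient)
qed

lemma general_position_orient_neq:
  assumes "general_position P" "a \<in> P" "b \<in> P" "c \<in> P" "a \<noteq> b" "a \<noteq> c" "b \<noteq> c"
  shows "orient a b c \<noteq> 0"
  using assms unfolding general_position_orient by blast

lemma general_position_subset: "general_position P \<Longrightarrow> Q \<subseteq> P \<Longrightarrow> general_position Q"
  unfolding general_position_def using finite_subset by blast

lemma open_segmentE:
  assumes "z \<in> open_segment a b"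
  obtains u where "0 < u" "u < 1" "z = (1 - u) *\<^sub>R a + u *\<^sub>R b"
  using assms by (auto simp: in_segment)

text \<open>The orientation is an affine function of its last argument; all separation arguments below rest on this.\<close>

lemma orient_convex: "orient a b ((1 - u) *\<^sub>R c + u *\<^sub>R d) = (1 - u) * orient a b c + u * orient a b d"
  by (simp add: orient_def algebra_simps)

lemma weighted_pos:
  fixes x y u :: real
  assumes "0 < u" "u < 1" "x \<ge> 0" "y \<ge> 0" "x \<noteq> 0 \<or> y \<noteq> 0"
  shows "(1 - u) * x + u * y > 0"
  using assms by (smt (verit) mult_nonneg_nonneg mult_pos_pos)

text \<open>The map \<open>orient a b\<close> vanishes on the first segment and is positive on the second one: it is
  affine, nonnegative at both ends and positive at one of them.\<close>

lemma open_segment_one_side: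
  assumes "orient a b c \<ge> 0" "orient a b d \<ge> 0" "orient a b c \<noteq> 0 \<or> orient a b d \<noteq> 0"
  shows "open_segment a b \<inter> open_segment c d = {}"
proof (rule equals0I)
  fix z assume "z \<in> open_segment a b \<inter> open_segment c d"
  then obtain u v where u: "z = (1 - u) *\<^sub>R a + u *\<^sub>R b" and v: "z = (1 - v) *\<^sub>R c + v *\<^sub>R d" "0 < v" "v < 1"
    by (meson IntE open_segmentE)
  have "orient a b z = 0" unfolding u orient_convex by simp
  moreover have "orient a b z > 0" unfolding v(1) orient_convex using weighted_pos v assms by blast
  ultimately show False by simp
qed

lemma open_segment_one_side_neg:
  assumes "orient a b c \<le> 0" "orient a b d \<le> 0" "orient a b c \<noteq> 0 \<or> orient a b d \<noteq> 0"
  shows "open_segment a b \<inter> open_segment c d = {}"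
  using open_segment_one_side[of b a c d] assms orient_swap[of a b] by (simp add: open_segment_commute)

text \<open>A separating line may touch both segments in end points, as long as one of the two segments is
  not contained in it.\<close>

lemma linear_separates_segments:
  fixes h :: "plane \<Rightarrow> real"
  assumes aff: "\<And>u x y. h ((1 - u) *\<^sub>R x + u *\<^sub>R y) = (1 - u) * h x + u * h y"
    and "h a \<le> 0" "h b \<le> 0" "h a \<noteq> 0 \<or> h b \<noteq> 0" "h c \<ge> 0" "h d \<ge> 0" 
  shows "open_segment a b \<inter> open_segment c d = {}"
proof (rule equals0I)
  fix z assume "z \<in> open_segment a b \<inter> open_segment c d"
  then obtain u v where u: "z = (1 - u) *\<^sub>R a + u *\<^sub>R b" "0 < u" "u < 1"
    and v: "z = (1 - v) *\<^sub>R c + v *\<^sub>R d" "0 < v" "v < 1"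
    by (meson IntE open_segmentE)
  have "- h z = (1 - u) * - h a + u * - h b" unfolding u(1) aff by (simp add: algebra_simps)
  also have "\<dots> > 0" using assms u by (intro weighted_pos) auto
  finally have "h z < 0" by simp
  moreover have "h z \<ge> 0" unfolding v(1) aff using v assms by simp
  ultimately show False by simp
qed

text \<open>Rotation about \<open>u\<close> is transitive on the points of an open half-plane whose boundary contains
  \<open>u\<close>. The half-plane is given by a linear form with coefficients \<open>h1\<close> and \<open>h2\<close>, and the claim can
  be read off the linear relation between the three vectors from \<open>u\<close>.\<close>

lemma orient_trans:
  fixes h1 h2 :: real
  assumes "orient u x y > 0" "orient u y z > 0"
    and "\<And>w. w \<in> {x, y, z} \<Longrightarrow> h1 * (w $ 1 - u $ 1) + h2 * (w $ 2 - u $ 2) > 0"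
  shows "orient u x z > 0"
proof -
  let ?h = "\<lambda>w. h1 * (w $ 1 - u $ 1) + h2 * (w $ 2 - u $ 2)"
  have "orient u x z * ?h y = orient u x y * ?h z + orient u y z * ?h x"
    by (simp add: orient_def algebra_simps)
  also have "\<dots> > 0" using assms(1,2) assms(3)[of x] assms(3)[of z]
    by (intro add_pos_pos) (simp_all only: mult_pos_pos insert_iff simp_thms)
  finally show ?thesis using assms(3)[of y] by (simp add: zero_less_mult_iff)
qed

text \<open>Ranks in a finite strict linear order are pairwise distinct and smaller than the number of
  elements, so each rank occurs. With rank 0 this produces a least element.\<close>

lemma exists_rank:
  assumes "finite X" "k < card X"
    and irr: "\<And>x. x \<in> X \<Longrightarrow> \<not> R x x"
    and tr: "\<And>x y z. x \<in> X \<Longrightarrow> y \<in> X \<Longrightarrow> z \<in> X \<Longrightarrow> R x y \<Longrightarrow> R y z \<Longrightarrow> R x z"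
    and tot: "\<And>x y. x \<in> X \<Longrightarrow> y \<in> X \<Longrightarrow> x \<noteq> y \<Longrightarrow> R x y \<or> R y x"
  shows "\<exists>x\<in>X. card {y \<in> X. R y x} = k"
proof -
  let ?r = "\<lambda>x. card {y \<in> X. R y x}"
  have mono: "?r x < ?r y" if "x \<in> X" "y \<in> X" "R x y" for x y
  proof (rule psubset_card_mono)
    show "{z \<in> X. R z x} \<subset> {z \<in> X. R z y}" using that irr tr by blast
  qed (use assms in auto)
  have "inj_on ?r X"
  proof (rule inj_onI, rule ccontr)
    fix x y assume "x \<in> X" "y \<in> X" "?r x = ?r y" "x \<noteq> y"
    then show False using tot[of x y] mono[of x y] mono[of y x] by auto
  qed
  moreover have "?r ` X \<subseteq> {..<card X}"
  proof (clarsimp)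
    fix x assume "x \<in> X"
    then have "{y \<in> X. R y x} \<subset> X" using irr by blast
    then show "card {y \<in> X. R y x} < card X" using assms psubset_card_mono by blast
  qed
  ultimately have "?r ` X = {..<card X}"
    by (metis card_image card_lessThan card_subset_eq finite_lessThan)
  then have "k \<in> ?r ` X" using assms by simp
  then show ?thesis by auto
qed

text \<open>Edges of a star never cross in general position: they lie on different rays.\<close>

lemma star_segments_disjoint:
  assumes "general_position P" "p \<in> P" "x \<in> P" "y \<in> P" "p \<noteq> x" "p \<noteq> y" "x \<noteq> y"
  shows "open_segment p x \<inter> open_segment p y = {}"
proof -
  have "orient p x y \<noteq> 0" by (rule general_position_orient_neq) (use assms in auto)
  then show ?thesis
    using open_segment_one_side[of p x p y] open_segment_one_side_neg[of p x p y]
    by (cases "orient p x y > 0") auto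
qed

section \<open>Chords of an outerplanar Hamilton cycle do not interleave\<close>

lemma connected_subset_inside:
  assumes "connected M" "M \<inter> X = {}" "x \<in> M" "x \<in> inside X"
  shows "M \<subseteq> inside X"
proof
  fix y assume "y \<in> M"
  then have "connected_component (- X) x y"
    using assms unfolding connected_component_def by blast
  then show "y \<in> inside X"
    using inside_same_component assms by metis
qed

text \<open>The essential property of a theta curve with the arcs \<open>A\<close>, \<open>B\<close> and \<open>E\<close>: a point that neither
  \<open>A \<union> E\<close> nor \<open>B \<union> E\<close> separates from infinity is not separated from infinity by all three arcs
  together. This is Janiszewski's theorem, as the two sets meet in the connected set \<open>E\<close>.\<close>

lemma not_inside_theta:
  fixes A B E :: "complex set"
  assumes comp: "compact A" "compact B" "compact E" and con: "connected E" and AB: "A \<inter> B \<subseteq> E"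
    and pn: "p \<notin> A \<union> B \<union> E" and pA: "p \<notin> inside (A \<union> E)" and pB: "p \<notin> inside (B \<union> E)"
  shows "p \<notin> inside (A \<union> B)"
proof
  assume p: "p \<in> inside (A \<union> B)"
  have "bounded (A \<union> B \<union> E)"
    using comp by (simp add: compact_imp_bounded)
  then obtain q where q: "q \<in> outside (A \<union> B \<union> E)"
    using outside_bounded_nonempty by blast
  have joined: "connected_component (- X) p q"
    if X: "X \<subseteq> A \<union> B \<union> E" "compact X" "p \<notin> inside X" for X
  proof -
    have "q \<in> outside X" using q X outside_mono by blast
    moreover have "p \<in> outside X" using X pn inside_Un_outside[of X] by blast
    moreover have "connected (outside X)"
      using X by (intro connected_outside) (auto simp: compact_imp_bounded)
    moreover have "outside X \<subseteq> - X" using inside_Un_outside[of X] by blast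
    ultimately show ?thesis unfolding connected_component_def by blast
  qed
  have EE: "(A \<union> E) \<inter> (B \<union> E) = E" using AB by blast
  have "connected_component (- ((A \<union> E) \<union> (B \<union> E))) p q"
  proof (rule Janiszewski)
    show "connected ((A \<union> E) \<inter> (B \<union> E))" using con EE by simp
    show "connected_component (- (A \<union> E)) p q" using comp pA by (intro joined) auto
    show "connected_component (- (B \<union> E)) p q" using comp pB by (intro joined) auto
  qed (use comp in \<open>auto intro!: compact_Un compact_imp_closed\<close>)
  then have "connected_component (- (A \<union> B)) p q"
    by (rule connected_component_of_subset) auto
  then have "q \<in> inside (A \<union> B)" using p inside_same_component by metis
  moreover have "q \<in> outside (A \<union> B)" using q outside_mono[of "A \<union> B" "A \<union> B \<union> E"] by blast
  ultimately show False using inside_Int_outside by blast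
qed

fun path_edges :: "'a list \<Rightarrow> 'a set set" where
  "path_edges (x # y # zs) = insert {x, y} (path_edges (y # zs))"
| "path_edges _ = {}"

lemma path_edges_append: "path_edges (xs @ y # ys) = path_edges (xs @ [y]) \<union> path_edges (y # ys)"
  by (induction xs rule: path_edges.induct) (auto)

lemma Union_path_edges_subset: "\<Union>(path_edges xs) \<subseteq> set xs"
  by (induction xs rule: path_edges.induct) auto

lemma path_edges_nth: "path_edges xs = {{xs ! i, xs ! Suc i} | i. Suc i < length xs}"
proof (induction xs rule: path_edges.induct)
  case (1 x y zs)
  have "{{(x # y # zs) ! i, (x # y # zs) ! Suc i} | i. Suc i < length (x # y # zs)}
      = insert {x, y} {{(y # zs) ! i, (y # zs) ! Suc i} | i. Suc i < length (y # zs)}" (is "?L = ?R")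
  proof (rule set_eqI, rule iffI)
    fix e assume "e \<in> ?L"
    then obtain i where i: "e = {(x # y # zs) ! i, (x # y # zs) ! Suc i}" "Suc i < length (x # y # zs)" by blast
    then show "e \<in> ?R" by (cases i) auto
  next
    fix e assume "e \<in> ?R"
    then consider "e = {x, y}" | i where "e = {(y # zs) ! i, (y # zs) ! Suc i}" "Suc i < length (y # zs)" by blast
    then show "e \<in> ?L"
    proof cases
      case 1 then show ?thesis by (intro CollectI exI[of _ 0]) simp
    next
      case (2 i) then show ?thesis by (intro CollectI exI[of _ "Suc i"]) simp
    qed
  qed
  then show ?case using 1 by simp
qed auto

lemma endpoints_not_path_edge:
  assumes "distinct (a # ps @ [b])" "ps \<noteq> []"
  shows "{a, b} \<notin> path_edges (a # ps @ [b])"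
proof -
  obtain p ps' where p: "ps = p # ps'" using assms by (cases ps) auto
  then have "a \<notin> \<Union>(path_edges (ps @ [b]))" using assms Union_path_edges_subset[of "ps @ [b]"] by auto
  then show ?thesis using assms p by (auto simp: doubleton_eq_iff)
qed

text \<open>A planar drawing, moved to the complex plane as the setting of the Jordan curve theorem.
  Outerplanarity survives in the last assumption only: no vertex lies inside a closed part of the
  drawing.\<close>

locale outerplane_drawing =
  fixes V :: "'a set" and Es :: "'a set set" and F :: "'a \<Rightarrow> complex" and g :: "'a set \<Rightarrow> real \<Rightarrow> complex"
  assumes inj: "inj_on F V"
    and edge_sub: "e \<in> Es \<Longrightarrow> e \<subseteq> V"
    and arc: "e \<in> Es \<Longrightarrow> arc (g e)"
    and ends: "e \<in> Es \<Longrightarrow> {pathstart (g e), pathfinish (g e)} = F ` e"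
    and avoid: "e \<in> Es \<Longrightarrow> path_image (g e) \<inter> F ` V = F ` e"
    and meet: "e \<in> Es \<Longrightarrow> e' \<in> Es \<Longrightarrow> e \<noteq> e' \<Longrightarrow> path_image (g e) \<inter> path_image (g e') \<subseteq> F ` (e \<inter> e')"
    and outer: "v \<in> V \<Longrightarrow> closed X \<Longrightarrow> X \<subseteq> F ` V \<union> (\<Union>e\<in>Es. path_image (g e)) \<Longrightarrow> F v \<notin> inside X"
begin

definition img :: "'a set set \<Rightarrow> complex set" where "img S = (\<Union>e\<in>S. path_image (g e))"

lemma img_Un: "img (S \<union> S') = img S \<union> img S'"
  by (auto simp: img_def)

lemma img_Int:
  assumes "S \<subseteq> Es" "S' \<subseteq> Es" "S \<inter> S' = {}"
  shows "img S \<inter> img S' \<subseteq> F ` (\<Union>S \<inter> \<Union>S')"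
proof
  fix z assume "z \<in> img S \<inter> img S'"
  then obtain e e' where e: "e \<in> S" "e' \<in> S'" "z \<in> path_image (g e)" "z \<in> path_image (g e')"
    by (auto simp: img_def)
  then have "z \<in> F ` (e \<inter> e')" using meet[of e e'] assms by blast
  then show "z \<in> F ` (\<Union>S \<inter> \<Union>S')" using e by blast
qed

lemma vertex_img:
  assumes "S \<subseteq> Es" "v \<in> V" "F v \<in> img S"
  shows "v \<in> \<Union>S"
proof -
  obtain e where e: "e \<in> S" "F v \<in> path_image (g e)" using assms by (auto simp: img_def)
  then have "F v \<in> F ` e" using avoid[of e] assms by blast
  then show ?thesis using inj edge_sub[of e] assms e by (auto simp: inj_on_def)
qed

lemma edge_arc:
  assumes "{x, y} \<in> Es"
  obtains h where "Path_Connected.arc h" "pathstart h = F x" "pathfinish h = F y" "path_image h = path_image (g {x, y})"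
proof -
  have "{pathstart (g {x, y}), pathfinish (g {x, y})} = {F x, F y}" using ends[OF assms] by simp
  then consider "pathstart (g {x, y}) = F x" "pathfinish (g {x, y}) = F y"
    | "pathstart (g {x, y}) = F y" "pathfinish (g {x, y}) = F x" by (auto simp: doubleton_eq_iff)
  then show thesis
  proof cases
    case 1 then show ?thesis using that arc[OF assms] by blast
  next
    case 2 then show ?thesis using that[of "reversepath (g {x, y})"] arc[OF assms]
      by (simp add: arc_reversepath)
  qed
qed

lemma path_arc:
  assumes "path_edges ys \<subseteq> Es" "distinct ys" "length ys \<ge> 2"
  shows "\<exists>h. Path_Connected.arc h \<and> pathstart h = F (hd ys) \<and> pathfinish h = F (last ys) \<and> path_image h = img (path_edges ys)"
  using assms
proof (induction ys rule: path_edges.induct)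
  case (1 x y zs)
  obtain h1 where h1: "Path_Connected.arc h1" "pathstart h1 = F x" "pathfinish h1 = F y" "path_image h1 = path_image (g {x, y})"
  proof (rule edge_arc)
    show "{x, y} \<in> Es" using "1.prems"(1) by simp
  qed
  show ?case
  proof (cases zs)
    case Nil
    have "path_image h1 = img (path_edges (x # y # zs))" "pathfinish h1 = F (last (x # y # zs))"
        "pathstart h1 = F (hd (x # y # zs))"
      using h1 Nil by (simp_all add: img_def)
    then show ?thesis using h1(1) by (intro exI[of _ h1] conjI)
  next
    case (Cons z zs')
    have "\<exists>h. Path_Connected.arc h \<and> pathstart h = F (hd (y # zs)) \<and> pathfinish h = F (last (y # zs))
        \<and> path_image h = img (path_edges (y # zs))"
    proof (rule "1.IH")
      show "path_edges (y # zs) \<subseteq> Es" using "1.prems"(1) by simp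
      show "distinct (y # zs)" using "1.prems"(2) by simp
      show "2 \<le> length (y # zs)" using Cons by simp
    qed
    then obtain h2 where h2: "Path_Connected.arc h2" "pathstart h2 = F y" "pathfinish h2 = F (last (y # zs))"
        "path_image h2 = img (path_edges (y # zs))"
      unfolding list.sel by blast
    have x: "x \<notin> \<Union>(path_edges (y # zs))"
      using "1.prems"(2) Union_path_edges_subset[of "y # zs"] by fastforce
    have "img {{x, y}} \<inter> img (path_edges (y # zs)) \<subseteq> F ` (\<Union>{{x, y}} \<inter> \<Union>(path_edges (y # zs)))"
      using "1.prems"(1) x by (intro img_Int) auto
    also have "\<dots> \<subseteq> {F y}" using x by auto
    finally have "path_image h1 \<inter> path_image h2 \<subseteq> {pathstart h2}"
      using h1 h2 by (simp add: img_def)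
    then have "Path_Connected.arc (h1 +++ h2)" using h1 h2 by (simp add: arc_join)
    moreover have "path_image (h1 +++ h2) = img (path_edges (x # y # zs))"
      using h1 h2 by (simp add: path_image_join img_def)
    moreover have "pathstart (h1 +++ h2) = F (hd (x # y # zs))"
      by (simp only: list.sel pathstart_join h1(2))
    moreover have "pathfinish (h1 +++ h2) = F (last (x # y # zs))"
      by (simp add: pathfinish_join h2(3))
    ultimately show ?thesis by (intro exI[of _ "h1 +++ h2"] conjI)
  qed
qed simp_all

lemma finite_path_edges: "finite (path_edges xs)"
  by (induction xs rule: path_edges.induct) auto

lemma compact_img: "finite S \<Longrightarrow> S \<subseteq> Es \<Longrightarrow> compact (img S)"
  unfolding img_def using arc by (intro compact_UN) (auto intro: compact_arc_image)

lemma edge_nontrivial: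
  assumes "e \<in> Es" "e \<subseteq> {a, b}"
  shows "e = {a, b}"
proof -
  have im: "{pathstart (g e), pathfinish (g e)} = F ` e" by (rule ends[OF assms(1)])
  have pq: "pathstart (g e) \<noteq> pathfinish (g e)" using arc_distinct_ends[OF arc[OF assms(1)]] by metis
  have "e \<noteq> {}" using im by (metis image_empty insert_not_empty)
  moreover have "e \<noteq> {x}" for x using im pq by (metis doubleton_eq_iff image_empty image_insert insert_absorb2)
  ultimately show ?thesis using assms(2) by blast
qed

text \<open>The chord \<open>{a, b}\<close> divides the cycle into two paths, with \<open>j\<close> and \<open>l\<close> on different sides. If
  \<open>M\<close> met the inside of the closed curve formed by the chord and the path through \<open>j\<close>, then \<open>M\<close>
  would stay there, and so would its limit point \<open>l\<close>, although no vertex is inside a part of the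
  drawing. By symmetry \<open>M\<close> avoids the inside of both such curves, and the theta curve property
  applies.\<close>

lemma connected_misses_cycle_inside:
  assumes dist: "distinct (a # ps @ b # qs)"
    and sub: "path_edges (a # ps @ [b]) \<subseteq> Es" "path_edges (b # qs @ [a]) \<subseteq> Es" "{a, b} \<in> Es"
    and j: "j \<in> set ps" "j \<in> V" and l: "l \<in> set qs" "l \<in> V"
    and M: "connected M" "M \<inter> img (insert {a, b} (path_edges (a # ps @ [b]) \<union> path_edges (b # qs @ [a]))) = {}"
      "F j \<in> closure M" "F l \<in> closure M"
  shows "M \<inter> inside (img (path_edges (a # ps @ [b]) \<union> path_edges (b # qs @ [a]))) = {}"
proof -
  define A B E where "A = path_edges (a # ps @ [b])" and "B = path_edges (b # qs @ [a])" and "E = {{a, b}}"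
  have fin: "finite A" "finite B" "finite E" by (auto simp: A_def B_def E_def finite_path_edges)
  have Es: "A \<subseteq> Es" "B \<subseteq> Es" "E \<subseteq> Es" using sub by (auto simp: A_def B_def E_def)
  have UA: "\<Union>A \<subseteq> insert a (insert b (set ps))"
    using Union_path_edges_subset[of "a # ps @ [b]"] unfolding A_def by auto
  have UB: "\<Union>B \<subseteq> insert a (insert b (set qs))"
    using Union_path_edges_subset[of "b # qs @ [a]"] unfolding B_def by auto
  have ps: "ps \<noteq> []" and qs: "qs \<noteq> []" using j l by auto
  have nA: "{a, b} \<notin> A" unfolding A_def using dist ps by (intro endpoints_not_path_edge) auto
  have pq: "set ps \<inter> set qs = {}" using dist by auto
  then have UAB: "\<Union>A \<inter> \<Union>B \<subseteq> {a, b}" using UA UB by blast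
  have disj: "A \<inter> B = {}"
  proof (rule equals0I)
    fix e assume e: "e \<in> A \<inter> B"
    then have eab: "e \<subseteq> {a, b}" using UAB by blast
    moreover have "e \<in> Es" using e Es by blast
    ultimately have "e = {a, b}" using edge_nontrivial by blast
    then show False using e nA by simp
  qed
  have comp: "compact (img A)" "compact (img B)" "compact (img E)"
    using fin Es by (auto intro: compact_img)
  have conE: "connected (img E)" using sub(3) arc by (simp add: img_def E_def connected_arc_image)
  have "img A \<inter> img B \<subseteq> F ` (\<Union>A \<inter> \<Union>B)" using Es disj by (intro img_Int)
  also have "\<dots> \<subseteq> F ` {a, b}" using UAB by (rule image_mono)
  also have "F ` {a, b} = {pathstart (g {a, b}), pathfinish (g {a, b})}"
    by (rule ends[OF sub(3), symmetric])
  also have "\<dots> \<subseteq> img E" unfolding img_def E_def by (simp add: pathstart_in_path_image pathfinish_in_path_image)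
  finally have AB: "img A \<inter> img B \<subseteq> img E" .
  have none: "M \<inter> inside (img X \<union> img E) = {}"
    if X: "X \<subseteq> Es" "finite X" "compact (img X)" "v \<in> V" "v \<notin> \<Union>X" "v \<noteq> a" "v \<noteq> b" "F v \<in> closure M"
      "M \<inter> (img X \<union> img E) = {}" for X v
  proof (rule ccontr)
    assume "M \<inter> inside (img X \<union> img E) \<noteq> {}"
    then have "M \<subseteq> inside (img X \<union> img E)" using M(1) X connected_subset_inside by blast
    then have "F v \<in> closure (inside (img X \<union> img E))" using X closure_mono by blast
    moreover have cl: "closed (img X \<union> img E)" using X comp by (auto intro: compact_imp_closed)
    ultimately have "F v \<in> (img X \<union> img E) \<union> inside (img X \<union> img E)"
      using closure_inside_subset by blast
    moreover have "F v \<notin> inside (img X \<union> img E)"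
      using X Es cl by (intro outer) (auto simp: img_def)
    ultimately have "F v \<in> img (X \<union> E)" by (auto simp: img_Un)
    then have "v \<in> \<Union>(X \<union> E)" using X Es by (intro vertex_img) auto
    then show False using X by (auto simp: E_def)
  qed
  have MA: "M \<inter> (img A \<union> img E) = {}" and MB: "M \<inter> (img B \<union> img E) = {}"
    using M(2) unfolding img_def A_def B_def E_def by auto
  have lA: "l \<notin> \<Union>A" and jB: "j \<notin> \<Union>B" and ne: "l \<noteq> a" "l \<noteq> b" "j \<noteq> a" "j \<noteq> b"
    using UA UB pq j l dist by auto
  have "M \<inter> inside (img A \<union> img E) = {}"
    by (rule none[OF Es(1) fin(1) comp(1) l(2) lA ne(1,2) M(4) MA])
  moreover have "M \<inter> inside (img B \<union> img E) = {}"
    by (rule none[OF Es(2) fin(2) comp(2) j(2) jB ne(3,4) M(3) MB])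
  ultimately have "M \<inter> inside (img A \<union> img B) = {}"
    using not_inside_theta[OF comp conE AB] MA MB by blast
  then show ?thesis by (simp add: img_Un A_def B_def)
qed

lemma img_vertex: "S \<subseteq> Es \<Longrightarrow> v \<in> \<Union>S \<Longrightarrow> F v \<in> img S"
proof -
  assume S: "S \<subseteq> Es" and "v \<in> \<Union>S"
  then obtain e where e: "e \<in> S" "v \<in> e" by blast
  then have "F v \<in> path_image (g e)" using S avoid[of e] by blast
  then show ?thesis using e unfolding img_def by blast
qed

lemma set_subset_Union_path_edges: "length xs \<ge> 2 \<Longrightarrow> set xs \<subseteq> \<Union>(path_edges xs)"
proof (induction xs rule: path_edges.induct)
  case (1 x y zs)
  then show ?case by (cases zs) auto
qed auto

text \<open>A chord cannot run outside the cycle: otherwise the inside of the cycle itself would be a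
  connected set as in the previous lemma, for every vertex of the cycle is in its frontier.\<close>

lemma chord_meets_cycle_inside:
  assumes dist: "distinct (a # ps @ b # qs)"
    and sub: "path_edges (a # ps @ [b]) \<subseteq> Es" "path_edges (b # qs @ [a]) \<subseteq> Es" "{a, b} \<in> Es"
    and ne: "ps \<noteq> []" "qs \<noteq> []"
  shows "path_image (g {a, b}) \<inter> inside (img (path_edges (a # ps @ [b]) \<union> path_edges (b # qs @ [a]))) \<noteq> {}"
proof
  define A B where "A = path_edges (a # ps @ [b])" and "B = path_edges (b # qs @ [a])"
  assume empty: "path_image (g {a, b}) \<inter> inside (img (path_edges (a # ps @ [b]) \<union> path_edges (b # qs @ [a]))) = {}"
  obtain h1 where h1: "Path_Connected.arc h1" "pathstart h1 = F a" "pathfinish h1 = F b" "path_image h1 = img A"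
    using path_arc[OF sub(1)] dist unfolding A_def by auto
  obtain h2 where h2: "Path_Connected.arc h2" "pathstart h2 = F b" "pathfinish h2 = F a" "path_image h2 = img B"
    using path_arc[OF sub(2)] dist unfolding B_def by auto
  have nA: "{a, b} \<notin> A" unfolding A_def using dist ne by (intro endpoints_not_path_edge) auto
  have UA: "\<Union>A \<subseteq> insert a (insert b (set ps))"
    using Union_path_edges_subset[of "a # ps @ [b]"] unfolding A_def by auto
  have UB: "\<Union>B \<subseteq> insert a (insert b (set qs))"
    using Union_path_edges_subset[of "b # qs @ [a]"] unfolding B_def by auto
  have "set ps \<inter> set qs = {}" using dist by auto
  then have UAB: "\<Union>A \<inter> \<Union>B \<subseteq> {a, b}" using UA UB by blast
  have disj: "A \<inter> B = {}"
    using UAB nA sub edge_nontrivial unfolding A_def B_def by blast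
  have "img A \<inter> img B \<subseteq> F ` (\<Union>A \<inter> \<Union>B)" using sub disj unfolding A_def B_def by (intro img_Int)
  also have "\<dots> \<subseteq> F ` {a, b}" using UAB by (rule image_mono)
  finally have "simple_path (h1 +++ h2)"
    using h1 h2 by (intro simple_path_join_loop) auto
  moreover have loop: "pathfinish (h1 +++ h2) = pathstart (h1 +++ h2)" using h1 h2 by simp
  moreover have im: "path_image (h1 +++ h2) = img (A \<union> B)" using h1 h2 by (simp add: path_image_join img_Un)
  ultimately have J: "inside (img (A \<union> B)) \<noteq> {}" "connected (inside (img (A \<union> B)))"
      "frontier (inside (img (A \<union> B))) = img (A \<union> B)"
    using Jordan_inside_outside[of "h1 +++ h2"] by auto
  obtain j l where j: "j \<in> set ps" and l: "l \<in> set qs" using ne by (meson ex_in_conv set_empty)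
  have UAB': "set (a # ps @ [b]) \<subseteq> \<Union>A" "set (b # qs @ [a]) \<subseteq> \<Union>B"
    unfolding A_def B_def by (intro set_subset_Union_path_edges; simp)+
  have jl: "j \<in> \<Union>(A \<union> B)" "l \<in> \<Union>(A \<union> B)" using j l UAB' by auto
  have AB: "A \<union> B \<subseteq> Es" using sub unfolding A_def B_def by blast
  then have jlV: "j \<in> V" "l \<in> V" using jl edge_sub by blast+
  have "img (A \<union> B) \<subseteq> closure (inside (img (A \<union> B)))" using J(3) by (auto simp: frontier_def)
  then have cl: "F j \<in> closure (inside (img (A \<union> B)))" "F l \<in> closure (inside (img (A \<union> B)))"
    using img_vertex[OF AB] jl by blast+
  have "img (insert {a, b} (A \<union> B)) = path_image (g {a, b}) \<union> img (A \<union> B)" by (simp add: img_def)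
  then have "inside (img (A \<union> B)) \<inter> img (insert {a, b} (A \<union> B)) = {}"
    using empty inside_no_overlap[of "img (A \<union> B)"] unfolding A_def B_def by blast
  then have "inside (img (A \<union> B)) \<inter> inside (img (A \<union> B)) = {}"
    using connected_misses_cycle_inside[OF dist sub j jlV(1) l jlV(2)] J(2) cl unfolding A_def B_def by blast
  then show False using J by simp
qed

lemma endpoints_in_closure:
  fixes h :: "real \<Rightarrow> complex"
  assumes "Path_Connected.arc h"
  shows "pathstart h \<in> closure (path_image h - {pathstart h, pathfinish h})"
    and "pathfinish h \<in> closure (path_image h - {pathstart h, pathfinish h})"
proof -
  have sub: "h ` {0<..<1} \<subseteq> path_image h - {pathstart h, pathfinish h}"
  proof
    fix z assume "z \<in> h ` {0<..<1}"
    then obtain t where t: "z = h t" "0 < t" "t < 1" by auto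
    have "inj_on h {0..1}" using assms by (simp add: arc_def)
    then have "h t \<noteq> h 0" "h t \<noteq> h 1" using t inj_onD[of h "{0..1}" t] by fastforce+
    then show "z \<in> path_image h - {pathstart h, pathfinish h}"
      using t by (auto simp: path_image_def pathstart_def pathfinish_def)
  qed
  have "continuous_on {0..1} h" using assms by (simp add: arc_def path_def)
  then have "h ` closure {0<..<1} \<subseteq> closure (h ` {0<..<1})"
    by (rule continuous_image_closure_subset) simp
  also have "\<dots> \<subseteq> closure (path_image h - {pathstart h, pathfinish h})" using sub by (rule closure_mono)
  finally show "pathstart h \<in> closure (path_image h - {pathstart h, pathfinish h})"
     "pathfinish h \<in> closure (path_image h - {pathstart h, pathfinish h})"
    by (auto simp: pathstart_def pathfinish_def)
qed

text \<open>The chord \<open>{j, l}\<close> meets the inside of the cycle. Without its end points it is connected,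
  disjoint from the cycle and from the chord \<open>{a, b}\<close>, and it has \<open>j\<close> and \<open>l\<close> as limit points, which
  is impossible.\<close>

lemma no_crossing_chords:
  assumes dist: "distinct (a # p1 @ j # p2 @ b # q1 @ l # q2)"
    and cyc: "path_edges (a # p1 @ j # p2 @ b # q1 @ l # q2 @ [a]) \<subseteq> Es"
    and ab: "{a, b} \<in> Es" and jl: "{j, l} \<in> Es"
  shows False
proof -
  define C where "C = path_edges (a # p1 @ j # p2 @ b # q1 @ l # q2 @ [a])"
  have C1: "C = path_edges (a # (p1 @ j # p2) @ [b]) \<union> path_edges (b # (q1 @ l # q2) @ [a])"
    using path_edges_append[of "a # p1 @ j # p2" b "q1 @ l # q2 @ [a]"] by (simp add: C_def)
  have "C = path_edges (a # p1 @ [j]) \<union> (path_edges (j # (p2 @ b # q1) @ [l]) \<union> path_edges (l # q2 @ [a]))"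
    using path_edges_append[of "a # p1" j "p2 @ b # q1 @ l # q2 @ [a]"]
      path_edges_append[of "j # p2 @ b # q1" l "q2 @ [a]"] by (simp add: C_def)
  moreover have "path_edges (l # (q2 @ a # p1) @ [j]) = path_edges (l # q2 @ [a]) \<union> path_edges (a # p1 @ [j])"
    using path_edges_append[of "l # q2" a "p1 @ [j]"] by simp
  ultimately have C2: "C = path_edges (j # (p2 @ b # q1) @ [l]) \<union> path_edges (l # (q2 @ a # p1) @ [j])"
    by auto
  have dist1: "distinct (a # (p1 @ j # p2) @ b # (q1 @ l # q2))" using dist by simp
  have dist2: "distinct (j # (p2 @ b # q1) @ l # (q2 @ a # p1))" using dist by auto
  have CE: "C \<subseteq> Es" using cyc by (simp add: C_def)
  have sub1: "path_edges (a # (p1 @ j # p2) @ [b]) \<subseteq> Es" "path_edges (b # (q1 @ l # q2) @ [a]) \<subseteq> Es"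
    using CE C1 by blast+
  have sub2: "path_edges (j # (p2 @ b # q1) @ [l]) \<subseteq> Es" "path_edges (l # (q2 @ a # p1) @ [j]) \<subseteq> Es"
    using CE C2 by blast+
  obtain z where z: "z \<in> path_image (g {j, l})" "z \<in> inside (img C)"
    using chord_meets_cycle_inside[OF dist2 sub2 jl] C2 by auto
  define h where "h = g {j, l}"
  define M where "M = path_image h - {pathstart h, pathfinish h}"
  have h: "Path_Connected.arc h" using arc[OF jl] by (simp add: h_def)
  have hends: "{pathstart h, pathfinish h} = {F j, F l}" using ends[OF jl] by (simp add: h_def)
  have jV: "j \<in> V" "l \<in> V" using edge_sub[OF jl] by auto
  have conM: "connected M"
    unfolding M_def using h connected_simple_path_endless arc_imp_simple_path by blast
  have clM: "F j \<in> closure M" "F l \<in> closure M"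
    using endpoints_in_closure[OF h] hends unfolding M_def by (metis doubleton_eq_iff)+
  have nC: "{j, l} \<notin> insert {a, b} C"
  proof
    assume "{j, l} \<in> insert {a, b} C"
    moreover have "{j, l} \<noteq> {a, b}" using dist by (auto simp: doubleton_eq_iff)
    ultimately have "{j, l} \<in> C" by simp
    moreover have "{j, l} \<notin> path_edges (j # (p2 @ b # q1) @ [l])"
      using dist by (intro endpoints_not_path_edge) auto
    moreover have "{l, j} \<notin> path_edges (l # (q2 @ a # p1) @ [j])"
      using dist by (intro endpoints_not_path_edge) auto
    ultimately show False using C2 by (auto simp: insert_commute)
  qed
  have "img {{j, l}} \<inter> img (insert {a, b} C) \<subseteq> F ` (\<Union>{{j, l}} \<inter> \<Union>(insert {a, b} C))"
    using nC CE ab jl by (intro img_Int) auto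
  also have "\<dots> \<subseteq> {F j, F l}" by auto
  finally have disj: "M \<inter> img (insert {a, b} C) = {}"
    using hends unfolding M_def h_def img_def by auto
  have "M \<inter> inside (img C) = {}"
    using connected_misses_cycle_inside[OF dist1 sub1 ab _ jV(1) _ jV(2) conM _ clM] disj C1 by auto
  then have "z \<in> {F j, F l}" using z hends unfolding M_def h_def by auto
  moreover have "{F j, F l} \<subseteq> img C"
  proof -
    have "set (j # (p2 @ b # q1) @ [l]) \<subseteq> \<Union>(path_edges (j # (p2 @ b # q1) @ [l]))"
      by (rule set_subset_Union_path_edges) simp
    then have "j \<in> \<Union>C" "l \<in> \<Union>C" unfolding C2 by auto
    then show ?thesis using img_vertex[OF CE] by blast
  qed
  ultimately show False using z inside_no_overlap[of "img C"] by blast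
qed

end

definition plane_to_complex :: "plane \<Rightarrow> complex" where
  "plane_to_complex x = Complex (x $ 1) (x $ 2)"

lemma linear_plane_to_complex: "linear plane_to_complex"
  by (rule linearI) (simp_all add: plane_to_complex_def complex_eq_iff)

lemma norm_plane_to_complex: "norm (plane_to_complex x) = norm x"
  by (simp add: plane_to_complex_def norm_vec_def L2_set_def UNIV_2 cmod_def)

lemma inj_plane_to_complex: "inj plane_to_complex"
  using linear_plane_to_complex norm_plane_to_complex
  by (metis linear_injective_0 norm_eq_zero)

text \<open>The bijection \<open>plane_to_complex\<close> preserves norms, so it maps unbounded components of a complement
  to unbounded connected sets.\<close>

lemma outside_not_inside_plane_to_complex:
  assumes w: "w \<in> outside D" and X: "X \<subseteq> plane_to_complex ` D"
  shows "plane_to_complex w \<notin> inside X"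
proof
  let ?\<phi> = plane_to_complex
  assume ins: "?\<phi> w \<in> inside X"
  define K where "K = connected_component_set (- D) w"
  have wD: "w \<notin> D" and unb: "\<not> bounded K" using w by (auto simp: outside_def K_def)
  have "connected (?\<phi> ` K)"
    by (intro connected_continuous_image linear_continuous_on linear_plane_to_complex[unfolded linear_conv_bounded_linear])
      (simp add: K_def)
  moreover have "?\<phi> w \<in> ?\<phi> ` K" using wD by (simp add: K_def)
  moreover have "K \<subseteq> - D" by (simp add: K_def connected_component_subset)
  then have "?\<phi> ` K \<subseteq> - X" using X inj_plane_to_complex by (auto dest: injD)
  ultimately have "?\<phi> ` K \<subseteq> connected_component_set (- X) (?\<phi> w)"
    by (intro connected_component_maximal)
  moreover have "bounded (connected_component_set (- X) (?\<phi> w))" using ins by (simp add: inside_def)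
  ultimately have "bounded (?\<phi> ` K)" using bounded_subset by blast
  then have "bounded K" by (simp add: bounded_iff norm_plane_to_complex)
  then show False using unb by simp
qed

lemma drop_segment:
  assumes "i < j" "j < length xs"
  shows "drop i xs = xs ! i # take (j - Suc i) (drop (Suc i) xs) @ drop j xs"
proof -
  have "drop i xs = xs ! i # drop (Suc i) xs" using assms by (simp add: Cons_nth_drop_Suc)
  also have "drop (Suc i) xs = take (j - Suc i) (drop (Suc i) xs) @ drop (j - Suc i) (drop (Suc i) xs)"
    by (rule append_take_drop_id[symmetric])
  also have "drop (j - Suc i) (drop (Suc i) xs) = drop j xs" using assms by simp
  finally show ?thesis .
qed

lemma is_cycle_path_edges:
  assumes "is_cycle G xs"
  shows "path_edges (xs @ [hd xs]) \<subseteq> edges G"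
proof
  fix e assume "e \<in> path_edges (xs @ [hd xs])"
  then obtain i where i: "i < length xs" "e = {(xs @ [hd xs]) ! i, (xs @ [hd xs]) ! Suc i}"
    by (auto simp: path_edges_nth)
  have "(xs @ [hd xs]) ! Suc i = xs ! (Suc i mod length xs)"
  proof (cases "Suc i < length xs")
    case True then show ?thesis by (simp add: nth_append)
  next
    case False
    then have "Suc i = length xs" using i by simp
    moreover have "xs \<noteq> []" using i by auto
    ultimately show ?thesis by (simp add: nth_append hd_conv_nth)
  qed
  then show "e \<in> edges G" using i assms by (auto simp: is_cycle_def nth_append)
qed

lemma path_edges_rotate:
  "path_edges (ys @ xs @ [hd (ys @ xs)]) = path_edges (xs @ ys @ [hd (xs @ ys)])"
proof (cases "xs = [] \<or> ys = []")
  case False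
  then obtain x xs' y ys' where "xs = x # xs'" "ys = y # ys'" by (meson neq_Nil_conv)
  then show ?thesis
    using path_edges_append[of "y # ys'" x "xs' @ [y]"] path_edges_append[of "x # xs'" y "ys' @ [x]"] by auto
qed auto

theorem outerplanar_Hamilton_chords_not_interleaved:
  assumes out: "outerplanar H" and cyc: "is_cycle H xs"
    and ord: "i < j" "j < k" "k < l" "l < length xs"
    and ik: "{xs ! i, xs ! k} \<in> edges H" and jl: "{xs ! j, xs ! l} \<in> edges H"
  shows False
proof -
  let ?\<phi> = plane_to_complex
  from out obtain f g where emb: "planar_embedding H f g"
    and fr: "\<And>v. v \<in> verts H \<Longrightarrow> f v \<in> frontier (outside (drawing H f g))"
    and sg: "simple_graph H" unfolding outerplanar_def by blast
  interpret D: outerplane_drawing "verts H" "edges H" "?\<phi> \<circ> f" "\<lambda>e. ?\<phi> \<circ> g e"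
  proof
    show "inj_on (?\<phi> \<circ> f) (verts H)"
      using emb inj_plane_to_complex by (auto simp: planar_embedding_def inj_on_def)
  next
    fix e assume e: "e \<in> edges H"
    show "e \<subseteq> verts H" using sg e by (auto simp: simple_graph_def)
    show "arc (?\<phi> \<circ> g e)"
      using emb e arc_linear_image_eq[OF linear_plane_to_complex inj_plane_to_complex]
      by (auto simp: planar_embedding_def)
    have "{pathstart (g e), pathfinish (g e)} = f ` e" using emb e by (auto simp: planar_embedding_def)
    then have "?\<phi> ` {pathstart (g e), pathfinish (g e)} = ?\<phi> ` f ` e" by simp
    then show "{pathstart (?\<phi> \<circ> g e), pathfinish (?\<phi> \<circ> g e)} = (?\<phi> \<circ> f) ` e"
      by (simp add: pathstart_def pathfinish_def image_comp)
    have "path_image (g e) \<inter> f ` verts H = f ` e" using emb e by (auto simp: planar_embedding_def)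
    then have "?\<phi> ` path_image (g e) \<inter> ?\<phi> ` f ` verts H = ?\<phi> ` f ` e"
      using inj_plane_to_complex by (metis image_Int)
    then show "path_image (?\<phi> \<circ> g e) \<inter> (?\<phi> \<circ> f) ` verts H = (?\<phi> \<circ> f) ` e"
      by (simp add: path_image_compose image_comp)
  next
    fix e e' assume e: "e \<in> edges H" "e' \<in> edges H" "e \<noteq> e'"
    have "path_image (g e) \<inter> path_image (g e') \<subseteq> f ` (e \<inter> e')" using emb e by (auto simp: planar_embedding_def)
    then have "?\<phi> ` path_image (g e) \<inter> ?\<phi> ` path_image (g e') \<subseteq> ?\<phi> ` f ` (e \<inter> e')"
      using inj_plane_to_complex by (metis image_Int image_mono)
    then show "path_image (?\<phi> \<circ> g e) \<inter> path_image (?\<phi> \<circ> g e') \<subseteq> (?\<phi> \<circ> f) ` (e \<inter> e')"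
      by (simp add: path_image_compose image_comp)
  next
    fix v X assume v: "v \<in> verts H" and X: "closed X"
      "X \<subseteq> (?\<phi> \<circ> f) ` verts H \<union> (\<Union>e\<in>edges H. path_image (?\<phi> \<circ> g e))"
    have XD: "X \<subseteq> ?\<phi> ` drawing H f g"
      using X(2) by (simp add: drawing_def image_Un image_UN path_image_compose image_comp)
    show "(?\<phi> \<circ> f) v \<notin> inside X"
    proof
      assume "(?\<phi> \<circ> f) v \<in> inside X"
      then have "f v \<in> ?\<phi> -` inside X" by simp
      moreover have "open (?\<phi> -` inside X)"
        using X(1) by (intro open_vimage open_inside linear_continuous_on linear_plane_to_complex[unfolded linear_conv_bounded_linear])
      moreover have "f v \<in> closure (outside (drawing H f g))" using fr[OF v] by (simp add: frontier_def)
      ultimately obtain w where "w \<in> outside (drawing H f g)" "?\<phi> w \<in> inside X"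
        by (meson closure_iff_nhds_not_empty disjoint_iff subsetI vimageD)
      then show False using outside_not_inside_plane_to_complex XD by blast
    qed
  qed
  define p1 p2 q1 q2 pre where "p1 = take (j - Suc i) (drop (Suc i) xs)" and "p2 = take (k - Suc j) (drop (Suc j) xs)"
    and "q1 = take (l - Suc k) (drop (Suc k) xs)" and "q2 = drop (Suc l) xs" and "pre = take i xs"
  define suf where "suf = xs ! i # p1 @ xs ! j # p2 @ xs ! k # q1 @ xs ! l # q2"
  have "drop i xs = suf"
    using ord drop_segment[of i j xs] drop_segment[of j k xs] drop_segment[of k l xs] Cons_nth_drop_Suc[of l xs]
    unfolding suf_def p1_def p2_def q1_def q2_def by simp
  then have xs: "xs = pre @ suf" unfolding pre_def by (metis append_take_drop_id)
  have "distinct xs" using cyc unfolding is_cycle_def by blast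
  then have "distinct (suf @ pre)" using xs by auto
  moreover have "path_edges (suf @ pre @ [hd (suf @ pre)]) \<subseteq> edges H"
    using is_cycle_path_edges[OF cyc] unfolding path_edges_rotate[of suf pre] xs by simp
  ultimately show False
    using D.no_crossing_chords[of "xs ! i" p1 "xs ! j" p2 "xs ! k" q1 "xs ! l" "q2 @ pre"] ik jl
    unfolding suf_def by (simp del: path_edges.simps)
qed

section \<open>Non-crossing straight-line drawings on a given point set\<close>

text \<open>The element of rank \<open>j\<close> from above in \<open>F \<union> {0}\<close> is found first; \<open>t\<close> lies between it and the next one.\<close>

lemma exists_threshold:
  fixes F :: "real set"
  assumes "finite F" "F \<subseteq> {0<..<1}" "j \<le> card F"
  obtains t where "0 < t" "t < 1" "t \<notin> F" "card {x \<in> F. t < x} = j"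
proof -
  have F0: "0 \<notin> F" using assms by auto
  have "\<exists>x\<in>insert 0 F. card {y \<in> insert 0 F. x < y} = j"
  proof (rule exists_rank)
    show "finite (insert 0 F)" "j < card (insert 0 F)" using assms F0 by simp_all
  qed (simp, (rule less_trans; assumption), (simp add: neq_iff disj_commute))
  then obtain x where x: "x \<in> insert 0 F" "card {y \<in> insert 0 F. x < y} = j" by blast
  have x01: "0 \<le> x" "x < 1" using x assms by auto
  define S where "S = insert 1 {y \<in> F. x < y}"
  have S: "finite S" "S \<noteq> {}" using assms by (auto simp: S_def)
  define y where "y = Min S"
  have "y \<in> S" unfolding y_def using S by (rule Min_in)
  then have y: "x < y" using x01 by (auto simp: S_def)
  have y1: "y \<le> 1" using S unfolding y_def by (intro Min_le) (auto simp: S_def)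
  have ymin: "y \<le> z" if "z \<in> F" "x < z" for z
    using that S unfolding y_def by (intro Min_le) (auto simp: S_def)
  define t where "t = (x + y) / 2"
  have t: "x < t" "t < y" using y by (auto simp: t_def)
  have "{z \<in> F. t < z} = {z \<in> insert 0 F. x < z}" (is "?L = ?R")
  proof
    show "?L \<subseteq> ?R" using t by auto
    show "?R \<subseteq> ?L"
    proof
      fix z assume z: "z \<in> ?R"
      then have "z \<in> F" using x01 by auto
      then show "z \<in> ?L" using ymin[of z] z t by auto
    qed
  qed
  then have "card {z \<in> F. t < z} = j" using x(2) by simp
  moreover have "t \<notin> F" using ymin[of t] t by auto
  moreover have "0 < t" "t < 1" using t x01 y1 by auto
  ultimately show thesis using that by blast
qed

text \<open>The splitting step of the drawing algorithm of Gritzmann, Mohar, Pach and Pollack. Let \<open>p1 p2\<close>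
  be an edge of the convex hull. The triangle \<open>p1 p2 q\<close> shall be free of further points, and a line
  through \<open>q\<close> that meets the segment \<open>p1 p2\<close> shall have exactly \<open>k\<close> of the remaining points, the set
  \<open>A\<close>, on the side of \<open>p1\<close>. The left-hand sides of the first inequalities are, by affinity,
  \<open>orient q z\<close> for the point \<open>z = (1 - t) p1 + t p2\<close> of that line; the second ones say that
  \<open>p1 q\<close> and \<open>q p2\<close> are hull edges of the two parts, so that the step can be repeated.

  Every point \<open>s\<close> has an angle at \<open>p1\<close>, measured from \<open>p2\<close>, and an angle at \<open>p2\<close>, measured from
  \<open>p1\<close>. Among the points that have at least \<open>k\<close> points above them in the first order, \<open>q\<close> is chosen
  lowest in the second order. When the line turns about \<open>q\<close> from \<open>q p2\<close> to \<open>q p1\<close>, the number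
  of points on the side of \<open>p1\<close> grows from at most \<open>k\<close> to at least \<open>k\<close>, one point at a time.\<close>

lemma exists_apex:
  assumes fin: "finite Q" and k: "k < card Q"
    and hull: "\<And>r. r \<in> Q \<Longrightarrow> orient p1 p2 r > 0"
    and gp: "general_position (insert p1 (insert p2 Q))" and p12: "p1 \<noteq> p2"
  obtains q A B t where "q \<in> Q" "A \<union> B = Q - {q}" "A \<inter> B = {}" "card A = k" "0 < t" "t < 1"
    "\<forall>a\<in>A. (1 - t) * orient q p1 a + t * orient q p2 a < 0 \<and> orient p1 q a > 0"
    "\<forall>b\<in>B. (1 - t) * orient q p1 b + t * orient q p2 b > 0 \<and> orient q p2 b > 0"
proof -
  have pQ: "p1 \<notin> Q" "p2 \<notin> Q" using hull by fastforce+
  have ne: "orient a b c \<noteq> 0" if "a \<in> insert p1 (insert p2 Q)" "b \<in> insert p1 (insert p2 Q)"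
      "c \<in> insert p1 (insert p2 Q)" "a \<noteq> b" "a \<noteq> c" "b \<noteq> c" for a b c
    using gp that unfolding general_position_orient by blast
  have h: "- (p2 $ 2 - p1 $ 2) * (w $ 1 - u $ 1) + (p2 $ 1 - p1 $ 1) * (w $ 2 - u $ 2) = orient p1 p2 w"
    if "u \<in> {p1, p2}" for u w
    using that by (auto simp: orient_def algebra_simps)
  have tr: "orient u x z > 0" if "u \<in> {p1, p2}" "x \<in> Q" "y \<in> Q" "z \<in> Q" "orient u x y > 0" "orient u y z > 0" for u x y z
    by (rule orient_trans[OF that(5,6), of "- (p2 $ 2 - p1 $ 2)" "p2 $ 1 - p1 $ 1"])
      (use that hull h[OF that(1)] in \<open>simp only: insert_iff empty_iff; blast\<close>)
  have tot: "orient u x y > 0 \<or> orient u y x > 0" if "u \<in> {p1, p2}" "x \<in> Q" "y \<in> Q" "x \<noteq> y" for u x y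
  proof -
    have "u \<noteq> x" "u \<noteq> y" using that pQ by auto
    then have "orient u x y \<noteq> 0" using that by (intro ne) auto
    then show ?thesis using orient_swap23[of u x y] by linarith
  qed
  note tr1 = tr[of p1, simplified] and tr2 = tr[of p2, simplified]
  note tot1 = tot[of p1, simplified] and tot2 = tot[of p2, simplified]
  define up where "up r = card {s \<in> Q. orient p1 r s > 0}" for r
  \<comment> \<open>Each point of \<open>X\<close> has at least \<open>k\<close> points of larger angle at \<open>p1\<close>.\<close>
  define X where "X = {r \<in> Q. k \<le> up r}"
  have up_mono: "up r \<le> up s" if "r \<in> Q" "s \<in> Q" "orient p1 s r > 0" for r s
    unfolding up_def
  proof (rule card_mono)
    show "{t \<in> Q. 0 < orient p1 r t} \<subseteq> {t \<in> Q. 0 < orient p1 s t}" using that tr1[of s r] by blast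
  qed (use fin in simp)
  have "\<exists>x\<in>Q. card {y \<in> Q. orient p1 x y > 0} = k"
    by (rule exists_rank[OF fin k]) (simp, use tr1 in blast, use tot1 in blast)
  then have "X \<noteq> {}" by (auto simp: X_def up_def)
  moreover have finX: "finite X" and XQ: "X \<subseteq> Q" using fin by (auto simp: X_def)
  ultimately have "0 < card X" by (simp add: card_gt_0_iff)
  have "\<exists>x\<in>X. card {y \<in> X. orient p2 x y > 0} = 0"
    by (rule exists_rank[OF finX \<open>0 < card X\<close>]) (simp, use tr2 XQ in blast, use tot2 XQ in blast)
  then obtain q where qX: "q \<in> X" and q0: "\<And>y. y \<in> X \<Longrightarrow> \<not> orient p2 q y > 0"
    using finX by auto
  have q: "q \<in> Q" "k \<le> up q" using qX by (auto simp: X_def)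
  \<comment> \<open>\<open>Y\<close> are the points of smaller angle at \<open>p2\<close> than \<open>q\<close>, \<open>W\<close> those of larger angle at \<open>p1\<close>. The
    claim \<open>Y \<subseteq> W\<close> expresses that the triangle \<open>p1 p2 q\<close> is empty.\<close>
  define Y where "Y = {s \<in> Q. orient p2 q s > 0}"
  define W where "W = {s \<in> Q. orient p1 q s > 0}"
  have finY: "finite Y" "finite W" using fin by (auto simp: Y_def W_def)
  have YQ: "Y \<subseteq> Q" by (auto simp: Y_def)
  have YX: "y \<notin> X" if "y \<in> Y" for y using that q0 by (auto simp: Y_def)
  have YW: "Y \<subseteq> W"
  proof
    fix s assume s: "s \<in> Y"
    then have sQ: "s \<in> Q" "s \<noteq> q" by (auto simp: Y_def)
    have "\<not> orient p1 s q > 0"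
    proof
      assume "orient p1 s q > 0"
      then have "s \<in> X" using up_mono[of q s] q sQ by (auto simp: X_def)
      then show False using YX s by blast
    qed
    then show "s \<in> W" using tot1[of s q] sQ q by (auto simp: W_def)
  qed
  have cardY: "card Y \<le> k"
  proof (rule ccontr)
    assume "\<not> card Y \<le> k"
    then have "k < card Y" by simp
    have "\<exists>x\<in>Y. card {y \<in> Y. orient p1 x y > 0} = k"
      by (rule exists_rank[OF finY(1) \<open>k < card Y\<close>]) (simp, use tr1 YQ in blast, use tot1 YQ in blast)
    then obtain y where y: "y \<in> Y" "card {z \<in> Y. orient p1 y z > 0} = k" by blast
    have "card {z \<in> Y. orient p1 y z > 0} \<le> up y"
      unfolding up_def by (rule card_mono) (use fin in \<open>auto simp: Y_def\<close>)
    then have "y \<in> X" using y by (auto simp: X_def Y_def)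
    then show False using YX y by blast
  qed
  have cardW: "k \<le> card W" using q by (simp add: up_def W_def)
  define U where "U = W - Y"
  have cardU: "k - card Y \<le> card U" using cardW YW finY by (simp add: U_def card_Diff_subset)
  define \<alpha> \<beta> where "\<alpha> s = orient q p1 s" and "\<beta> s = orient q p2 s" for s
  have \<alpha>: "\<alpha> s = - orient p1 q s" and \<beta>: "\<beta> s = - orient p2 q s" for s
    unfolding \<alpha>_def \<beta>_def by (rule orient_swap)+
  have nz: "\<alpha> s \<noteq> 0" "\<beta> s \<noteq> 0" if "s \<in> Q" "s \<noteq> q" for s
    unfolding \<alpha>_def \<beta>_def using that q pQ by (intro ne; blast)+
  have U: "\<alpha> s < 0" "\<beta> s > 0" if "s \<in> U" for s
    using that nz[of s] \<alpha>[of s] \<beta>[of s] unfolding U_def W_def Y_def by fastforce+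
  \<comment> \<open>The parameter at which the rotating line through \<open>q\<close> passes the point \<open>s\<close>.\<close>
  define \<tau> where "\<tau> s = - \<alpha> s / (\<beta> s - \<alpha> s)" for s
  have inj: "inj_on \<tau> U"
  proof (rule inj_onI, rule ccontr)
    fix s r assume s: "s \<in> U" "r \<in> U" "\<tau> s = \<tau> r" "s \<noteq> r"
    have "\<beta> s - \<alpha> s \<noteq> 0" "\<beta> r - \<alpha> r \<noteq> 0" using U[of s] U[of r] s by auto
    then have "\<alpha> s * (\<beta> r - \<alpha> r) = \<alpha> r * (\<beta> s - \<alpha> s)"
      using s(3) unfolding \<tau>_def by (simp add: frac_eq_eq)
    then have "\<alpha> s * \<beta> r - \<alpha> r * \<beta> s = 0" by (simp add: algebra_simps)
    moreover have "\<alpha> s * \<beta> r - \<alpha> r * \<beta> s = orient q p1 p2 * orient q s r"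
      by (simp add: \<alpha>_def \<beta>_def orient_def algebra_simps)
    moreover have "orient q p1 p2 \<noteq> 0" using ne[of q p1 p2] q pQ p12 by auto
    moreover have "s \<noteq> q" "r \<noteq> q" "s \<in> Q" "r \<in> Q" using s by (auto simp: U_def W_def)
    then have "orient q s r \<noteq> 0" using ne[of q s r] s q by simp
    ultimately show False by simp
  qed
  have \<tau>01: "\<tau> ` U \<subseteq> {0<..<1}"
    using U by (auto simp: \<tau>_def divide_simps) (smt (verit))+
  obtain t where t: "0 < t" "t < 1" "t \<notin> \<tau> ` U" "card {x \<in> \<tau> ` U. t < x} = k - card Y"
  proof (rule exists_threshold[of "\<tau> ` U" "k - card Y"])
    show "finite (\<tau> ` U)" using finY by (simp add: U_def)
    show "k - card Y \<le> card (\<tau> ` U)" using cardU inj by (simp add: card_image)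
  qed (use \<tau>01 in auto)
  define l where "l s = (1 - t) * \<alpha> s + t * \<beta> s" for s
  have lU: "l s < 0 \<longleftrightarrow> t < \<tau> s" "l s = 0 \<longleftrightarrow> t = \<tau> s" if "s \<in> U" for s
  proof -
    have d: "\<beta> s - \<alpha> s > 0" using U[OF that] by simp
    have "l s = (\<beta> s - \<alpha> s) * (t - \<tau> s)" using d by (simp add: l_def \<tau>_def field_simps)
    then show "l s < 0 \<longleftrightarrow> t < \<tau> s" "l s = 0 \<longleftrightarrow> t = \<tau> s" using d by (auto simp: mult_less_0_iff)
  qed
  have lY: "l s < 0" "\<alpha> s < 0" if "s \<in> Y" for s
  proof -
    show a: "\<alpha> s < 0" using that YW \<alpha>[of s] by (auto simp: W_def)
    have "\<beta> s < 0" using that \<beta>[of s] by (auto simp: Y_def)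
    then show "l s < 0" unfolding l_def using a t by (smt (verit) mult_pos_neg)
  qed
  have lN: "l s > 0" "\<beta> s > 0" if "s \<in> Q" "s \<noteq> q" "s \<notin> W" for s
  proof -
    show b: "\<beta> s > 0" using that YW nz[of s] \<beta>[of s] by (auto simp: Y_def)
    have "\<alpha> s > 0" using that nz[of s] \<alpha>[of s] by (auto simp: W_def)
    then show "l s > 0" unfolding l_def using b t by (smt (verit) mult_pos_pos)
  qed
  have WU: "W = Y \<union> U" "Y \<inter> U = {}" using YW by (auto simp: U_def)
  define A where "A = Y \<union> {s \<in> U. t < \<tau> s}"
  define B where "B = Q - {q} - A"
  have qW: "q \<notin> W" by (simp add: W_def)
  have AQ: "A \<subseteq> Q - {q}" using WU qW by (auto simp: A_def W_def)
  show thesis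
  proof (rule that[of q A B t])
    show "q \<in> Q" "0 < t" "t < 1" using q t by auto
    show "A \<union> B = Q - {q}" "A \<inter> B = {}" using AQ by (auto simp: B_def)
    have "{x \<in> \<tau> ` U. t < x} = \<tau> ` {s \<in> U. t < \<tau> s}" by auto
    moreover have "inj_on \<tau> {s \<in> U. t < \<tau> s}" using inj by (rule inj_on_subset) auto
    ultimately have "card {s \<in> U. t < \<tau> s} = k - card Y" using t(4) by (simp add: card_image)
    then show "card A = k"
      unfolding A_def using finY cardY WU(2) by (subst card_Un_disjoint) (auto simp: U_def)
    show "\<forall>a\<in>A. (1 - t) * orient q p1 a + t * orient q p2 a < 0 \<and> orient p1 q a > 0"
    proof (intro ballI conjI)
      fix a assume a: "a \<in> A"
      then have "l a < 0" using lY lU by (auto simp: A_def)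
      then show "(1 - t) * orient q p1 a + t * orient q p2 a < 0" by (simp add: l_def \<alpha>_def \<beta>_def)
      have "a \<in> W" using a WU by (auto simp: A_def)
      then show "orient p1 q a > 0" by (simp add: W_def)
    qed
    show "\<forall>b\<in>B. (1 - t) * orient q p1 b + t * orient q p2 b > 0 \<and> orient q p2 b > 0"
    proof (intro ballI)
      fix b assume b: "b \<in> B"
      have "l b > 0 \<and> \<beta> b > 0"
      proof (cases "b \<in> W")
        case True
        then have bU: "b \<in> U" "\<not> t < \<tau> b" using b WU by (auto simp: A_def B_def)
        moreover have "t \<noteq> \<tau> b" using t(3) bU by auto
        ultimately have "l b > 0" using lU[of b] by linarith
        then show ?thesis using U bU by blast
      qed (use b lN in \<open>auto simp: B_def\<close>)
      then show "(1 - t) * orient q p1 b + t * orient q p2 b > 0 \<and> orient q p2 b > 0"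
        by (simp add: l_def \<alpha>_def \<beta>_def)
    qed
  qed
qed

definition draws_noncrossing :: "(nat \<times> nat) set \<Rightarrow> nat \<Rightarrow> nat \<Rightarrow> (nat \<Rightarrow> plane) \<Rightarrow> bool" where
  "draws_noncrossing E lo hi f \<longleftrightarrow> (\<forall>i j k l. (i, j) \<in> E \<and> (k, l) \<in> E \<and> lo \<le> i \<and> j \<le> hi \<and> lo \<le> k \<and> l \<le> hi \<and>
     (i, j) \<noteq> (k, l) \<longrightarrow> open_segment (f i) (f j) \<inter> open_segment (f k) (f l) = {})"

text \<open>Induction over intervals of vertices. Let \<open>w\<close> be the last neighbour of \<open>lo\<close> before \<open>hi\<close>. Except
  for the pair \<open>(lo, hi)\<close>, no pair in \<open>E\<close> jumps over \<open>w\<close>, since it would interleave with \<open>(lo, w)\<close>.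
  So \<open>w\<close> is placed on the apex found above, and the intervals \<open>{lo..w}\<close> and \<open>{w..hi}\<close> are drawn on
  the two sides of the separating line.\<close>

theorem noncrossing_embedding_on_points:
  fixes E :: "(nat \<times> nat) set"
  assumes ord: "\<And>i j. (i, j) \<in> E \<Longrightarrow> i < j"
    and nonint: "\<And>i j k l. (i, k) \<in> E \<Longrightarrow> (j, l) \<in> E \<Longrightarrow> i < j \<Longrightarrow> j < k \<Longrightarrow> k < l \<Longrightarrow> False"
  shows "\<lbrakk>lo < hi; finite Q; Suc (card Q + lo) = hi; p1 \<noteq> p2; \<And>r. r \<in> Q \<Longrightarrow> orient p1 p2 r > 0;
      general_position (insert p1 (insert p2 Q))\<rbrakk> \<Longrightarrow>
    \<exists>f. f lo = p1 \<and> f hi = p2 \<and> inj_on f {lo..hi} \<and> f ` {lo..hi} = insert p1 (insert p2 Q) \<and>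
      draws_noncrossing E lo hi f"
proof (induction "hi - lo" arbitrary: lo hi p1 p2 Q rule: less_induct)
  case less
  note hull = less.prems(5)
  show ?case
  proof (cases "hi = Suc lo")
    case True
    then have "Q = {}" using less.prems by simp
    define f where "f x = (if x = lo then p1 else p2)" for x :: nat
    have 1: "{lo..hi} = {lo, hi}" using True by auto
    have 2: "i = lo \<and> j = hi" if "(i, j) \<in> E" "lo \<le> i" "j \<le> hi" for i j
      using ord[OF that(1)] that True by linarith
    show ?thesis
    proof (intro exI[of _ f] conjI)
      show "inj_on f {lo..hi}" unfolding 1 using True less.prems(4) by (simp add: f_def)
      show "f ` {lo..hi} = insert p1 (insert p2 Q)" unfolding 1 using True \<open>Q = {}\<close> by (simp add: f_def insert_commute)
      show "draws_noncrossing E lo hi f" unfolding draws_noncrossing_def using 2 by blast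
    qed (use True in \<open>simp_all add: f_def\<close>)
  next
    case False
    define N where "N = insert (Suc lo) {j. (lo, j) \<in> E \<and> j < hi}"
    define w where "w = Max N"
    have N: "finite N" "N \<noteq> {}" unfolding N_def by auto
    have wN: "w \<in> N" unfolding w_def using N by (rule Max_in)
    have wmax: "j \<le> w" if "j \<in> N" for j unfolding w_def using N that by simp
    have w: "lo < w" "w < hi" using wN False less.prems(1) ord unfolding N_def by auto
    have split: "(i = lo \<and> j = hi) \<or> j \<le> w \<or> w \<le> i" if ij: "(i, j) \<in> E" "lo \<le> i" "j \<le> hi" for i j
    proof (rule ccontr)
      assume "\<not> ?thesis"
      then have n: "\<not> (i = lo \<and> j = hi)" "w < j" "i < w" by auto
      show False
      proof (cases "i = lo")
        case True
        then have "j \<in> N" using n ij unfolding N_def by auto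
        then show False using wmax n by fastforce
      next
        case False
        then have "lo < i" using ij by simp
        then have "(lo, w) \<in> E" using wN n unfolding N_def by auto
        then show False using nonint[of lo w i j] ij n \<open>lo < i\<close> by blast
      qed
    qed
    have kQ: "w - Suc lo < card Q" using w less.prems(3) by linarith
    obtain q A B t where q: "q \<in> Q" and AB: "A \<union> B = Q - {q}" "A \<inter> B = {}" and cA: "card A = w - Suc lo"
      and t: "0 < t" "t < 1"
      and ballA: "\<forall>a\<in>A. (1 - t) * orient q p1 a + t * orient q p2 a < 0 \<and> orient p1 q a > 0"
      and ballB: "\<forall>b\<in>B. (1 - t) * orient q p1 b + t * orient q p2 b > 0 \<and> orient q p2 b > 0"
      by (rule exists_apex[OF less.prems(2) kQ hull less.prems(6) less.prems(4)])
    have lA: "(1 - t) * orient q p1 a + t * orient q p2 a < 0" and oA: "orient p1 q a > 0" if "a \<in> A" for a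
      using ballA that by blast+
    have lB: "(1 - t) * orient q p1 b + t * orient q p2 b > 0" and oB: "orient q p2 b > 0" if "b \<in> B" for b
      using ballB that by blast+
    have fin: "finite A" "finite B" using AB less.prems(2) by (metis finite_Diff finite_Un)+
    have "card A + card B = card Q - 1" using AB fin q less.prems(2) by (metis card_Diff_singleton card_Un_disjoint)
    then have cB: "Suc (card B + w) = hi" using cA w less.prems(3) kQ by linarith
    have cA': "Suc (card A + lo) = w" using cA w by simp
    have pq: "p1 \<noteq> q" "q \<noteq> p2" using hull[OF q] by auto
    have gpA: "general_position (insert p1 (insert q A))" and gpB: "general_position (insert q (insert p2 B))"
      by (rule general_position_subset[OF less.prems(6)]; use AB q in blast)+
    obtain f1 where f1: "f1 lo = p1" "f1 w = q" "inj_on f1 {lo..w}" "f1 ` {lo..w} = insert p1 (insert q A)" "draws_noncrossing E lo w f1"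
    proof -
      have "w - lo < hi - lo" using w by simp
      from less.hyps[of w lo A p1 q, OF this w(1) fin(1) cA' pq(1) oA gpA] show ?thesis
        using that by blast
    qed
    obtain f2 where f2: "f2 w = q" "f2 hi = p2" "inj_on f2 {w..hi}" "f2 ` {w..hi} = insert q (insert p2 B)" "draws_noncrossing E w hi f2"
    proof -
      have "hi - w < hi - lo" using w by simp
      from less.hyps[of hi w B q p2, OF this w(2) fin(2) cB pq(2) oB gpB] show ?thesis
        using that by blast
    qed
    define f where "f x = (if x \<le> w then f1 x else f2 x)" for x
    have fl: "f x = f1 x" if "x \<le> w" for x using that by (simp add: f_def)
    have fr: "f x = f2 x" if "w \<le> x" for x using that f1(2) f2(1) by (cases "x = w") (auto simp: f_def)
    define h where "h z = (1 - t) * orient q p1 z + t * orient q p2 z" for z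
    have haff: "h ((1 - u) *\<^sub>R x + u *\<^sub>R y) = (1 - u) * h x + u * h y" for u x y
      unfolding h_def orient_convex by (simp add: algebra_simps)
    have hq: "h q = 0" by (simp add: h_def)
    have "orient q p2 p1 = - orient p1 p2 q" "orient q p1 p2 = orient p1 p2 q" by (simp_all add: orient_def algebra_simps)
    then have hp: "h p1 < 0" "h p2 > 0" using hull[OF q] t by (simp_all add: h_def)
    have hl: "h (f x) < 0" if "lo \<le> x" "x < w" for x
    proof -
      have "f1 x \<in> insert p1 (insert q A)" using f1(4) that by force
      moreover have "f1 x \<noteq> q" using f1(2,3) that w by (metis atLeastAtMost_iff inj_onD less_imp_le order_refl order_less_irrefl)
      ultimately show ?thesis using fl[of x] that hp lA unfolding h_def by auto
    qed
    have hr: "h (f x) > 0" if "w < x" "x \<le> hi" for x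
    proof -
      have "f2 x \<in> insert q (insert p2 B)" using f2(4) that by force
      moreover have "f2 x \<noteq> q" using f2(1,3) that w by (metis atLeastAtMost_iff inj_onD less_imp_le order_refl order_less_irrefl)
      ultimately show ?thesis using fr[of x] that hp lB unfolding h_def by auto
    qed
    have fw: "f w = q" using fl f1 by simp
    have "f ` {lo..hi} = f1 ` {lo..w} \<union> f2 ` {w..hi}"
    proof -
      have "{lo..hi} = {lo..w} \<union> {w..hi}" using w by auto
      moreover have "f ` {lo..w} = f1 ` {lo..w}" "f ` {w..hi} = f2 ` {w..hi}" using fl fr by auto
      ultimately show ?thesis by (simp add: image_Un)
    qed
    also have "\<dots> = insert p1 (insert p2 Q)" unfolding f1(4) f2(4) using AB q by blast
    finally have im: "f ` {lo..hi} = insert p1 (insert p2 Q)" .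
    have "card (insert p1 (insert p2 Q)) = card {lo..hi}"
    proof -
      have "p1 \<notin> Q" "p2 \<notin> Q" using hull by fastforce+
      then show ?thesis using less.prems(1-4) by simp
    qed
    then have inj: "inj_on f {lo..hi}" using im by (intro eq_card_imp_inj_on) auto
    have flo: "f lo = p1" and fhi: "f hi = p2" using fl fr f1 f2 w by auto
    have ostr: "orient p1 p2 (f x) > 0" if "lo < x" "x < hi" for x
    proof -
      have "f x \<in> insert p1 (insert p2 Q)" using im that by force
      moreover have "f x \<noteq> p1" "f x \<noteq> p2" using inj flo fhi that inj_on_eq_iff[OF inj, of x lo] inj_on_eq_iff[OF inj, of x hi] by auto
      ultimately show ?thesis using hull by auto
    qed
    have outer: "open_segment p1 p2 \<inter> open_segment (f i) (f j) = {}"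
      if "(i, j) \<in> E" "lo \<le> i" "j \<le> hi" "(i, j) \<noteq> (lo, hi)" for i j
    proof (rule open_segment_one_side)
      have ij: "i < j" using ord that by blast
      show "orient p1 p2 (f i) \<ge> 0"
        using ostr[of i] flo that ij by (cases "i = lo") auto
      show "orient p1 p2 (f j) \<ge> 0"
        using ostr[of j] fhi that ij by (cases "j = hi") auto
      show "orient p1 p2 (f i) \<noteq> 0 \<or> orient p1 p2 (f j) \<noteq> 0"
        using ostr[of i] ostr[of j] that ij by (cases "i = lo") auto
    qed
    have LR: "open_segment (f i) (f j) \<inter> open_segment (f k) (f l) = {}"
      if "(i, j) \<in> E" "lo \<le> i" "j \<le> w" "(k, l) \<in> E" "w \<le> k" "l \<le> hi" for i j k l
    proof (rule linear_separates_segments[of h])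
      have ij: "i < j" "k < l" using ord that by blast+
      show "h (f i) \<le> 0" "h (f i) \<noteq> 0 \<or> h (f j) \<noteq> 0" using hl[of i] that ij by auto
      show "h (f j) \<le> 0" using hl[of j] that ij hq fw by (cases "j = w") auto
      show "h (f k) \<ge> 0" using hr[of k] that ij hq fw by (cases "k = w") auto
      show "h (f l) \<ge> 0" using hr[of l] that ij by auto
    qed (rule haff)
    show ?thesis
    proof (intro exI[of _ f] conjI flo fhi inj im, unfold draws_noncrossing_def, intro allI impI)
      fix i j k l
      assume asm: "(i, j) \<in> E \<and> (k, l) \<in> E \<and> lo \<le> i \<and> j \<le> hi \<and> lo \<le> k \<and> l \<le> hi \<and> (i, j) \<noteq> (k, l)"
      then have o: "i < j" "k < l" using ord by blast+
      consider "i = lo \<and> j = hi" | "k = lo \<and> l = hi" | "j \<le> w" "l \<le> w" | "j \<le> w" "w \<le> k" | "w \<le> i" "l \<le> w" | "w \<le> i" "w \<le> k"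
        using split[of i j] split[of k l] asm by blast
      then show "open_segment (f i) (f j) \<inter> open_segment (f k) (f l) = {}"
      proof cases
        case 1 then show ?thesis using outer[of k l] asm flo fhi by auto
      next
        case 2 then show ?thesis using outer[of i j] asm flo fhi by auto
      next
        case 3
        then have "f i = f1 i" "f j = f1 j" "f k = f1 k" "f l = f1 l" using fl o by auto
        then show ?thesis using f1(5) asm 3 unfolding draws_noncrossing_def by simp
      next
        case 4 then show ?thesis using LR asm by blast
      next
        case 5 then show ?thesis using LR[of k l i j] asm by blast
      next
        case 6
        then have "f i = f2 i" "f j = f2 j" "f k = f2 k" "f l = f2 l" using fr o by auto
        then show ?thesis using f2(5) asm 6 unfolding draws_noncrossing_def by simp
      qed
    qed
  qed
qed

text \<open>A point of maximal norm will do, as one sees by expanding the square of \<open>x - p\<close>.\<close>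

lemma exists_exposed_point:
  assumes "finite P" "P \<noteq> {}"
  obtains p h1 h2 where "p \<in> P" "\<And>x. x \<in> P \<Longrightarrow> x \<noteq> p \<Longrightarrow> h1 * (x $ 1 - p $ 1) + h2 * (x $ 2 - (p :: plane) $ 2) > 0"
proof -
  let ?n = "\<lambda>x::plane. (x $ 1)\<^sup>2 + (x $ 2)\<^sup>2"
  have "Max (?n ` P) \<in> ?n ` P" using assms by (intro Max_in) auto
  then obtain p where p: "p \<in> P" "?n p = Max (?n ` P)" by auto
  have max: "?n x \<le> ?n p" if "x \<in> P" for x using that assms p by simp
  show thesis
  \<comment> \<open>The linear form is minus the inner product with \<open>p\<close>.\<close>
  proof (rule that[of p "- p $ 1" "- p $ 2"])
    fix x assume x: "x \<in> P" "x \<noteq> p"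
    then have "(x $ 1 - p $ 1)\<^sup>2 + (x $ 2 - p $ 2)\<^sup>2 > 0"
      by (metis eq_iff_diff_eq_0 plane_eq_iff sum_power2_gt_zero_iff)
    moreover define d where "d = (- p $ 1) * (x $ 1 - p $ 1) + (- p $ 2) * (x $ 2 - p $ 2)"
    ultimately have "2 * d > ?n p - ?n x"
      by (simp add: power2_eq_square algebra_simps)
    then have "d > 0" using max[OF x(1)] by linarith
    then show "(- p $ 1) * (x $ 1 - p $ 1) + (- p $ 2) * (x $ 2 - p $ 2) > 0" unfolding d_def .
  qed (rule p(1))
qed

lemma exists_angular_rank:
  assumes gp: "general_position P" and "p \<in> P" and X: "X \<subseteq> P - {p}"
    and h: "\<And>x. x \<in> P \<Longrightarrow> x \<noteq> p \<Longrightarrow> h1 * (x $ 1 - p $ 1) + h2 * (x $ 2 - p $ 2) > 0"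
    and k: "k < card X"
  shows "\<exists>x\<in>X. card {y \<in> X. orient p x y < 0} = k"
proof -
  have "\<exists>x\<in>X. card {y \<in> X. orient p y x > 0} = k"
  proof (rule exists_rank[OF _ k])
    show "finite X" using gp X finite_subset unfolding general_position_def by blast
  next
    fix x y z assume "x \<in> X" "y \<in> X" "z \<in> X" and o: "orient p x y > 0" "orient p y z > 0"
    then show "orient p x z > 0"
      by (intro orient_trans[OF o, of h1 h2]) (use X h in blast)
  next
    fix x y assume "x \<in> X" "y \<in> X" "x \<noteq> y"
    then have "orient p x y \<noteq> 0"
      by (intro general_position_orient_neq[OF gp]) (use X assms(2) in auto)
    then show "orient p x y > 0 \<or> orient p y x > 0" using orient_swap23[of p x y] by linarith
  qed simp
  moreover have "orient p y x > 0 \<longleftrightarrow> orient p x y < 0" for x y using orient_swap23[of p x y] by linarith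
  ultimately show ?thesis by simp
qed

text \<open>From an exposed point all other points are seen in an open half-plane; the first one in angular
  order completes a hull edge.\<close>

lemma exists_hull_edge:
  assumes gp: "general_position P" and "card P \<ge> 2"
  obtains p q where "p \<in> P" "q \<in> P" "p \<noteq> q" "\<And>r. r \<in> P - {p, q} \<Longrightarrow> orient p q r > 0"
proof -
  have fin: "finite P" "P \<noteq> {}" using assms by (auto simp: general_position_def)
  obtain p h1 h2 where p: "p \<in> P" and h: "\<And>x. x \<in> P \<Longrightarrow> x \<noteq> p \<Longrightarrow> h1 * (x $ 1 - p $ 1) + h2 * (x $ 2 - p $ 2) > 0"
    using exists_exposed_point[OF fin] by blast
  have "0 < card (P - {p})" using assms p fin by simp
  from exists_angular_rank[OF gp p subset_refl h this]
  obtain q where q: "q \<in> P - {p}" "card {y \<in> P - {p}. orient p q y < 0} = 0" by blast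
  then have "{y \<in> P - {p}. orient p q y < 0} = {}" using fin by simp
  then have nn: "\<not> orient p q r < 0" if "r \<in> P - {p, q}" for r using that by blast
  have ne: "orient p q r \<noteq> 0" if "r \<in> P - {p, q}" for r
    by (rule general_position_orient_neq[OF gp]) (use that q p in auto)
  have o: "orient p q r > 0" if "r \<in> P - {p, q}" for r using nn[OF that] ne[OF that] by linarith
  show thesis
  proof (rule that[of p q])
    show "q \<in> P" "p \<noteq> q" using q by auto
  qed (rule p, rule o)
qed

text \<open>Copies are constructed from injections of the vertices. The last assumption ranges over all
  ways to write an edge as a pair.\<close>

lemma has_mono_non_crossing_copyI:
  assumes sg: "simple_graph G" and inj: "inj_on f (verts G)" and fP: "f ` verts G \<subseteq> P"
    and col: "\<And>e. e \<in> edges G \<Longrightarrow> c (f ` e) = k"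
    and nc: "\<And>a b x y. {a, b} \<in> edges G \<Longrightarrow> {x, y} \<in> edges G \<Longrightarrow> {a, b} \<noteq> {x, y} \<Longrightarrow>
      open_segment (f a) (f b) \<inter> open_segment (f x) (f y) = {}"
  shows "has_mono_non_crossing_copy P c k G"
proof -
  define S where "S = (f ` verts G, (\<lambda>e. f ` e) ` edges G)"
  have e: "e \<subseteq> verts G" "card e = 2" if "e \<in> edges G" for e using sg that by (auto simp: simple_graph_def)
  have card: "card (f ` e) = 2" if "e \<in> edges G" for e
    using e[OF that] inj by (metis card_image inj_on_subset)
  have "simple_graph S"
    using sg e card by (auto simp: S_def simple_graph_def)
  moreover have "edges S \<subseteq> edges (complete_geometric_graph P)"
  proof
    fix d assume "d \<in> edges S"
    then obtain e' where e': "e' \<in> edges G" "d = f ` e'" by (auto simp: S_def)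
    then obtain p q where "d = {p, q}" "p \<noteq> q" using card[of e'] by (auto simp: card_2_iff)
    moreover have "d \<subseteq> P" using e' e fP by blast
    ultimately show "d \<in> edges (complete_geometric_graph P)" by (auto simp: complete_geometric_graph_def)
  qed
  ultimately have "subgraph S (complete_geometric_graph P)"
    using fP by (simp add: subgraph_def S_def complete_geometric_graph_def)
  moreover have "non_crossing S"
    unfolding non_crossing_def
  proof (intro ballI notI)
    fix d d' assume d: "d \<in> edges S" "d' \<in> edges S" and cr: "edges_cross d d'"
    then obtain e1 e2 where e12: "e1 \<in> edges G" "d = f ` e1" "e2 \<in> edges G" "d' = f ` e2" by (auto simp: S_def)
    obtain a b where ab: "e1 = {a, b}" using e(2)[OF e12(1)] by (auto simp: card_2_iff)
    obtain x y where xy: "e2 = {x, y}" using e(2)[OF e12(3)] by (auto simp: card_2_iff)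
    obtain p q r s where pq: "d = {p, q}" "d' = {r, s}" "open_segment p q \<inter> open_segment r s \<noteq> {}" and ne: "d \<noteq> d'"
      using cr unfolding edges_cross_def by blast
    have "{f a, f b} = {p, q}" "{f x, f y} = {r, s}" using pq e12 ab xy by auto
    then have "open_segment (f a) (f b) = open_segment p q" "open_segment (f x) (f y) = open_segment r s"
      by (metis doubleton_eq_iff open_segment_commute)+
    moreover have "e1 \<noteq> e2" using ne e12 by auto
    then have "open_segment (f a) (f b) \<inter> open_segment (f x) (f y) = {}" using nc[of a b x y] e12 ab xy by simp
    ultimately show False using pq(3) by (simp only: simp_thms)
  qed
  moreover have "\<forall>e\<in>edges S. c e = k" using col by (auto simp: S_def)
  moreover have "graph_iso S G"
  proof -
    let ?g = "inv_into (verts G) f"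
    have "bij_betw ?g (verts S) (verts G)"
      using inj by (simp add: S_def bij_betw_inv_into inj_on_imp_bij_betw)
    moreover have "?g ` f ` e' = e'" if "e' \<in> edges G" for e'
      using e(1)[OF that] inj by (simp add: inv_into_image_cancel)
    then have "(\<lambda>e. ?g ` e) ` edges S = edges G" by (force simp: S_def image_image)
    ultimately show ?thesis unfolding graph_iso_def by blast
  qed
  ultimately show ?thesis unfolding has_mono_non_crossing_copy_def by blast
qed

text \<open>All edges between points of \<open>I\<close> have the right colour, so any non-crossing drawing of \<open>H\<close> on \<open>I\<close>
  will do. The vertices are drawn in their order along the Hamilton cycle.\<close>

lemma mono_clique_has_outerplanar_copy:
  assumes out: "outerplanar H" and ham: "has_Hamilton_cycle H"
    and IP: "I \<subseteq> P" and gp: "general_position I" and card: "card I = card (verts H)"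
    and col: "\<And>x y. x \<in> I \<Longrightarrow> y \<in> I \<Longrightarrow> x \<noteq> y \<Longrightarrow> c {x, y} = k"
  shows "has_mono_non_crossing_copy P c k H"
proof -
  obtain xs where cyc: "is_cycle H xs" and xs: "set xs = verts H" using ham unfolding has_Hamilton_cycle_def by blast
  have dist: "distinct xs" "length xs \<ge> 3" using cyc unfolding is_cycle_def by blast+
  define m where "m = length xs"
  have m: "m \<ge> 3" "card I = m" using dist card xs distinct_card unfolding m_def by force+
  have sg: "simple_graph H" using out by (simp add: outerplanar_def)
  obtain p q where pq: "p \<in> I" "q \<in> I" "p \<noteq> q" and hull: "\<And>r. r \<in> I - {p, q} \<Longrightarrow> orient p q r > 0"
    using exists_hull_edge[OF gp] m by auto
  define Q where "Q = I - {p, q}"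
  have IQ: "I = insert p (insert q Q)" using pq by (auto simp: Q_def)
  have finI: "finite I" using gp by (simp add: general_position_def)
  have cardQ: "Suc (card Q + 0) = m - 1" using m pq finI by (simp add: Q_def card_Diff_subset)
  have hullQ: "orient p q r > 0" if "r \<in> Q" for r using hull that by (simp add: Q_def)
  have gpQ: "general_position (insert p (insert q Q))" using gp IQ by simp
  have finQ: "finite Q" using finI by (simp add: Q_def)
  have m0: "0 < m - 1" using m by simp
  define E where "E = {(i, j). i < j \<and> j < m \<and> {xs ! i, xs ! j} \<in> edges H}"
  have "\<exists>g. g 0 = p \<and> g (m - 1) = q \<and> inj_on g {0..m - 1} \<and> g ` {0..m - 1} = insert p (insert q Q) \<and>
      draws_noncrossing E 0 (m - 1) g"
  proof (rule noncrossing_embedding_on_points[OF _ _ m0 finQ cardQ pq(3) hullQ gpQ])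
    fix i j k l assume "(i, k) \<in> E" "(j, l) \<in> E" "i < j" "j < k" "k < l"
    then show False
      using outerplanar_Hamilton_chords_not_interleaved[OF out cyc, of i j k l] by (auto simp: E_def m_def)
  qed (auto simp: E_def)
  then obtain g where g: "inj_on g {0..m - 1}" "g ` {0..m - 1} = I" and gall: "draws_noncrossing E 0 (m - 1) g"
    unfolding IQ[symmetric] by blast
  have gnc: "open_segment (g i) (g j) \<inter> open_segment (g k) (g l) = {}"
    if "(i, j) \<in> E" "(k, l) \<in> E" "(i, j) \<noteq> (k, l)" for i j k l
  proof -
    have "j \<le> m - 1" "l \<le> m - 1" using that(1,2) unfolding E_def by auto
    then show ?thesis using gall that unfolding draws_noncrossing_def by simp
  qed
  have lessm: "{0..m - 1} = {..<m}" using m by auto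
  define idx where "idx = inv_into {..<m} (nth xs)"
  have bij: "bij_betw (nth xs) {..<m} (verts H)" using dist xs by (simp add: bij_betw_nth m_def)
  have idx: "idx v < m" "xs ! idx v = v" if "v \<in> verts H" for v
    using that bij unfolding idx_def bij_betw_def by (metis inv_into_into lessThan_iff, metis f_inv_into_f)
  have inj_idx: "inj_on idx (verts H)" by (rule inj_on_inverseI[of _ "nth xs"]) (rule idx(2))
  define f where "f v = g (idx v)" for v
  show ?thesis
  proof (rule has_mono_non_crossing_copyI[OF sg])
    show inj: "inj_on f (verts H)"
      using g(1) inj_idx idx(1) unfolding f_def lessm by (auto simp: inj_on_def)
    have fI: "f ` verts H \<subseteq> I" using g(2) idx unfolding f_def lessm by auto
    then show "f ` verts H \<subseteq> P" using IP by blast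
    fix e assume e: "e \<in> edges H"
    then obtain a b where ab: "e = {a, b}" "a \<noteq> b" "a \<in> verts H" "b \<in> verts H"
      using sg by (auto simp: simple_graph_def card_2_iff)
    then have "f a \<noteq> f b" "f a \<in> I" "f b \<in> I" using inj fI by (auto simp: inj_on_def)
    then show "c (f ` e) = k" using col ab by simp
  next
    have E: "\<exists>i j. (i, j) \<in> E \<and> {a, b} = {xs ! i, xs ! j} \<and> open_segment (f a) (f b) = open_segment (g i) (g j)"
      if ab: "{a, b} \<in> edges H" for a b
    proof -
      have v: "a \<in> verts H" "b \<in> verts H" "a \<noteq> b" using sg ab by (auto simp: simple_graph_def)
      then have "idx a \<noteq> idx b" using inj_idx by (auto simp: inj_on_def)
      then consider "idx a < idx b" | "idx b < idx a" by linarith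
      then show ?thesis
      proof cases
        case 1
        then show ?thesis using v idx ab by (intro exI[of _ "idx a"] exI[of _ "idx b"]) (auto simp: E_def f_def)
      next
        case 2
        then show ?thesis using v idx ab
          by (intro exI[of _ "idx b"] exI[of _ "idx a"]) (auto simp: E_def f_def insert_commute open_segment_commute)
      qed
    qed
    fix a b x y assume ab: "{a, b} \<in> edges H" and xy: "{x, y} \<in> edges H" and ne: "{a, b} \<noteq> {x, y}"
    obtain i j where ij: "(i, j) \<in> E" "{a, b} = {xs ! i, xs ! j}" "open_segment (f a) (f b) = open_segment (g i) (g j)"
      using E[OF ab] by blast
    obtain k l where kl: "(k, l) \<in> E" "{x, y} = {xs ! k, xs ! l}" "open_segment (f x) (f y) = open_segment (g k) (g l)"
      using E[OF xy] by blast
    have "(i, j) \<noteq> (k, l)" using ij kl ne by auto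
    then show "open_segment (f a) (f b) \<inter> open_segment (f x) (f y) = {}"
      unfolding ij(3) kl(3) by (rule gnc[OF ij(1) kl(1)])
  qed
qed

section \<open>Independent sets in sparse graphs\<close>

text \<open>Greedy selection: a vertex with fewer than \<open>k\<close> neighbours is picked, and at most \<open>k\<close> vertices,
  itself and its neighbours, are discarded.\<close>

lemma sparse_has_independent_set:
  fixes R :: "'a \<Rightarrow> 'a \<Rightarrow> bool"
  assumes "finite Q" "k * m < card Q" and sym: "\<And>x y. R x y \<Longrightarrow> R y x"
    and sparse: "\<And>X. X \<subseteq> Q \<Longrightarrow> X \<noteq> {} \<Longrightarrow> \<exists>v\<in>X. card {u \<in> X. u \<noteq> v \<and> R v u} < k"
  shows "\<exists>I\<subseteq>Q. card I = Suc m \<and> (\<forall>x\<in>I. \<forall>y\<in>I. x \<noteq> y \<longrightarrow> \<not> R x y)"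
  using assms(1,2,4)
proof (induction m arbitrary: Q)
  case 0
  then obtain v where "v \<in> Q" by fastforce
  then show ?case by (intro exI[of _ "{v}"]) auto
next
  case (Suc m)
  have "Q \<noteq> {}" using Suc.prems by auto
  then obtain v where v: "v \<in> Q" "card {u \<in> Q. u \<noteq> v \<and> R v u} < k" using Suc.prems(3)[of Q] by blast
  define N where "N = insert v {u \<in> Q. u \<noteq> v \<and> R v u}"
  have N: "N \<subseteq> Q" "finite N" using v Suc.prems(1) by (auto simp: N_def)
  have "card N \<le> k" using v Suc.prems(1) by (simp add: N_def)
  then have km: "k * m < card (Q - N)" using Suc.prems(2) N by (simp add: card_Diff_subset)
  have "\<exists>I\<subseteq>Q - N. card I = Suc m \<and> (\<forall>x\<in>I. \<forall>y\<in>I. x \<noteq> y \<longrightarrow> \<not> R x y)"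
  proof (rule Suc.IH)
    show "finite (Q - N)" using Suc.prems(1) by simp
    show "\<exists>v\<in>X. card {u \<in> X. u \<noteq> v \<and> R v u} < k" if "X \<subseteq> Q - N" "X \<noteq> {}" for X
      using Suc.prems(3)[of X] that by blast
  qed (rule km)
  then obtain I where I: "I \<subseteq> Q - N" "card I = Suc m" "\<forall>x\<in>I. \<forall>y\<in>I. x \<noteq> y \<longrightarrow> \<not> R x y" by blast
  have "finite I" using I Suc.prems(1) by (meson finite_Diff finite_subset)
  moreover have "v \<notin> I" using I by (auto simp: N_def)
  moreover have "\<not> R v x" "\<not> R x v" if "x \<in> I" for x
    using that I(1) sym[of x v] by (auto simp: N_def)
  ultimately show ?case using I v by (intro exI[of _ "insert v I"]) auto
qed

section \<open>Caterpillars as zigzags\<close>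

text \<open>The edges of a caterpillar that starts with the edge \<open>(p, q)\<close> and receives the vertices
  \<open>x # xs\<close> one by one. The current pivot \<open>p\<close> gets the next vertex as another neighbour if the code
  is \<open>False\<close>; if it is \<open>True\<close>, the vertex \<open>q\<close> that was added last becomes the pivot first. Each pair
  has the pivot as its first component.\<close>

fun zigzag :: "bool list \<Rightarrow> 'a \<Rightarrow> 'a \<Rightarrow> 'a list \<Rightarrow> ('a \<times> 'a) set" where
  "zigzag (b # bs) p q (x # xs) = insert (p, q) (zigzag bs (if b then q else p) x xs)"
| "zigzag _ p q _ = {(p, q)}"

text \<open>The length of the initial run of \<open>False\<close>: the number of neighbours that the current pivot still
  receives.\<close>

fun stays :: "bool list \<Rightarrow> nat" where
  "stays (False # cs) = Suc (stays cs)"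
| "stays _ = 0"

text \<open>A pivot that is introduced by \<open>True\<close> receives one new vertex with this step and one for each
  following \<open>False\<close>, which are at most \<open>d\<close> together.\<close>

fun runs_below :: "nat \<Rightarrow> bool list \<Rightarrow> bool" where
  "runs_below d (True # cs) \<longleftrightarrow> stays cs < d \<and> runs_below d cs"
| "runs_below d (False # cs) \<longleftrightarrow> runs_below d cs"
| "runs_below d [] \<longleftrightarrow> True"

lemma zigzag_prepend_leaves:
  assumes "length xs = length cs"
  shows "\<exists>cs' q' xs'. q' # xs' = ls @ q # xs \<and> length xs' = length cs' \<and>
    zigzag cs' v q' xs' = Pair v ` set ls \<union> zigzag cs v q xs \<and>
    count_list cs' True = count_list cs True \<and> stays cs' = length ls + stays cs \<and> runs_below d cs' = runs_below d cs"
proof (induction ls)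
  case Nil
  then show ?case using assms by auto
next
  case (Cons l ls)
  then obtain cs' q' xs' where IH: "q' # xs' = ls @ q # xs" "length xs' = length cs'"
    "zigzag cs' v q' xs' = Pair v ` set ls \<union> zigzag cs v q xs"
    "count_list cs' True = count_list cs True" "stays cs' = length ls + stays cs" "runs_below d cs' = runs_below d cs"
    by blast
  have "zigzag (False # cs') v l (q' # xs') = Pair v ` set (l # ls) \<union> zigzag cs v q xs"
    using IH(3) by simp
  moreover have "l # q' # xs' = (l # ls) @ q # xs" using IH(1) by simp
  moreover have "length (q' # xs') = length (False # cs')" using IH(2) by simp
  moreover have "count_list (False # cs') True = count_list cs True" "stays (False # cs') = length (l # ls) + stays cs"
    "runs_below d (False # cs') = runs_below d cs" using IH(4,5,6) by simp_all
  ultimately show ?case by blast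
qed

text \<open>The zigzag visits \<open>v1\<close>, the leaves of \<open>v1\<close>, \<open>v2\<close>, the leaves of \<open>v2\<close>, and so on for the spine
  \<open>ys = [v1, v2, ...]\<close>. A pivot is introduced together with a new
  neighbour, so the last spine vertex needs a leaf.\<close>

lemma spine_zigzag:
  fixes L :: "'a \<Rightarrow> 'a list"
  assumes "ys \<noteq> []" "L (last ys) \<noteq> []" "distinct ys"
    and "\<forall>v\<in>set ys. length (L v) + (if v = last ys then 0 else 1) \<le> d"
  shows "\<exists>cs q xs. length xs = length cs \<and> mset (q # xs) = mset (tl ys @ concat (map L ys)) \<and>
    (\<lambda>(a, b). {a, b}) ` zigzag cs (hd ys) q xs = path_edges ys \<union> {{v, l} | v l. v \<in> set ys \<and> l \<in> set (L v)} \<and>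
    Suc (count_list cs True) = length ys \<and> stays cs < d \<and> runs_below d cs"
  using assms
proof (induction ys rule: list_nonempty_induct)
  case (single v)
  define ls l where "ls = butlast (L v)" and "l = last (L v)"
  have Lv: "L v = ls @ [l]" using single by (simp add: ls_def l_def)
  obtain cs q xs where z: "q # xs = ls @ l # []" "length xs = length cs"
    "zigzag cs v q xs = Pair v ` set ls \<union> zigzag [] v l []" "count_list cs True = count_list [] True"
    "stays cs = length ls + stays []" "runs_below d cs = runs_below d []"
    using zigzag_prepend_leaves[of "[]" "[]" ls l v d] by auto
  have len: "length (L v) \<le> d" using single(3) by simp
  have m: "mset (q # xs) = mset (tl [v] @ concat (map L [v]))" unfolding z(1) using Lv by simp
  have e: "(\<lambda>(a, b). {a, b}) ` zigzag cs (hd [v]) q xs = path_edges [v] \<union> {{u, l} | u l. u \<in> set [v] \<and> l \<in> set (L u)}"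
    using z(3) Lv by (auto simp: image_Un image_image)
  show ?case
  proof (intro exI[of _ cs] exI[of _ q] exI[of _ xs] conjI m e z(2))
    show "Suc (count_list cs True) = length [v]" using z(4) by simp
    show "stays cs < d" using z(5) Lv len by simp
    show "runs_below d cs" using z(6) by simp
  qed
next
  case (cons v ys)
  obtain u us where ys: "ys = u # us" using cons.hyps by (cases ys) auto
  have vl: "v \<noteq> last ys" using cons.prems cons.hyps by auto
  have "\<exists>cs q xs. length xs = length cs \<and> mset (q # xs) = mset (tl ys @ concat (map L ys)) \<and>
    (\<lambda>(a, b). {a, b}) ` zigzag cs (hd ys) q xs = path_edges ys \<union> {{v, l} | v l. v \<in> set ys \<and> l \<in> set (L v)} \<and>
    Suc (count_list cs True) = length ys \<and> stays cs < d \<and> runs_below d cs"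
  proof (rule cons.IH)
    show "\<forall>w\<in>set ys. length (L w) + (if w = last ys then 0 else 1) \<le> d"
      using cons.prems(3) cons.hyps by simp
  qed (use cons.prems cons.hyps in auto)
  then obtain cs q xs where IH: "length xs = length cs" "mset (q # xs) = mset (tl ys @ concat (map L ys))"
    "(\<lambda>(a, b). {a, b}) ` zigzag cs u q xs = path_edges ys \<union> {{v, l} | v l. v \<in> set ys \<and> l \<in> set (L v)}"
    "Suc (count_list cs True) = length ys" "stays cs < d" "runs_below d cs"
    unfolding ys by auto
  have "length (q # xs) = length (True # cs)" using IH(1) by simp
  from zigzag_prepend_leaves[OF this, of "L v" u v d]
  obtain cs' q' xs' where z: "q' # xs' = L v @ u # q # xs" "length xs' = length cs'"
    "zigzag cs' v q' xs' = Pair v ` set (L v) \<union> zigzag (True # cs) v u (q # xs)"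
    "count_list cs' True = count_list (True # cs) True"
    "stays cs' = length (L v) + stays (True # cs)" "runs_below d cs' = runs_below d (True # cs)"
    by blast
  have len: "length (L v) < d" using cons.prems(3) vl cons.hyps by simp
  have m: "mset (q' # xs') = mset (tl (v # ys) @ concat (map L (v # ys)))"
    unfolding z(1) using IH(2) by (simp add: ys)
  have "(\<lambda>(a, b). {a, b}) ` zigzag cs' v q' xs' =
      (\<lambda>(a, b). {a, b}) ` Pair v ` set (L v) \<union> insert {v, u} ((\<lambda>(a, b). {a, b}) ` zigzag cs u q xs)"
    unfolding z(3) by (simp add: image_Un)
  also have "\<dots> = path_edges (v # ys) \<union> {{w, l} | w l. w \<in> set (v # ys) \<and> l \<in> set (L w)}"
    unfolding IH(3) by (auto simp: ys)
  finally have e: "(\<lambda>(a, b). {a, b}) ` zigzag cs' (hd (v # ys)) q' xs' =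
      path_edges (v # ys) \<union> {{w, l} | w l. w \<in> set (v # ys) \<and> l \<in> set (L w)}" by simp
  show ?case
  proof (intro exI[of _ cs'] exI[of _ q'] exI[of _ xs'] conjI m e z(2))
    show "Suc (count_list cs' True) = length (v # ys)" using z(4) IH(4) by simp
    show "stays cs' < d" using z(5) len by simp
    show "runs_below d cs'" using z(6) IH(5,6) by simp
  qed
qed

lemma connected_closed_set:
  assumes con: "connected_graph G" and v: "v \<in> S" "S \<subseteq> verts G"
    and closed: "\<And>x y. x \<in> S \<Longrightarrow> {x, y} \<in> edges G \<Longrightarrow> y \<in> S"
  shows "verts G \<subseteq> S"
proof
  fix u assume "u \<in> verts G"
  then have "(v, u) \<in> {(x, y). {x, y} \<in> edges G}\<^sup>*" using con v unfolding connected_graph_def by blast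
  then show "u \<in> S" by (induction rule: rtrancl_induct) (use v closed in auto)
qed

lemma degree_eq_card_neighbours:
  assumes "simple_graph G"
  shows "degree G v = card {u. {v, u} \<in> edges G}"
proof -
  have "{e \<in> edges G. v \<in> e} = (\<lambda>u. {v, u}) ` {u. {v, u} \<in> edges G}"
  proof (intro set_eqI iffI)
    fix e assume e: "e \<in> {e \<in> edges G. v \<in> e}"
    then have "card e = 2" using assms by (auto simp: simple_graph_def)
    then obtain a b where "e = {a, b}" by (auto simp: card_2_iff)
    then show "e \<in> (\<lambda>u. {v, u}) ` {u. {v, u} \<in> edges G}" using e by (auto simp: insert_commute)
  qed auto
  moreover have "inj_on (\<lambda>u. {v, u}) A" for A by (auto simp: inj_on_def doubleton_eq_iff)
  ultimately show ?thesis unfolding degree_def by (simp add: card_image)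
qed

lemma leaf_neighbour_ex1:
  assumes "simple_graph G" "leaf G l"
  shows "\<exists>u. {w. {l, w} \<in> edges G} = {u}"
proof -
  have "card {w. {l, w} \<in> edges G} = 1"
    using assms(2) degree_eq_card_neighbours[OF assms(1), of l] by (simp add: leaf_def)
  then show ?thesis by (auto simp: card_1_singleton_iff)
qed

text \<open>Two adjacent leaves form a component of their own.\<close>

lemma leaf_neighbour_nonleaf:
  assumes con: "connected_graph G" and sg: "simple_graph G" and n: "card (verts G) \<ge> 3"
    and l: "leaf G l" and e: "{l, v} \<in> edges G"
  shows "v \<in> nonleaves G"
proof (rule ccontr)
  have vs: "l \<in> verts G" "v \<in> verts G" "l \<noteq> v" using sg e by (auto simp: simple_graph_def)
  assume "v \<notin> nonleaves G"
  then have "leaf G v" using vs by (simp add: nonleaves_def)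
  have only: "{u. {x, u} \<in> edges G} = {y}" if "leaf G x" "{x, y} \<in> edges G" for x y
  proof -
    obtain z where "{u. {x, u} \<in> edges G} = {z}" using leaf_neighbour_ex1[OF sg \<open>leaf G x\<close>] by blast
    then show ?thesis using that(2) by auto
  qed
  have "{u. {l, u} \<in> edges G} = {v}" "{u. {v, u} \<in> edges G} = {l}"
    using only[OF l e] only[OF \<open>leaf G v\<close>, of l] e by (auto simp: insert_commute)
  then have "verts G \<subseteq> {l, v}"
    by (intro connected_closed_set[OF con, of l]) (use vs in auto)
  then have "card (verts G) \<le> card {l, v}" by (intro card_mono) auto
  also have "\<dots> \<le> 2" by (simp add: card_insert_if)
  finally show False using n by simp
qed

text \<open>A caterpillar consists of its spine \<open>ys\<close> and lists \<open>L v\<close> of leaves attached to the spine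
  vertices. The last spine vertex carries a leaf: otherwise its predecessor would be its only
  neighbour and it would be a leaf itself.\<close>

lemma caterpillar_structure:
  assumes cat: "caterpillar T" and n: "card (verts T) \<ge> 3"
  obtains ys L where "distinct ys" "set ys = nonleaves T" "ys \<noteq> []" "distinct (concat (map L ys))"
    "set ys \<inter> set (concat (map L ys)) = {}" "verts T = set ys \<union> set (concat (map L ys))"
    "edges T = path_edges ys \<union> {{v, l} | v l. v \<in> set ys \<and> l \<in> set (L v)}"
    "L (last ys) \<noteq> []" "\<forall>v\<in>set ys. length (L v) + (if v = last ys then 0 else 1) \<le> max_degree T"
proof -
  have sg: "simple_graph T" and con: "connected_graph T" using cat by (auto simp: caterpillar_def tree_def)
  obtain ys where ys: "distinct ys" "nonleaves T = set ys"
    "{e \<in> edges T. e \<subseteq> nonleaves T} = path_edges ys"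
    using cat unfolding caterpillar_def path_graph_def induced_subgraph_def path_edges_nth by auto
  have finV: "finite (verts T)" using sg by (simp add: simple_graph_def)
  define LS where "LS v = {l. leaf T l \<and> {v, l} \<in> edges T}" for v
  have LSV: "LS v \<subseteq> verts T" for v by (auto simp: LS_def leaf_def)
  then have finLS: "finite (LS v)" for v using finV finite_subset by blast
  define L where "L v = (SOME ls. set ls = LS v \<and> distinct ls)" for v
  have L: "set (L v) = LS v" "distinct (L v)" for v
    using someI_ex[OF finite_distinct_list[OF finLS[of v]]] unfolding L_def by auto
  have lenL: "length (L v) = card (LS v)" for v using L distinct_card by metis
  have leaf_nb: "v \<in> set ys" if "leaf T l" "{v, l} \<in> edges T" for v l
    using leaf_neighbour_nonleaf[OF con sg n that(1), of v] that(2) ys(2) by (simp add: insert_commute)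
  have leaf_ex: "\<exists>v. {v, l} \<in> edges T" if "leaf T l" for l
  proof -
    obtain u where "{w. {l, w} \<in> edges T} = {u}" using leaf_neighbour_ex1[OF sg \<open>leaf T l\<close>] by blast
    then have "{l, u} \<in> edges T" by blast
    then show ?thesis by (metis insert_commute)
  qed
  have leaf_uniq: "u = v" if "leaf T l" "{u, l} \<in> edges T" "{v, l} \<in> edges T" for u v l
  proof -
    obtain w where "{w. {l, w} \<in> edges T} = {w}" using leaf_neighbour_ex1[OF sg \<open>leaf T l\<close>] by blast
    moreover have "{l, u} \<in> edges T" "{l, v} \<in> edges T" using that by (simp_all add: insert_commute)
    ultimately have "u \<in> {w}" "v \<in> {w}" by blast+
    then show ?thesis by simp
  qed
  have VE: "verts T = set ys \<union> (\<Union>v\<in>set ys. LS v)"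
  proof
    show "verts T \<subseteq> set ys \<union> (\<Union>v\<in>set ys. LS v)"
    proof
      fix x assume x: "x \<in> verts T"
      show "x \<in> set ys \<union> (\<Union>v\<in>set ys. LS v)"
      proof (cases "leaf T x")
        case True
        then obtain v where "{v, x} \<in> edges T" using leaf_ex by blast
        then show ?thesis using leaf_nb True by (auto simp: LS_def)
      qed (use x ys(2) in \<open>auto simp: nonleaves_def\<close>)
    qed
    show "set ys \<union> (\<Union>v\<in>set ys. LS v) \<subseteq> verts T" using LSV ys(2) by (auto simp: nonleaves_def)
  qed
  have ne: "ys \<noteq> []" using VE n by auto
  have disj: "set ys \<inter> (\<Union>v\<in>set ys. LS v) = {}" using ys(2) by (auto simp: nonleaves_def LS_def)
  have EE: "edges T = path_edges ys \<union> {{v, l} | v l. v \<in> set ys \<and> l \<in> set (L v)}"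
  proof
    show "edges T \<subseteq> path_edges ys \<union> {{v, l} | v l. v \<in> set ys \<and> l \<in> set (L v)}"
    proof
      fix e assume e: "e \<in> edges T"
      then obtain a b where ab: "e = {a, b}" "a \<in> verts T" "b \<in> verts T"
        using sg by (auto simp: simple_graph_def card_2_iff)
      show "e \<in> path_edges ys \<union> {{v, l} | v l. v \<in> set ys \<and> l \<in> set (L v)}"
      proof (cases "leaf T a \<or> leaf T b")
        case False
        then have "e \<subseteq> nonleaves T" using ab by (auto simp: nonleaves_def)
        then show ?thesis using e ys(3) by blast
      next
        case True
        then obtain l v where lv: "e = {v, l}" "leaf T l" using ab by (metis insert_commute)
        then have "v \<in> set ys" "l \<in> set (L v)" using leaf_nb e L by (auto simp: LS_def)
        then show ?thesis using lv by blast
      qed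
    qed
    show "path_edges ys \<union> {{v, l} | v l. v \<in> set ys \<and> l \<in> set (L v)} \<subseteq> edges T"
      using ys(3) L by (auto simp: LS_def)
  qed
  have dconc: "distinct (concat (map L zs))" if "distinct zs" "set zs \<subseteq> set ys" for zs
    using that
  proof (induction zs)
    case (Cons z zs)
    have "set (L z) \<inter> set (concat (map L zs)) = {}"
    proof (rule equals0I)
      fix x assume x: "x \<in> set (L z) \<inter> set (concat (map L zs))"
      then obtain w where w: "w \<in> set zs" "x \<in> LS w" "x \<in> LS z" using L(1) by auto
      then have "w = z" using leaf_uniq[of x w z] unfolding LS_def by blast
      then show False using w Cons.prems(1) by simp
    qed
    then show ?case using Cons L(2) by simp
  qed simp
  have deg: "card {u. {v, u} \<in> edges T} \<le> max_degree T" if "v \<in> set ys" for v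
  proof -
    have "v \<in> verts T" using that VE by blast
    then have "degree T v \<le> max_degree T" unfolding max_degree_def using finV by (intro Max_ge) auto
    then show ?thesis using degree_eq_card_neighbours[OF sg] by simp
  qed
  have finN: "finite {u. {v, u} \<in> edges T}" for v
    by (rule finite_subset[OF _ finV]) (use sg in \<open>auto simp: simple_graph_def\<close>)
  have next_nb: "\<exists>w\<in>set ys. {v, w} \<in> edges T" if v: "v \<in> set ys" "v \<noteq> last ys" for v
  proof -
    obtain i where i: "i < length ys" "v = ys ! i" using v by (auto simp: in_set_conv_nth)
    then have "Suc i < length ys" using v ne by (metis Suc_lessI diff_Suc_1 last_conv_nth)
    then show ?thesis using i EE by (intro bexI[of _ "ys ! Suc i"]) (auto simp: path_edges_nth)
  qed
  have bound: "length (L v) + (if v = last ys then 0 else 1) \<le> max_degree T" if v: "v \<in> set ys" for v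
  proof (cases "v = last ys")
    case True
    have "card (LS v) \<le> card {u. {v, u} \<in> edges T}" by (rule card_mono[OF finN]) (auto simp: LS_def)
    then show ?thesis using True deg[OF v] lenL by simp
  next
    case False
    then obtain w where w: "w \<in> set ys" "{v, w} \<in> edges T" using next_nb v by blast
    have "w \<notin> LS v" using w disj v by blast
    have "card (insert w (LS v)) \<le> card {u. {v, u} \<in> edges T}"
      by (rule card_mono[OF finN]) (use w in \<open>auto simp: LS_def\<close>)
    then show ?thesis using False deg[OF v] lenL finLS \<open>w \<notin> LS v\<close> by simp
  qed
  have lastL: "L (last ys) \<noteq> []"
  proof
    assume e: "L (last ys) = []"
    define v where "v = last ys"
    have vys: "v \<in> set ys" using ne by (simp add: v_def)
    have LSv: "LS v = {}" using e L(1)[of v] by (simp add: v_def)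
    show False
    proof (cases "butlast ys = []")
      case True
      then have "ys = [v]" using ne by (metis append_butlast_last_id append_Nil v_def)
      then have "verts T = {v}" using VE LSv by simp
      then show False using n by simp
    next
      case False
      define w where "w = last (butlast ys)"
      have ysw: "ys = butlast (butlast ys) @ [w] @ [v]"
        using ne False by (metis append.assoc append_butlast_last_id v_def w_def)
      have "{u. {v, u} \<in> edges T} = {w}"
      proof
        show "{u. {v, u} \<in> edges T} \<subseteq> {w}"
        proof
          fix u assume "u \<in> {u. {v, u} \<in> edges T}"
          then have u: "{v, u} \<in> edges T" by simp
          have "u \<noteq> v" using u sg by (auto simp: simple_graph_def)
          have "{v, u} \<notin> {{v, l} | v l. v \<in> set ys \<and> l \<in> set (L v)}"
          proof
            assume "{v, u} \<in> {{v, l} | v l. v \<in> set ys \<and> l \<in> set (L v)}"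
            then obtain x l where xl: "{v, u} = {x, l}" "x \<in> set ys" "l \<in> LS x" using L by blast
            have "l \<noteq> v" using xl disj vys by blast
            then have "x = v" using xl by (auto simp: doubleton_eq_iff)
            then show False using xl LSv by simp
          qed
          then have "{v, u} \<in> path_edges ys" using u EE by blast
          also have "path_edges ys = path_edges (butlast (butlast ys) @ [w]) \<union> {{w, v}}"
            by (subst ysw) (use path_edges_append[of "butlast (butlast ys)" w "[v]"] in simp)
          finally have "{v, u} \<in> path_edges (butlast (butlast ys) @ [w]) \<or> {v, u} = {w, v}" by blast
          moreover have "v \<notin> set (butlast (butlast ys) @ [w])" using ys(1) by (subst (asm) ysw) auto
          then have "{v, u} \<notin> path_edges (butlast (butlast ys) @ [w])" using Union_path_edges_subset[of "butlast (butlast ys) @ [w]"] by blast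
          ultimately show "u \<in> {w}" using \<open>u \<noteq> v\<close> by (auto simp: doubleton_eq_iff)
        qed
        have "{w, v} \<in> path_edges ys"
          by (subst ysw) (use path_edges_append[of "butlast (butlast ys)" w "[v]"] in simp)
        then show "{w} \<subseteq> {u. {v, u} \<in> edges T}" using EE by (auto simp: insert_commute)
      qed
      then have "degree T v = 1" using degree_eq_card_neighbours[OF sg] by simp
      moreover have "v \<in> nonleaves T" using vys ys(2) by simp
      ultimately show False by (simp add: nonleaves_def leaf_def)
    qed
  qed
  show thesis
  proof (rule that[OF ys(1) ys(2)[symmetric] ne _ _ _ EE lastL])
    show "distinct (concat (map L ys))" using dconc ys(1) by blast
    show "set ys \<inter> set (concat (map L ys)) = {}" using disj L by auto
    show "verts T = set ys \<union> set (concat (map L ys))" using VE L by auto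
    show "\<forall>v\<in>set ys. length (L v) + (if v = last ys then 0 else 1) \<le> max_degree T" using bound by blast
  qed
qed

lemma caterpillar_zigzag:
  assumes cat: "caterpillar T" and n: "card (verts T) \<ge> 3"
  obtains cs p q xs where "length xs = length cs" "distinct (p # q # xs)" "verts T = set (p # q # xs)"
    "edges T = (\<lambda>(a, b). {a, b}) ` zigzag cs p q xs"
    "Suc (count_list cs True) = card (nonleaves T)" "stays cs < max_degree T" "runs_below (max_degree T) cs"
proof -
  obtain ys L where ys: "distinct ys" "set ys = nonleaves T" "ys \<noteq> []" "distinct (concat (map L ys))"
    "set ys \<inter> set (concat (map L ys)) = {}" "verts T = set ys \<union> set (concat (map L ys))"
    "edges T = path_edges ys \<union> {{v, l} | v l. v \<in> set ys \<and> l \<in> set (L v)}"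
    "L (last ys) \<noteq> []" "\<forall>v\<in>set ys. length (L v) + (if v = last ys then 0 else 1) \<le> max_degree T"
    by (rule caterpillar_structure[OF cat n])
  obtain cs q xs where z: "length xs = length cs" "mset (q # xs) = mset (tl ys @ concat (map L ys))"
    "(\<lambda>(a, b). {a, b}) ` zigzag cs (hd ys) q xs = path_edges ys \<union> {{v, l} | v l. v \<in> set ys \<and> l \<in> set (L v)}"
    "Suc (count_list cs True) = length ys" "stays cs < max_degree T" "runs_below (max_degree T) cs"
    using spine_zigzag[OF ys(3,8,1,9)] by (elim exE conjE) (rule that)
  have hdtl: "ys = hd ys # tl ys" using ys(3) by simp
  have "mset (hd ys # q # xs) = mset (ys @ concat (map L ys))"
    using z(2) by (subst (2) hdtl) simp
  then have deq: "distinct (hd ys # q # xs) = distinct (ys @ concat (map L ys))"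
    and seq: "set (hd ys # q # xs) = set (ys @ concat (map L ys))"
    by (rule mset_eq_imp_distinct_iff, rule mset_eq_setD)
  show thesis
  proof (rule that[OF z(1)])
    show "distinct (hd ys # q # xs)" unfolding deq using ys(1,4,5) by simp
    show "verts T = set (hd ys # q # xs)" unfolding seq ys(6) by simp
    show "edges T = (\<lambda>(a, b). {a, b}) ` zigzag cs (hd ys) q xs" unfolding z(3) ys(7) ..
    show "Suc (count_list cs True) = card (nonleaves T)" unfolding z(4) ys(2)[symmetric] distinct_card[OF ys(1)] ..
  qed (rule z)+
qed

lemma tree_two_vertices:
  assumes T: "tree T" and n: "card (verts T) = 2"
  obtains p q where "p \<noteq> q" "verts T = {p, q}" "edges T = {{p, q}}"
proof -
  obtain p q where pq: "verts T = {p, q}" "p \<noteq> q" using n by (auto simp: card_2_iff)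
  have sg: "simple_graph T" and con: "connected_graph T" using T by (auto simp: tree_def)
  have sub: "e = {p, q}" if "e \<in> edges T" for e
  proof -
    have "e \<subseteq> {p, q}" "card e = 2" using that sg pq by (auto simp: simple_graph_def)
    then show ?thesis using pq(2) card_subset_eq[of "{p, q}" e] by simp
  qed
  moreover have "edges T \<noteq> {}"
  proof
    assume "edges T = {}"
    then have "verts T \<subseteq> {p}" by (intro connected_closed_set[OF con, of p]) (use pq in auto)
    then show False using pq by auto
  qed
  ultimately have "edges T = {{p, q}}" by blast
  then show thesis by (rule that[OF pq(2,1)])
qed

definition noncrossing_pairs :: "(plane \<times> plane) set \<Rightarrow> bool" where
  "noncrossing_pairs Z \<longleftrightarrow> (\<forall>(a, b)\<in>Z. \<forall>(x, y)\<in>Z. (a, b) \<noteq> (x, y) \<longrightarrow> open_segment a b \<inter> open_segment x y = {})"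

lemma noncrossing_pairsI:
  assumes "\<And>a b x y. (a, b) \<in> Z \<Longrightarrow> (x, y) \<in> Z \<Longrightarrow> (a, b) \<noteq> (x, y) \<Longrightarrow> open_segment a b \<inter> open_segment x y = {}"
  shows "noncrossing_pairs Z"
  unfolding noncrossing_pairs_def
  by (simp only: case_prod_unfold) (intro ballI impI, rule assms, simp_all)

lemma noncrossing_pairsD:
  assumes "noncrossing_pairs Z" "(a, b) \<in> Z" "(x, y) \<in> Z" "(a, b) \<noteq> (x, y)"
  shows "open_segment a b \<inter> open_segment x y = {}"
  using bspec[OF bspec[OF assms(1)[unfolded noncrossing_pairs_def] assms(2), unfolded case_prod_conv] assms(3)] assms(4)
  by simp

lemma noncrossing_pairs_insert:
  assumes "noncrossing_pairs Z" "\<And>x y. (x, y) \<in> Z \<Longrightarrow> open_segment a b \<inter> open_segment x y = {}"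
  shows "noncrossing_pairs (insert (a, b) Z)"
  using assms unfolding noncrossing_pairs_def by (fastforce simp: Int_commute)

lemma zigzag_mem:
  "(a, b) \<in> zigzag cs p q xs \<Longrightarrow> (a = p \<and> b \<in> set (q # xs)) \<or> (a \<in> set (q # xs) \<and> b \<in> set xs)"
proof (induction cs p q xs rule: zigzag.induct)
  case (1 c bs p q x xs)
  then show ?case by (cases c) auto
qed auto

text \<open>Used to turn a second list of points with the same zigzag code into a copy of the first zigzag.\<close>

lemma exists_map_eq:
  assumes "distinct xs" "length xs = length ys"
  shows "\<exists>f. map f xs = ys"
proof
  show "map (\<lambda>x. the (map_of (zip xs ys) x)) xs = ys"
    using assms by (intro nth_equalityI) (simp_all add: map_of_zip_nth)
qed

lemma zigzag_map: "zigzag cs (f p) (f q) (map f xs) = map_prod f f ` zigzag cs p q xs"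
proof (induction cs p q xs rule: zigzag.induct)
  case (1 b bs p q x xs)
  then show ?case by (cases b) auto
qed auto

text \<open>The same with one chosen orientation for each edge.\<close>

lemma oriented_copy:
  assumes sg: "simple_graph G" and E: "edges G = (\<lambda>(a, b). {a, b}) ` Z"
    and inj: "inj_on f (verts G)" and fP: "f ` verts G \<subseteq> P"
    and col: "\<And>a b. (a, b) \<in> Z \<Longrightarrow> c {f a, f b} = k"
    and nc: "noncrossing_pairs (map_prod f f ` Z)"
  shows "has_mono_non_crossing_copy P c k G"
proof (rule has_mono_non_crossing_copyI[OF sg inj fP])
  have orient: "\<exists>u v. (u, v) \<in> Z \<and> e = {u, v}" if "e \<in> edges G" for e
  proof -
    have "e \<in> (\<lambda>(a, b). {a, b}) ` Z" using that unfolding E .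
    then obtain d where "e = (\<lambda>(a, b). {a, b}) d" "d \<in> Z" by (rule imageE)
    then show ?thesis by (cases d) auto
  qed
  fix e assume "e \<in> edges G"
  then obtain a b where "(a, b) \<in> Z" "e = {a, b}" using orient by blast
  then show "c (f ` e) = k" using col by simp
next
  have pair: "\<exists>u v. (u, v) \<in> Z \<and> {a, b} = {u, v} \<and> open_segment (f a) (f b) = open_segment (f u) (f v)"
    if e: "{a, b} \<in> edges G" for a b
  proof -
    have "{a, b} \<in> (\<lambda>(a, b). {a, b}) ` Z" using e unfolding E .
    then obtain d where "{a, b} = (\<lambda>(a, b). {a, b}) d" "d \<in> Z" by (rule imageE)
    then obtain u v where uv: "(u, v) \<in> Z" "{a, b} = {u, v}" by (cases d) auto
    then have "(a = u \<and> b = v) \<or> (a = v \<and> b = u)" by (auto simp: doubleton_eq_iff)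
    then have "open_segment (f a) (f b) = open_segment (f u) (f v)" by (auto simp: open_segment_commute)
    then show ?thesis using uv by blast
  qed
  fix a b x y assume e: "{a, b} \<in> edges G" "{x, y} \<in> edges G" and ne: "{a, b} \<noteq> {x, y}"
  obtain u v w z where uv: "(u, v) \<in> Z" "{a, b} = {u, v}" "open_segment (f a) (f b) = open_segment (f u) (f v)"
    and wz: "(w, z) \<in> Z" "{x, y} = {w, z}" "open_segment (f x) (f y) = open_segment (f w) (f z)"
    using pair[OF e(1)] pair[OF e(2)] by blast
  have "{u, v} \<subseteq> verts G" "{w, z} \<subseteq> verts G"
    using sg e unfolding uv(2) wz(2) simple_graph_def by blast+
  then have V: "u \<in> verts G" "v \<in> verts G" "w \<in> verts G" "z \<in> verts G" by auto
  have "u \<noteq> w \<or> v \<noteq> z" using ne uv(2) wz(2) by blast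
  then have "f u \<noteq> f w \<or> f v \<noteq> f z" using inj_on_eq_iff[OF inj] V by simp
  then have "(f u, f v) \<noteq> (f w, f z)" by simp
  moreover have m: "(f u, f v) \<in> map_prod f f ` Z" "(f w, f z) \<in> map_prod f f ` Z"
    using imageI[OF uv(1), of "map_prod f f"] imageI[OF wz(1), of "map_prod f f"] by simp_all
  ultimately have "open_segment (f u) (f v) \<inter> open_segment (f w) (f z) = {}"
    by (intro noncrossing_pairsD[OF nc m])
  then show "open_segment (f a) (f b) \<inter> open_segment (f x) (f y) = {}" unfolding uv(3) wz(3) .
qed

lemma zigzag_copy:
  assumes sg: "simple_graph T" and dist: "distinct (p # q # xs)" and V: "verts T = set (p # q # xs)"
    and E: "edges T = (\<lambda>(a, b). {a, b}) ` zigzag cs p q xs"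
    and dist': "distinct (p' # q' # xs')" and len: "length xs' = length xs" and P: "set (p' # q' # xs') \<subseteq> P"
    and col: "\<forall>(a, b)\<in>zigzag cs p' q' xs'. c {a, b} = k"
    and nc: "noncrossing_pairs (zigzag cs p' q' xs')"
  shows "has_mono_non_crossing_copy P c k T"
proof -
  have len': "length (p # q # xs) = length (p' # q' # xs')" using len by simp
  obtain f where f: "map f (p # q # xs) = p' # q' # xs'"
    using exists_map_eq[OF dist len'] by (elim exE) (rule that)
  then have fs: "f p = p'" "f q = q'" "map f xs = xs'" by auto
  have im: "map_prod f f ` zigzag cs p q xs = zigzag cs p' q' xs'" using zigzag_map[of cs f p q xs] fs by simp
  have fV: "f ` verts T = set (p' # q' # xs')" unfolding V f[symmetric] by simp
  show ?thesis
  proof (rule oriented_copy[OF sg E])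
    show "inj_on f (verts T)" unfolding V using dist' f by (metis distinct_map)
    show "f ` verts T \<subseteq> P" using fV P by simp
    show "noncrossing_pairs (map_prod f f ` zigzag cs p q xs)" unfolding im by (rule nc)
    fix a b assume "(a, b) \<in> zigzag cs p q xs"
    then have "map_prod f f (a, b) \<in> zigzag cs p' q' xs'" unfolding im[symmetric] by (rule imageI)
    then show "c {f a, f b} = k" using col by auto
  qed
qed

section \<open>Zigzags in dense geometric graphs on points in convex position\<close>

text \<open>The combinatorial content of convex position: no point lies in a triangle spanned by others.\<close>

definition transitive_rotation :: "plane set \<Rightarrow> bool" where
  "transitive_rotation Q \<longleftrightarrow> (\<forall>p\<in>Q. \<forall>x\<in>Q. \<forall>y\<in>Q. \<forall>z\<in>Q. orient p x y > 0 \<longrightarrow> orient p y z > 0 \<longrightarrow> orient p x z > 0)"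

lemma convex_position_subset_hull:
  assumes "convex_position P" "p \<in> P" "A \<subseteq> P - {p}"
  shows "p \<notin> convex hull A"
proof -
  obtain K where K: "polytope K" "P = {v. v extreme_point_of K}" using assms(1) unfolding convex_position_def by blast
  have "convex K" using K polytope_imp_convex by blast
  moreover have "p extreme_point_of K" using K assms by auto
  ultimately have "convex (K - {p})" by (simp add: extreme_point_of_stillconvex)
  moreover have "A \<subseteq> K - {p}" using K assms(3) unfolding extreme_point_of_def by auto
  ultimately have "convex hull A \<subseteq> K - {p}" by (simp add: hull_minimal)
  then show ?thesis by blast
qed

lemma convex_position_imp_general_position:
  assumes "convex_position P"
  shows "general_position P"
  unfolding general_position_orient
proof (intro conjI ballI impI notI)
  show "finite P" using assms by (simp add: convex_position_def)
  fix a b c assume abc: "a \<in> P" "b \<in> P" "c \<in> P" "a \<noteq> b" "a \<noteq> c" "b \<noteq> c" "orient a b c = 0"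
  then have "collinear {a, b, c}" by (simp add: collinear_orient)
  then consider "between (b, c) a" | "between (c, a) b" | "between (a, b) c"
    using collinear_between_cases by blast
  then show False
  proof cases
    case 1
    then have "a \<in> convex hull {b, c}" by (simp add: between_mem_segment segment_convex_hull)
    then show False using convex_position_subset_hull[OF assms, of a "{b, c}"] abc by auto
  next
    case 2
    then have "b \<in> convex hull {c, a}" by (simp add: between_mem_segment segment_convex_hull)
    then show False using convex_position_subset_hull[OF assms, of b "{c, a}"] abc by auto
  next
    case 3
    then have "c \<in> convex hull {a, b}" by (simp add: between_mem_segment segment_convex_hull)
    then show False using convex_position_subset_hull[OF assms, of c "{a, b}"] abc by auto
  qed
qed

lemma positive_rotation_in_triangle:
  assumes "orient p x y > 0" "orient p y z > 0" "orient p z x > 0"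
  shows "p \<in> convex hull {x, y, z}"
proof -
  define s where "s = orient p y z + orient p z x + orient p x y"
  have s: "s > 0" using assms by (simp add: s_def)
  have "orient p y z *\<^sub>R x + orient p z x *\<^sub>R y + orient p x y *\<^sub>R z = s *\<^sub>R p"
    by (simp add: plane_eq_iff s_def orient_def) (simp add: algebra_simps)
  then have "(1 / s) *\<^sub>R (orient p y z *\<^sub>R x + orient p z x *\<^sub>R y + orient p x y *\<^sub>R z) = p"
    using s by simp
  then have "p = (orient p y z / s) *\<^sub>R x + (orient p z x / s) *\<^sub>R y + (orient p x y / s) *\<^sub>R z"
    by (simp add: scaleR_add_right)
  moreover have "orient p y z / s + orient p z x / s + orient p x y / s = 1"
    using s by (simp add: s_def add_divide_distrib[symmetric])
  moreover have "orient p y z / s \<ge> 0" "orient p z x / s \<ge> 0" "orient p x y / s \<ge> 0" using assms s by simp_all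
  ultimately show ?thesis unfolding convex_hull_3 by blast
qed

text \<open>If transitivity failed for \<open>x\<close>, \<open>y\<close>, \<open>z\<close>, then these points would surround \<open>p\<close>, and \<open>p\<close> would
  be a convex combination of them.\<close>

lemma convex_position_transitive_rotation:
  assumes "convex_position P"
  shows "transitive_rotation P"
  unfolding transitive_rotation_def
proof (intro ballI impI)
  fix p x y z assume P: "p \<in> P" "x \<in> P" "y \<in> P" "z \<in> P" and o: "orient p x y > 0" "orient p y z > 0"
  have ne: "p \<noteq> x" "p \<noteq> y" "p \<noteq> z" using o by auto
  have "x \<noteq> z" using o orient_swap23[of p y z] by auto
  then have "orient p x z \<noteq> 0"
    using P ne by (intro general_position_orient_neq[OF convex_position_imp_general_position[OF assms]])
  moreover have "\<not> orient p z x > 0"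
    using positive_rotation_in_triangle[OF o] convex_position_subset_hull[OF assms P(1), of "{x, y, z}"] P ne by auto
  ultimately show "orient p x z > 0" using orient_swap23[of p x z] by linarith
qed

text \<open>Depending on the sign of \<open>s\<close>, the points on one or the other side of the chord \<open>p q\<close>. In
  convex position, these are the points passed when a ray from \<open>p\<close> is turned inwards from \<open>q\<close>.\<close>

definition inside_sector :: "real \<Rightarrow> plane \<Rightarrow> plane \<Rightarrow> plane \<Rightarrow> bool" where
  "inside_sector s p q x \<longleftrightarrow> s * orient p x q > 0"

text \<open>The oriented edges from which a zigzag with the given code can be drawn by always turning
  inwards. Turning about the other end point means turning in the other sense, hence the change of
  sign when the pivot is switched.\<close>

fun continuable :: "(plane \<times> plane) set \<Rightarrow> real \<Rightarrow> bool list \<Rightarrow> (plane \<times> plane) set" where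
  "continuable E s [] = E"
| "continuable E s (b # bs) = {(p, q) \<in> E. \<exists>x.
     (if b then (q, x) \<in> continuable E (- s) bs else (p, x) \<in> continuable E s bs) \<and> inside_sector s p q x}"

lemma continuable_subset: "continuable E s cs \<subseteq> E"
  by (cases cs) auto

lemma inside_sector_reverse: "inside_sector s p q x \<longleftrightarrow> inside_sector (- s) q p x"
  by (simp add: inside_sector_def orient_def algebra_simps)

text \<open>At each point \<open>p\<close>, at most one edge of \<open>G\<close> is the last one in rotation order.\<close>

lemma card_last_in_rotation:
  assumes gp: "general_position Q" and G: "G \<subseteq> Q \<times> Q" and irr: "\<And>p. (p, p) \<notin> G" and s: "s \<noteq> 0"
  shows "card {(p, q) \<in> G. \<forall>x. (p, x) \<in> G \<longrightarrow> \<not> inside_sector s p q x} \<le> card Q"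
proof -
  let ?M = "{(p, q) \<in> G. \<forall>x. (p, x) \<in> G \<longrightarrow> \<not> inside_sector s p q x}"
  have "inj_on fst ?M"
  proof (rule inj_onI, rule ccontr)
    fix u v assume u: "u \<in> ?M" and v: "v \<in> ?M" and eq: "fst u = fst v" and ne: "u \<noteq> v"
    obtain p q x where pq: "u = (p, q)" "v = (p, x)" using eq by (cases u; cases v) auto
    have G2: "(p, q) \<in> G" "(p, x) \<in> G" and n: "\<not> inside_sector s p q x" "\<not> inside_sector s p x q"
      using u v pq by auto
    have "p \<noteq> q" "p \<noteq> x" using G2 irr by blast+
    moreover have "p \<in> Q" "q \<in> Q" "x \<in> Q" "q \<noteq> x" using G2 G ne pq by auto
    ultimately have "p \<in> Q" "q \<in> Q" "x \<in> Q" "p \<noteq> q" "p \<noteq> x" "q \<noteq> x" by blast+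
    then have "orient p q x \<noteq> 0" by (rule general_position_orient_neq[OF gp])
    then have "s * orient p q x \<noteq> 0" using s by simp
    then show False using n orient_swap23[of p x q] unfolding inside_sector_def by auto
  qed
  moreover have "fst ` ?M \<subseteq> Q" using G by auto
  moreover have "finite Q" using gp by (simp add: general_position_def)
  ultimately show ?thesis by (rule card_inj_on_le)
qed

text \<open>Each step of the code costs at most one edge per point, namely the last one in rotation order
  among the edges that have not been lost before. For a switch this is applied to the reversed edges,
  which is possible as \<open>E\<close> is symmetric.\<close>

lemma card_continuable:
  assumes gp: "general_position Q" and EQ: "E \<subseteq> Q \<times> Q" and irr: "\<And>p. (p, p) \<notin> E"
    and sym: "\<And>p q. (p, q) \<in> E \<Longrightarrow> (q, p) \<in> E"
  shows "s \<noteq> 0 \<Longrightarrow> card (E - continuable E s cs) \<le> length cs * card Q"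
proof (induction cs arbitrary: s)
  case (Cons b bs)
  define t where "t = (if b then - s else s)"
  define G where "G = continuable E t bs"
  define M where "M = {(p, q) \<in> G. \<forall>x. (p, x) \<in> G \<longrightarrow> \<not> inside_sector t p q x}"
  have t: "t \<noteq> 0" using Cons.prems by (simp add: t_def)
  have GE: "G \<subseteq> E" unfolding G_def by (rule continuable_subset)
  have "finite (Q \<times> Q)" using gp by (simp add: general_position_def)
  then have finE: "finite E" by (rule finite_subset[OF EQ])
  have "M \<subseteq> E" using GE by (auto simp: M_def)
  then have finM: "finite M" using finE by (rule finite_subset)
  have cM: "card M \<le> card Q"
    unfolding M_def by (rule card_last_in_rotation[OF gp _ _ t]) (use GE EQ irr in blast)+
  have IH: "card (E - G) \<le> length bs * card Q" unfolding G_def using Cons.IH[OF t] .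
  define h :: "plane \<times> plane \<Rightarrow> plane \<times> plane" where "h = (if b then prod.swap else id)"
  have "E - continuable E s (b # bs) \<subseteq> h ` ((E - G) \<union> M)"
  proof
    fix e assume e: "e \<in> E - continuable E s (b # bs)"
    obtain p q where pq: "e = (p, q)" by (cases e)
    show "e \<in> h ` ((E - G) \<union> M)"
    proof (cases b)
      case True
      have "(q, p) \<in> (E - G) \<union> M"
      proof (cases "(q, p) \<in> G")
        case qp: True
        have "\<not> inside_sector s p q x" if "(q, x) \<in> G" for x
          using e pq True that unfolding G_def t_def by auto
        then have "\<not> inside_sector t q p x" if "(q, x) \<in> G" for x
          using that True inside_sector_reverse[of s p q x] by (simp add: t_def)
        then show ?thesis using qp by (simp add: M_def)
      next
        case False
        then show ?thesis using e pq sym by blast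
      qed
      then have "prod.swap (q, p) \<in> h ` ((E - G) \<union> M)" unfolding h_def using True by (simp del: swap_simp)
      then show ?thesis using pq by simp
    next
      case False
      have "(p, q) \<in> (E - G) \<union> M"
        using e pq False by (auto simp: M_def G_def t_def)
      then show ?thesis using False pq by (simp add: h_def)
    qed
  qed
  then have "card (E - continuable E s (b # bs)) \<le> card (h ` ((E - G) \<union> M))"
    using finE finM by (intro card_mono) auto
  also have "\<dots> \<le> card ((E - G) \<union> M)" using finE finM by (intro card_image_le) auto
  also have "\<dots> \<le> card (E - G) + card M" by (rule card_Un_le)
  finally show ?case using IH cM by simp
qed simp

text \<open>The later vertices all lie in the sector behind the chord \<open>p q\<close>, by transitivity of rotation, so
  the later edges stay on one side of it.\<close>

lemma continuable_extends:
  assumes tr: "transitive_rotation Q" and EQ: "E \<subseteq> Q \<times> Q"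
  shows "s \<noteq> 0 \<Longrightarrow> (p, q) \<in> continuable E s cs \<Longrightarrow>
    \<exists>xs. length xs = length cs \<and> distinct xs \<and> (\<forall>x\<in>set xs. x \<in> Q \<and> inside_sector s p q x) \<and>
      zigzag cs p q xs \<subseteq> E \<and> noncrossing_pairs (zigzag cs p q xs)"
proof (induction cs arbitrary: s p q)
  case Nil
  then show ?case by (intro exI[of _ "[]"]) (auto simp: noncrossing_pairs_def)
next
  case (Cons b bs)
  have pqE: "(p, q) \<in> E" using Cons.prems(2) by simp
  then have pqQ: "p \<in> Q" "q \<in> Q" using EQ by auto
  define t p' where "t = (if b then - s else s)" and "p' = (if b then q else p)"
  have "\<exists>x. (p', x) \<in> continuable E t bs \<and> inside_sector s p q x"
    using Cons.prems(2) unfolding t_def p'_def by (cases b) auto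
  then obtain x where x: "(p', x) \<in> continuable E t bs" "inside_sector s p q x" by blast
  have xQ: "x \<in> Q" using x(1) continuable_subset EQ by blast
  have "t \<noteq> 0" using Cons.prems(1) by (simp add: t_def)
  then obtain ys where ys: "length ys = length bs" "distinct ys" "\<forall>y\<in>set ys. y \<in> Q \<and> inside_sector t p' x y"
    "zigzag bs p' x ys \<subseteq> E" "noncrossing_pairs (zigzag bs p' x ys)"
    using Cons.IH[OF _ x(1)] by blast
  have trans: "inside_sector s p q y" if y: "y \<in> Q" "inside_sector t p' x y" for y
  proof -
    have T: "inside_sector r u v y" if "u \<in> Q" "v \<in> Q" "inside_sector r u v x" "inside_sector r u x y" for r u v
    proof -
      have a: "r * orient u x v > 0" "r * orient u y x > 0" using that by (auto simp: inside_sector_def)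
      show ?thesis
      proof (cases "r > 0")
        case True
        then have "orient u y x > 0" "orient u x v > 0" using a by (auto simp: zero_less_mult_iff)
        then have "orient u y v > 0" using tr xQ y(1) that(1,2) unfolding transitive_rotation_def by blast
        then show ?thesis using True by (simp add: inside_sector_def)
      next
        case False
        then have r: "r < 0" using a by (auto simp: zero_less_mult_iff)
        then have "orient u v x > 0" "orient u x y > 0"
          using a orient_swap23[of u v x] orient_swap23[of u x y] by (auto simp: zero_less_mult_iff)
        then have "orient u v y > 0" using tr xQ y(1) that(1,2) unfolding transitive_rotation_def by blast
        then show ?thesis using r orient_swap23[of u v y] by (simp add: inside_sector_def zero_less_mult_iff)
      qed
    qed
    show ?thesis
    proof (cases b)
      case True
      have "inside_sector (- s) q p y"
        by (rule T[OF pqQ(2,1)]) (use True x(2) y(2) inside_sector_reverse[of s p q x] in \<open>auto simp: t_def p'_def\<close>)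
      then show ?thesis using inside_sector_reverse by blast
    next
      case False
      show ?thesis by (rule T[OF pqQ]) (use False x(2) y(2) in \<open>auto simp: t_def p'_def\<close>)
    qed
  qed
  have ins: "\<forall>y\<in>set (x # ys). y \<in> Q \<and> inside_sector s p q y" using x(2) xQ ys(3) trans by auto
  have "x \<notin> set ys" using ys(3) by (auto simp: inside_sector_def)
  then have dist: "distinct (x # ys)" using ys(2) by simp
  have Z: "zigzag (b # bs) p q (x # ys) = insert (p, q) (zigzag bs p' x ys)" by (simp add: p'_def)
  have "open_segment p q \<inter> open_segment a c = {}" if "(a, c) \<in> zigzag bs p' x ys" for a c
  proof -
    have side: "s * orient p q y < 0" if "y \<in> set (x # ys)" for y
    proof -
      have "s * orient p y q > 0" using ins that by (auto simp: inside_sector_def)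
      then show ?thesis using orient_swap23[of p y q] by (simp add: algebra_simps)
    qed
    have ac: "a \<in> {p, q} \<union> set (x # ys)" "c \<in> set (x # ys)"
      using zigzag_mem[OF that] by (auto simp: p'_def split: if_splits)
    have c: "s * orient p q c < 0" using ac(2) side by blast
    have a: "s * orient p q a \<le> 0"
    proof (cases "a \<in> {p, q}")
      case False
      then show ?thesis using ac(1) side[of a] by (meson UnE less_imp_le)
    qed auto
    show ?thesis
    proof (cases "s > 0")
      case True
      then have "orient p q a \<le> 0" "orient p q c < 0" using a c by (auto simp: mult_le_0_iff mult_less_0_iff)
      then show ?thesis by (intro open_segment_one_side_neg) auto
    next
      case False
      then have "s < 0" using Cons.prems(1) by simp
      then have "orient p q a \<ge> 0" "orient p q c > 0" using a c by (auto simp: mult_le_0_iff mult_less_0_iff)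
      then show ?thesis by (intro open_segment_one_side) auto
    qed
  qed
  then have "noncrossing_pairs (zigzag (b # bs) p q (x # ys))"
    unfolding Z using ys(5) by (intro noncrossing_pairs_insert)
  moreover have "zigzag (b # bs) p q (x # ys) \<subseteq> E" unfolding Z using ys(4) pqE by simp
  ultimately show ?case using ys(1) dist ins by (intro exI[of _ "x # ys"]) simp
qed

text \<open>Perles' theorem in terms of oriented edges: \<open>length cs\<close> steps discard at most \<open>length cs * card Q\<close>
  of them.\<close>

theorem dense_convex_graph_contains_zigzag:
  assumes gp: "general_position Q" and tr: "transitive_rotation Q"
    and EQ: "E \<subseteq> Q \<times> Q" and irr: "\<And>p. (p, p) \<notin> E" and sym: "\<And>p q. (p, q) \<in> E \<Longrightarrow> (q, p) \<in> E"
    and dense: "length cs * card Q < card E"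
  obtains p q xs where "length xs = length cs" "distinct (p # q # xs)" "set (p # q # xs) \<subseteq> Q"
    "zigzag cs p q xs \<subseteq> E" "noncrossing_pairs (zigzag cs p q xs)"
proof -
  have "card (E - continuable E 1 cs) \<le> length cs * card Q"
    using card_continuable[OF gp EQ irr sym, of 1 cs] by simp
  then have "continuable E 1 cs \<noteq> {}" using dense by auto
  then obtain p q where pq: "(p, q) \<in> continuable E 1 cs" by auto
  then have "(p, q) \<in> E" using continuable_subset by blast
  then have pqQ: "p \<in> Q" "q \<in> Q" "p \<noteq> q" using EQ irr by auto
  obtain xs where xs: "length xs = length cs" "distinct xs" "\<forall>x\<in>set xs. x \<in> Q \<and> inside_sector 1 p q x"
      "zigzag cs p q xs \<subseteq> E" "noncrossing_pairs (zigzag cs p q xs)"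
    using continuable_extends[OF tr EQ one_neq_zero pq] by blast
  have n: "p \<notin> set xs" "q \<notin> set xs" using xs(3) by (auto simp: inside_sector_def)
  show thesis
  proof (rule that[OF xs(1) _ _ xs(4,5)])
    show "distinct (p # q # xs)" using n xs(2) pqQ(3) by simp
    show "set (p # q # xs) \<subseteq> Q" using xs(3) pqQ(1,2) by auto
  qed
qed

section \<open>Zigzags in large point sets in general position\<close>

text \<open>The order from left to right, with vertical ties resolved from bottom to top.\<close>

definition lex_less :: "plane \<Rightarrow> plane \<Rightarrow> bool" where
  "lex_less a b \<longleftrightarrow> a $ 1 < b $ 1 \<or> (a $ 1 = b $ 1 \<and> a $ 2 < b $ 2)"

lemma lex_less_irrefl: "\<not> lex_less a a" by (simp add: lex_less_def)

lemma lex_less_trans: "lex_less a b \<Longrightarrow> lex_less b c \<Longrightarrow> lex_less a c" by (auto simp: lex_less_def)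

lemma lex_less_total: "a \<noteq> b \<Longrightarrow> lex_less a b \<or> lex_less b a" by (auto simp: lex_less_def plane_eq_iff)

lemma exists_lex_least:
  assumes "finite U" "U \<noteq> {}"
  obtains x where "x \<in> U" "\<forall>y\<in>U - {x}. lex_less x y"
proof -
  have "0 < card U" using assms by (simp add: card_gt_0_iff)
  have "\<exists>x\<in>U. card {y \<in> U. lex_less y x} = 0"
    by (rule exists_rank[OF assms(1) \<open>0 < card U\<close>]) (simp add: lex_less_irrefl, blast intro: lex_less_trans, blast dest: lex_less_total)
  then obtain x where x: "x \<in> U" "{y \<in> U. lex_less y x} = {}" using assms(1) by auto
  then show thesis using that[of x] lex_less_total by blast
qed

lemma lex_less_open_segment:
  assumes z: "z \<in> open_segment a b" and ab: "lex_less a b"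
  shows "lex_less a z" "lex_less z b"
proof -
  obtain u where u: "0 < u" "u < 1" "z = (1 - u) *\<^sub>R a + u *\<^sub>R b" using z by (rule open_segmentE)
  have i: "z $ i - a $ i = u * (b $ i - a $ i)" "b $ i - z $ i = (1 - u) * (b $ i - a $ i)" for i
    unfolding u(3) by (simp_all add: algebra_simps)
  have lt: "a $ i < z $ i" "z $ i < b $ i" if "a $ i < b $ i" for i
    using i[of i] mult_pos_pos[of u "b $ i - a $ i"] mult_pos_pos[of "1 - u" "b $ i - a $ i"] u(1,2) that by linarith+
  have eq: "z $ i = a $ i" "z $ i = b $ i" if "a $ i = b $ i" for i
    using i[of i] that by auto
  have "lex_less a z \<and> lex_less z b"
  proof (cases "a $ 1 < b $ 1")
    case True
    then show ?thesis using lt[OF True] by (simp add: lex_less_def)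
  next
    case False
    then have "a $ 1 = b $ 1" "a $ 2 < b $ 2" using ab by (auto simp: lex_less_def)
    then show ?thesis using eq[of 1] lt[of 2] by (simp add: lex_less_def)
  qed
  then show "lex_less a z" "lex_less z b" by auto
qed

text \<open>Segments in successive vertical slabs: a common point would be both to the left and to the right of \<open>q\<close>.\<close>

lemma lex_less_segments_disjoint:
  assumes "lex_less p q" "lex_less a b" "q = a \<or> lex_less q a"
  shows "open_segment p q \<inter> open_segment a b = {}"
proof (rule equals0I)
  fix z assume "z \<in> open_segment p q \<inter> open_segment a b"
  then have "lex_less z q" "lex_less a z" using lex_less_open_segment assms by blast+
  then show False using assms(3) lex_less_trans lex_less_irrefl by metis
qed

lemma zigzag_lex_sorted:
  "sorted_wrt lex_less (p # q # xs) \<Longrightarrow> (a, b) \<in> zigzag cs p q xs \<Longrightarrow> lex_less a b"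
proof (induction cs p q xs rule: zigzag.induct)
  case (1 c bs p q x xs)
  then show ?case by (cases c) auto
qed auto

text \<open>After \<open>j\<close> rounds, those points remain from which \<open>j\<close> spine vertices can be chosen from left to
  right, each with \<open>d\<close> neighbours to choose from.\<close>

fun peel :: "(plane \<Rightarrow> plane \<Rightarrow> bool) \<Rightarrow> nat \<Rightarrow> plane set \<Rightarrow> nat \<Rightarrow> plane set" where
  "peel R d P 0 = P"
| "peel R d P (Suc j) = {v \<in> peel R d P j. d \<le> card {u \<in> peel R d P j. lex_less v u \<and> R v u}}"

lemma peel_subset: "peel R d P j \<subseteq> P"
  by (induction j) auto

text \<open>Greedy from left to right: the next vertex is the leftmost available neighbour of the pivot, which
  leaves all the others for the remaining steps. A switch of the pivot uses up one round of peeling.\<close>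

lemma peel_extends:
  assumes gp: "general_position P"
  shows "\<lbrakk>p \<in> P; R p q; lex_less p q; q \<in> peel R d P (count_list cs True); runs_below d cs;
      stays cs \<le> card {u \<in> peel R d P (count_list cs True). lex_less q u \<and> R p u}\<rbrakk> \<Longrightarrow>
    \<exists>xs. length xs = length cs \<and> set xs \<subseteq> P \<and> sorted_wrt lex_less (p # q # xs) \<and>
      (\<forall>(a, b)\<in>zigzag cs p q xs. R a b) \<and> noncrossing_pairs (zigzag cs p q xs)"
proof (induction cs arbitrary: p q)
  case Nil
  then show ?case by (intro exI[of _ "[]"]) (auto simp: noncrossing_pairs_def)
next
  case (Cons b bs)
  define p' where "p' = (if b then q else p)"
  define S where "S = peel R d P (count_list bs True)"
  have finP: "finite P" using gp by (simp add: general_position_def)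
  have finS: "finite S" using finite_subset[OF peel_subset finP] unfolding S_def .
  have qP: "q \<in> P" using Cons.prems(4) peel_subset by blast
  define U where "U = {u \<in> S. lex_less q u \<and> R p' u}"
  have U: "Suc (stays bs) \<le> card U"
  proof (cases b)
    case True
    then have "q \<in> peel R d P (Suc (count_list bs True))" using Cons.prems(4) by simp
    then have "d \<le> card U" using True unfolding U_def S_def p'_def by simp
    moreover have "stays bs < d" using Cons.prems(5) True by simp
    ultimately show ?thesis by simp
  next
    case False
    then show ?thesis using Cons.prems(6) unfolding U_def S_def p'_def by simp
  qed
  have finU: "finite U" using finS by (simp add: U_def)
  moreover have "U \<noteq> {}" using U by auto
  ultimately obtain x where x: "x \<in> U" "\<forall>y\<in>U - {x}. lex_less x y" by (rule exists_lex_least)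
  have x': "x \<in> S" "lex_less q x" "R p' x" using x(1) by (auto simp: U_def)
  have p'x: "lex_less p' x" using x'(2) lex_less_trans[OF Cons.prems(3) x'(2)] by (simp add: p'_def)
  have p'P: "p' \<in> P" using Cons.prems(1) qP by (simp add: p'_def)
  have "card (U - {x}) \<le> card {u \<in> S. lex_less x u \<and> R p' u}"
  proof (rule card_mono)
    show "U - {x} \<subseteq> {u \<in> S. lex_less x u \<and> R p' u}" using x(2) by (auto simp: U_def)
  qed (use finS in simp)
  then have st: "stays bs \<le> card {u \<in> S. lex_less x u \<and> R p' u}" using U finU x(1) by simp
  have rb: "runs_below d bs" using Cons.prems(5) by (cases b) auto
  obtain ys where ys: "length ys = length bs" "set ys \<subseteq> P" "sorted_wrt lex_less (p' # x # ys)"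
      "\<forall>(a, b)\<in>zigzag bs p' x ys. R a b" "noncrossing_pairs (zigzag bs p' x ys)"
    using Cons.IH[OF p'P x'(3) p'x x'(1)[unfolded S_def] rb st[unfolded S_def]] by blast
  have xP: "x \<in> P" using x'(1) peel_subset unfolding S_def by blast
  have qlt: "lex_less q y" if "y \<in> set (x # ys)" for y
    using that x'(2) ys(3) lex_less_trans[of q x y] by auto
  have plt: "lex_less p y" if "y \<in> set (x # ys)" for y
    using lex_less_trans[OF Cons.prems(3) qlt[OF that]] .
  have sorted: "sorted_wrt lex_less (p # q # x # ys)"
    using Cons.prems(3) qlt plt ys(3) by simp
  have Z: "zigzag (b # bs) p q (x # ys) = insert (p, q) (zigzag bs p' x ys)" by (simp add: p'_def)
  have "open_segment p q \<inter> open_segment a c = {}" if ac: "(a, c) \<in> zigzag bs p' x ys" for a c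
  proof -
    have lac: "lex_less a c" using zigzag_lex_sorted[OF ys(3) ac] .
    have "(a = p' \<and> c \<in> set (x # ys)) \<or> a \<in> set (x # ys)" using zigzag_mem[OF ac] by auto
    then consider "a = p" "c \<in> set (x # ys)" | "a = q \<or> a \<in> set (x # ys)"
      unfolding p'_def by (cases b) auto
    then show ?thesis
    proof cases
      case 1
      have "c \<in> P" using 1 xP ys(2) by auto
      moreover have "p \<noteq> q" "p \<noteq> c" "q \<noteq> c" using Cons.prems(3) plt[OF 1(2)] qlt[OF 1(2)] lex_less_irrefl by blast+
      ultimately show ?thesis unfolding 1(1) using star_segments_disjoint[OF gp Cons.prems(1) qP] by blast
    next
      case 2
      then have "q = a \<or> lex_less q a" using qlt by blast
      then show ?thesis by (rule lex_less_segments_disjoint[OF Cons.prems(3) lac])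
    qed
  qed
  then have nc: "noncrossing_pairs (zigzag (b # bs) p q (x # ys))"
    unfolding Z using ys(5) by (intro noncrossing_pairs_insert)
  have red: "\<forall>(a, b)\<in>zigzag (b # bs) p q (x # ys). R a b" unfolding Z using ys(4) Cons.prems(2) by simp
  show ?case
  proof (intro exI[of _ "x # ys"] conjI nc red sorted)
    show "length (x # ys) = length (b # bs)" using ys(1) by simp
    show "set (x # ys) \<subseteq> P" using ys(2) xP by simp
  qed
qed

text \<open>In every set of points lost in round \<open>j\<close>, the leftmost point has fewer than \<open>d\<close> neighbours within
  the set. So the lost points contain a large independent set unless there are few of them.\<close>

lemma card_peel_step:
  assumes fin: "finite P" and sym: "\<And>x y. R x y \<Longrightarrow> R y x"
    and noind: "\<And>I. I \<subseteq> P \<Longrightarrow> card I = Suc m \<Longrightarrow> \<exists>x\<in>I. \<exists>y\<in>I. x \<noteq> y \<and> R x y"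
  shows "card (peel R d P j) \<le> card (peel R d P (Suc j)) + d * m"
proof -
  define S where "S = peel R d P j"
  have finS: "finite S" using finite_subset[OF peel_subset fin] unfolding S_def .
  have sub: "peel R d P (Suc j) \<subseteq> S" unfolding S_def by auto
  define W where "W = S - peel R d P (Suc j)"
  have "card W \<le> d * m"
  proof (rule ccontr)
    assume "\<not> card W \<le> d * m"
    then have big: "d * m < card W" by simp
    have "\<exists>I\<subseteq>W. card I = Suc m \<and> (\<forall>x\<in>I. \<forall>y\<in>I. x \<noteq> y \<longrightarrow> \<not> R x y)"
    proof (rule sparse_has_independent_set[OF _ big sym])
      show "finite W" using finS by (simp add: W_def)
      fix X assume X: "X \<subseteq> W" "X \<noteq> {}"
      have "finite X" using X finS unfolding W_def by (meson finite_Diff finite_subset)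
      then obtain v where v: "v \<in> X" "\<forall>y\<in>X - {v}. lex_less v y" using X(2) by (rule exists_lex_least)
      have vW: "v \<in> S" "\<not> d \<le> card {u \<in> S. lex_less v u \<and> R v u}" using v X unfolding W_def S_def by auto
      have "{u \<in> X. u \<noteq> v \<and> R v u} \<subseteq> {u \<in> S. lex_less v u \<and> R v u}" using v X unfolding W_def by auto
      then have "card {u \<in> X. u \<noteq> v \<and> R v u} \<le> card {u \<in> S. lex_less v u \<and> R v u}"
        using finS by (intro card_mono) auto
      then show "\<exists>v\<in>X. card {u \<in> X. u \<noteq> v \<and> R v u} < d" using v(1) vW by (intro bexI[of _ v]) auto
    qed
    then obtain I where I: "I \<subseteq> W" "card I = Suc m" "\<forall>x\<in>I. \<forall>y\<in>I. x \<noteq> y \<longrightarrow> \<not> R x y" by blast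
    have "I \<subseteq> P" using I(1) peel_subset unfolding W_def S_def by blast
    then show False using noind[of I] I(2,3) by blast
  qed
  moreover have "card W = card S - card (peel R d P (Suc j))"
    unfolding W_def by (rule card_Diff_subset[OF finite_subset[OF sub finS] sub])
  moreover have "card (peel R d P (Suc j)) \<le> card S" by (rule card_mono[OF finS sub])
  ultimately show ?thesis unfolding S_def by linarith
qed

theorem large_set_contains_sorted_zigzag:
  assumes gp: "general_position P" and sym: "\<And>x y. R x y \<Longrightarrow> R y x"
    and noind: "\<And>I. I \<subseteq> P \<Longrightarrow> card I = Suc m \<Longrightarrow> \<exists>x\<in>I. \<exists>y\<in>I. x \<noteq> y \<and> R x y"
    and large: "Suc (count_list cs True) * (d * m) < card P"
    and runs: "stays cs < d" "runs_below d cs"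
  obtains p q xs where "length xs = length cs" "distinct (p # q # xs)" "set (p # q # xs) \<subseteq> P"
    "\<forall>(a, b)\<in>zigzag cs p q xs. R a b" "noncrossing_pairs (zigzag cs p q xs)"
proof -
  have finP: "finite P" using gp by (simp add: general_position_def)
  have "card P \<le> card (peel R d P j) + j * (d * m)" for j
  proof (induction j)
    case (Suc j)
    have "card (peel R d P j) \<le> card (peel R d P (Suc j)) + d * m"
      by (rule card_peel_step[OF finP sym noind])
    then show ?case using Suc by (simp only: mult_Suc)
  qed simp
  from this[of "Suc (count_list cs True)"] have "card (peel R d P (Suc (count_list cs True))) > 0" using large by linarith
  then obtain p where p: "p \<in> peel R d P (Suc (count_list cs True))" by (auto simp only: card_gt_0_iff)
  define S where "S = peel R d P (count_list cs True)"
  define U where "U = {u \<in> S. lex_less p u \<and> R p u}"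
  have pP: "p \<in> P" by (rule subsetD[OF peel_subset p])
  have pU: "p \<in> P" "d \<le> card U" using p pP unfolding U_def S_def by simp_all
  have finS: "finite S" using finite_subset[OF peel_subset finP] unfolding S_def .
  have finU: "finite U" using finS by (simp add: U_def)
  moreover have "U \<noteq> {}" using pU(2) runs(1) by auto
  ultimately obtain q where q: "q \<in> U" "\<forall>y\<in>U - {q}. lex_less q y" by (rule exists_lex_least)
  have q': "q \<in> S" "lex_less p q" "R p q" using q(1) by (auto simp: U_def)
  have "card (U - {q}) \<le> card {u \<in> S. lex_less q u \<and> R p u}"
  proof (rule card_mono)
    show "U - {q} \<subseteq> {u \<in> S. lex_less q u \<and> R p u}" using q(2) by (auto simp: U_def)
  qed (use finS in simp)
  then have st: "stays cs \<le> card {u \<in> S. lex_less q u \<and> R p u}" using pU(2) runs(1) finU q(1) by simp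
  obtain xs where xs: "length xs = length cs" "set xs \<subseteq> P" "sorted_wrt lex_less (p # q # xs)"
      "\<forall>(a, b)\<in>zigzag cs p q xs. R a b" "noncrossing_pairs (zigzag cs p q xs)"
    using peel_extends[OF gp pU(1) q'(3,2) q'(1)[unfolded S_def] runs(2) st[unfolded S_def]] by blast
  have qP: "q \<in> P" using q'(1) peel_subset unfolding S_def by blast
  have "distinct ys" if "sorted_wrt lex_less ys" for ys
    using that by (induction ys) (auto simp: lex_less_irrefl)
  then have "distinct (p # q # xs)" using xs(3) by blast
  then show thesis
    by (rule that[OF xs(1) _ _ xs(4,5)]) (use xs(2) pU(1) qP in simp)
qed

section \<open>Double stars in dense geometric graphs\<close>

text \<open>The set \<open>A\<close> receives the leaves of \<open>x\<close> and \<open>B\<close> those of \<open>y\<close>, on opposite sides of the line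
  \<open>x y\<close>. The sign \<open>s\<close> tells which side is which. The roles of the two centres depend on where the
  neighbours of the second one lie.\<close>

lemma dense_graph_contains_double_star:
  assumes gp: "general_position Q" and Q: "Q \<noteq> {}"
    and dense: "\<forall>v\<in>Q. Suc (a + b) \<le> card {w \<in> Q. w \<noteq> v \<and> R v w}" and sym: "\<And>x y. R x y \<Longrightarrow> R y x"
  obtains x y A B s where "x \<in> Q" "y \<in> Q" "x \<noteq> y" "R x y" "A \<subseteq> Q" "B \<subseteq> Q" "card A = a" "card B = b" "s \<noteq> (0::real)"
    "\<forall>p\<in>A. R x p \<and> s * orient x y p > 0" "\<forall>p\<in>B. R y p \<and> s * orient x y p < 0"
proof -
  have finQ: "finite Q" using gp by (simp add: general_position_def)
  obtain u h1 h2 where u: "u \<in> Q" and h: "\<And>x. x \<in> Q \<Longrightarrow> x \<noteq> u \<Longrightarrow> h1 * (x $ 1 - u $ 1) + h2 * (x $ 2 - u $ 2) > 0"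
    using exists_exposed_point[OF finQ Q] by blast
  define X where "X = {w \<in> Q. w \<noteq> u \<and> R u w}"
  have X: "X \<subseteq> Q - {u}" "finite X" using finQ by (auto simp: X_def)
  have cX: "Suc (a + b) \<le> card X" using dense u by (simp add: X_def)
  then have "a < card X" by simp
  from exists_angular_rank[OF gp u X(1) h this]
  obtain v where v: "v \<in> X" "card {y \<in> X. orient u v y < 0} = a" by blast
  have vQ: "v \<in> Q" "v \<noteq> u" "R u v" "R v u" using v(1) sym by (auto simp: X_def)
  have nz: "orient u v y \<noteq> 0" if "y \<in> Q" "y \<noteq> u" "y \<noteq> v" for y
    by (rule general_position_orient_neq[OF gp]) (use that u vQ in auto)
  define Xn Xp where "Xn = {y \<in> X. orient u v y < 0}" and "Xp = {y \<in> X. orient u v y > 0}"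
  have "X = insert v (Xn \<union> Xp)"
  proof
    show "X \<subseteq> insert v (Xn \<union> Xp)"
    proof
      fix y assume y: "y \<in> X"
      show "y \<in> insert v (Xn \<union> Xp)"
      proof (cases "y = v")
        case False
        then have "orient u v y \<noteq> 0" using nz[of y] y X(1) by blast
        then show ?thesis using y by (auto simp: Xn_def Xp_def)
      qed simp
    qed
  qed (use v in \<open>auto simp: Xn_def Xp_def\<close>)
  \<comment> \<open>Apart from \<open>v\<close> itself, a neighbour of \<open>u\<close> is on one of the two sides, and \<open>a\<close> are on the first.\<close>
  then have "card X \<le> Suc (card (Xn \<union> Xp))" by (metis card_insert_le_m1 card_insert_if diff_Suc_1 finite_insert le_SucI order_refl X(2))
  also have "card (Xn \<union> Xp) \<le> card Xn + card Xp" by (rule card_Un_le)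
  finally have cXp: "b \<le> card Xp" using cX v(2) unfolding Xn_def by simp
  define Y where "Y = {w \<in> Q. w \<noteq> v \<and> R v w}"
  have cY: "Suc (a + b) \<le> card Y" using dense vQ by (simp add: Y_def)
  have finY: "finite Y" using finQ by (simp add: Y_def)
  define Yn Yp where "Yn = {y \<in> Y. orient u v y < 0}" and "Yp = {y \<in> Y. orient u v y > 0}"
  have "Y \<subseteq> insert u (Yn \<union> Yp)"
  proof
    fix y assume y: "y \<in> Y"
    show "y \<in> insert u (Yn \<union> Yp)"
    proof (cases "y = u")
      case False
      then have "orient u v y \<noteq> 0" using nz[of y] y by (auto simp: Y_def)
      then show ?thesis using y by (auto simp: Yn_def Yp_def)
    qed simp
  qed
  then have "card Y \<le> card (insert u (Yn \<union> Yp))" using finY by (intro card_mono) (auto simp: Yn_def Yp_def)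
  also have "\<dots> \<le> Suc (card (Yn \<union> Yp))" using finY by (simp add: card_insert_if Yn_def Yp_def)
  also have "card (Yn \<union> Yp) \<le> card Yn + card Yp" by (rule card_Un_le)
  finally have cYnp: "a + b \<le> card Yn + card Yp" using cY by simp
  show thesis
  proof (cases "b \<le> card Yp")
    case True
    then obtain B where B: "B \<subseteq> Yp" "card B = b" by (meson obtain_subset_with_card_n)
    show thesis
    proof (rule that[OF u vQ(1) vQ(2)[symmetric] vQ(3), of Xn B "- 1"])
      show "Xn \<subseteq> Q" "card Xn = a" using X v(2) by (auto simp: Xn_def)
      show "B \<subseteq> Q" using B by (auto simp: Yp_def Y_def)
      show "\<forall>p\<in>Xn. R u p \<and> - 1 * orient u v p > 0" by (auto simp: Xn_def X_def)
      show "\<forall>p\<in>B. R v p \<and> - 1 * orient u v p < 0" using B by (auto simp: Yp_def Y_def)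
    qed (use B in simp_all)
  next
    case False
    then have "a \<le> card Yn" using cYnp by simp
    then obtain A where A: "A \<subseteq> Yn" "card A = a" by (meson obtain_subset_with_card_n)
    obtain B where B: "B \<subseteq> Xp" "card B = b" using cXp by (meson obtain_subset_with_card_n)
    have o: "orient v u p = - orient u v p" for p by (rule orient_swap)
    show thesis
    proof (rule that[OF vQ(1) u vQ(2) vQ(4), of A B 1])
      show "A \<subseteq> Q" using A by (auto simp: Yn_def Y_def)
      show "B \<subseteq> Q" using B X by (auto simp: Xp_def)
      show "\<forall>p\<in>A. R v p \<and> 1 * orient v u p > 0" using A unfolding o by (auto simp: Yn_def Y_def)
      show "\<forall>p\<in>B. R u p \<and> 1 * orient v u p < 0" using B unfolding o by (auto simp: Xp_def X_def)
    qed (use A B in simp_all)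
  qed
qed

text \<open>Edges at different centres are separated by the line through the centres.\<close>

lemma double_star_noncrossing:
  assumes gp: "general_position Q" and xy: "x \<in> Q" "y \<in> Q" "x \<noteq> y" and AB: "A \<subseteq> Q" "B \<subseteq> Q" and s: "s \<noteq> (0::real)"
    and A: "\<forall>p\<in>A. s * orient x y p > 0" and B: "\<forall>p\<in>B. s * orient x y p < 0"
  shows "noncrossing_pairs (insert (x, y) ({x} \<times> A \<union> {y} \<times> B))"
proof -
  have nA: "x \<notin> A" "y \<notin> A" and nB: "x \<notin> B" "y \<notin> B" using A B by auto
  have sep: "open_segment x a \<inter> open_segment y b = {}" if "a \<in> A" "b \<in> B" for a b
  proof -
    have "open_segment y b \<inter> open_segment x a = {}"
    proof (rule linear_separates_segments[of "\<lambda>z. s * orient x y z"])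
      show "s * orient x y ((1 - t) *\<^sub>R u + t *\<^sub>R v) = (1 - t) * (s * orient x y u) + t * (s * orient x y v)" for t u v
        unfolding orient_convex by (simp add: algebra_simps)
      have ab: "s * orient x y a > 0" "s * orient x y b < 0" using A B that by blast+
      then show "s * orient x y y \<noteq> 0 \<or> s * orient x y b \<noteq> 0" by (metis less_irrefl)
      show "s * orient x y b \<le> 0" "0 \<le> s * orient x y a" using ab by simp_all
    qed simp_all
    then show ?thesis by blast
  qed
  have "noncrossing_pairs ({x} \<times> A \<union> {y} \<times> B)"
  proof (rule noncrossing_pairsI)
    fix a b c d assume "(a, b) \<in> {x} \<times> A \<union> {y} \<times> B" "(c, d) \<in> {x} \<times> A \<union> {y} \<times> B" "(a, b) \<noteq> (c, d)"
    then consider "a = x" "b \<in> A" "c = x" "d \<in> A" "b \<noteq> d" | "a = y" "b \<in> B" "c = y" "d \<in> B" "b \<noteq> d"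
      | "a = x" "b \<in> A" "c = y" "d \<in> B" | "a = y" "b \<in> B" "c = x" "d \<in> A" by blast
    then show "open_segment a b \<inter> open_segment c d = {}"
    proof cases
      case 1 then show ?thesis using star_segments_disjoint[OF gp xy(1), of b d] AB nA by auto
    next
      case 2 then show ?thesis using star_segments_disjoint[OF gp xy(2), of b d] AB nB by auto
    next
      case 3 then show ?thesis using sep by blast
    next
      case 4 then show ?thesis using sep[of d b] by blast
    qed
  qed
  then show ?thesis
  proof (rule noncrossing_pairs_insert)
    fix c d assume "(c, d) \<in> {x} \<times> A \<union> {y} \<times> B"
    then consider "c = x" "d \<in> A" | "c = y" "d \<in> B" by blast
    then show "open_segment x y \<inter> open_segment c d = {}"
    proof cases
      case 1 then show ?thesis using star_segments_disjoint[OF gp xy(1), of y d] xy AB nA by auto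
    next
      case 2
      then have "open_segment y x \<inter> open_segment y d = {}"
        using star_segments_disjoint[OF gp xy(2), of x d] xy AB nB by auto
      then show ?thesis using 2 by (simp add: open_segment_commute)
    qed
  qed
qed

lemma double_star_copy:
  assumes sg: "simple_graph T" and V: "verts T = {u, v} \<union> A \<union> B"
    and E: "edges T = insert {u, v} ({{u, l} | l. l \<in> A} \<union> {{v, l} | l. l \<in> B})"
    and disj: "u \<noteq> v" "u \<notin> A" "v \<notin> A" "u \<notin> B" "v \<notin> B" "A \<inter> B = {}"
    and gp: "general_position Q" and xy: "x \<in> Q" "y \<in> Q" "x \<noteq> y"
    and AB: "A' \<subseteq> Q" "B' \<subseteq> Q" "card A' = card A" "card B' = card B" and s: "s \<noteq> (0::real)"
    and A: "\<forall>p\<in>A'. c {x, p} = k \<and> s * orient x y p > 0" and B: "\<forall>p\<in>B'. c {y, p} = k \<and> s * orient x y p < 0"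
    and cxy: "c {x, y} = k"
  shows "has_mono_non_crossing_copy Q c k T"
proof -
  have "finite (verts T)" "finite Q" using sg gp by (auto simp: simple_graph_def general_position_def)
  then have fin: "finite A" "finite B" "finite A'" "finite B'" using V AB finite_subset by auto
  obtain g h where g: "bij_betw g A A'" and h: "bij_betw h B B'"
    using fin AB finite_same_card_bij by metis
  define f where "f z = (if z = u then x else if z = v then y else if z \<in> A then g z else h z)" for z
  have fA: "f z = g z" if "z \<in> A" for z using that disj by (auto simp: f_def)
  have fB: "f z = h z" if "z \<in> B" for z using that disj by (auto simp: f_def)
  have fuv: "f u = x" "f v = y" using disj by (auto simp: f_def)
  have imA: "f ` A = A'" using g fA unfolding bij_betw_def by (metis image_cong)
  have imB: "f ` B = B'" using h fB unfolding bij_betw_def by (metis image_cong)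
  have nA: "x \<notin> A'" "y \<notin> A'" and nB: "x \<notin> B'" "y \<notin> B'" using A B by fastforce+
  have AB': "A' \<inter> B' = {}" using A B by fastforce
  have injA: "inj_on f A" using g fA unfolding bij_betw_def by (metis inj_on_cong)
  have injB: "inj_on f B" using h fB unfolding bij_betw_def by (metis inj_on_cong)
  have "inj_on f (A \<union> B)" using injA injB imA imB AB' by (auto simp: inj_on_Un)
  moreover have "f ` (A \<union> B) = A' \<union> B'" using imA imB by auto
  ultimately have inj: "inj_on f (verts T)"
    unfolding V using fuv nA nB xy(3) by (auto simp: inj_on_Un)
  define Z where "Z = insert (u, v) ({u} \<times> A \<union> {v} \<times> B)"
  show ?thesis
  proof (rule oriented_copy[OF sg _ inj])
    show "edges T = (\<lambda>(a, b). {a, b}) ` Z" unfolding E Z_def by auto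
    show "f ` verts T \<subseteq> Q" unfolding V using fuv imA imB xy AB by auto
    have "map_prod f f ` Z = insert (x, y) ({x} \<times> A' \<union> {y} \<times> B')"
      unfolding Z_def imA[symmetric] imB[symmetric] using fuv by (auto simp: image_Un map_prod_def image_iff)
    moreover have "noncrossing_pairs (insert (x, y) ({x} \<times> A' \<union> {y} \<times> B'))"
      using double_star_noncrossing[OF gp xy AB(1,2) s] A B by blast
    ultimately show "noncrossing_pairs (map_prod f f ` Z)" by simp
    fix a b assume "(a, b) \<in> Z"
    then consider "a = u" "b = v" | "a = u" "b \<in> A" | "a = v" "b \<in> B" unfolding Z_def by auto
    then show "c {f a, f b} = k"
    proof cases
      case 1 then show ?thesis using fuv cxy by simp
    next
      case 2
      then have "f b \<in> A'" using imA by blast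
      then show ?thesis using 2 fuv A by simp
    next
      case 3
      then have "f b \<in> B'" using imB by blast
      then show ?thesis using 3 fuv B by simp
    qed
  qed
qed

section \<open>A colouring of points on a parabola\<close>

definition parabola :: "nat \<Rightarrow> plane" where
  "parabola i = (\<chi> j. if j = 1 then real i else (real i)\<^sup>2)"

lemma parabola_nth [simp]: "parabola i $ 1 = real i" "parabola i $ 2 = (real i)\<^sup>2"
  by (simp_all add: parabola_def)

lemma parabola_eq_iff [simp]: "parabola i = parabola j \<longleftrightarrow> i = j"
  by (auto simp: plane_eq_iff)

lemma inj_parabola: "inj_on parabola A"
  by (simp add: inj_on_def)

text \<open>The tangent at a point of the parabola has all the other points strictly above it.\<close>

lemma parabola_extreme: "parabola i \<notin> convex hull (parabola ` (A - {i}))"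
proof -
  \<comment> \<open>The normal vector of the tangent at \<open>parabola i\<close>.\<close>
  define a :: plane where "a = (\<chi> j. if j = 1 then - 2 * real i else 1)"
  have a: "inner a z = - 2 * real i * z $ 1 + z $ 2" for z
    by (simp add: a_def inner_vec_def UNIV_2)
  have sq: "inner a (parabola j) = (real j - real i)\<^sup>2 - (real i)\<^sup>2" for j
    by (simp add: a power2_eq_square algebra_simps)
  have "parabola ` (A - {i}) \<subseteq> {z. inner a z > - (real i)\<^sup>2}" by (auto simp: sq)
  then have "convex hull (parabola ` (A - {i})) \<subseteq> {z. inner a z > - (real i)\<^sup>2}"
    by (intro hull_minimal convex_halfspace_gt)
  moreover have "parabola i \<notin> {z. inner a z > - (real i)\<^sup>2}" by (simp add: sq)
  ultimately show ?thesis by blast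
qed

lemma convex_position_parabola:
  assumes "finite A"
  shows "convex_position (parabola ` A)"
  unfolding convex_position_def
proof (intro conjI exI)
  show "finite (parabola ` A)" using assms by simp
  then show "polytope (convex hull (parabola ` A))" unfolding polytope_def by blast
  show "parabola ` A = {v. v extreme_point_of convex hull (parabola ` A)}"
  proof
    show "{v. v extreme_point_of convex hull (parabola ` A)} \<subseteq> parabola ` A"
      using extreme_point_of_convex_hull by blast
    show "parabola ` A \<subseteq> {v. v extreme_point_of convex hull (parabola ` A)}"
    proof
      fix v assume "v \<in> parabola ` A"
      then obtain i where i: "i \<in> A" "v = parabola i" by blast
      have "parabola ` A = insert v (parabola ` (A - {i}))" using i by blast
      moreover have "v extreme_point_of convex hull (insert v (parabola ` (A - {i})))"
        using assms parabola_extreme unfolding i(2) by (intro extreme_point_of_convex_hull_insert) auto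
      ultimately show "v \<in> {v. v extreme_point_of convex hull (parabola ` A)}" by simp
    qed
  qed
qed

text \<open>The line through the points with abscissae \<open>i\<close> and \<open>k\<close> is \<open>y = (i + k) * x - i * k\<close>.\<close>

lemma parabola_chord:
  assumes "real i < x" "x < real k" "z $ 1 = x" "z $ 2 = (real i + real k) * x - real i * real k"
  shows "z \<in> open_segment (parabola i) (parabola k)"
proof -
  define u where "u = (x - real i) / (real k - real i)"
  have d: "real k - real i > 0" using assms by linarith
  have u: "0 < u" "u < 1" using assms d by (simp_all add: u_def)
  have ud: "u * (real k - real i) = x - real i" using d by (simp add: u_def)
  have "(1 - u) * real i + u * real k = x" using ud by (simp add: algebra_simps)
  moreover have "(1 - u) * (real i)\<^sup>2 + u * (real k)\<^sup>2 = (real i)\<^sup>2 + (u * (real k - real i)) * (real k + real i)"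
    by (simp add: power2_eq_square algebra_simps)
  then have "(1 - u) * (real i)\<^sup>2 + u * (real k)\<^sup>2 = (real i + real k) * x - real i * real k"
    unfolding ud by (simp add: power2_eq_square algebra_simps)
  ultimately have "z = (1 - u) *\<^sub>R parabola i + u *\<^sub>R parabola k"
    using assms(3,4) by (simp add: plane_eq_iff)
  moreover have "parabola i \<noteq> parabola k" using d by simp
  ultimately show ?thesis unfolding in_segment using u by blast
qed

lemma parabola_chords_cross:
  assumes "i < j" "j < k" "k < l"
  shows "edges_cross {parabola i, parabola k} {parabola j, parabola l}"
proof -
  define a b c d where "a = real i" and "b = real j" and "c = real k" and "d = real l"
  have abcd: "a < b" "b < c" "c < d" using assms by (auto simp: a_def b_def c_def d_def)
  \<comment> \<open>The abscissa of the intersection point of the two lines.\<close>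
  define x where "x = (b * d - a * c) / (b + d - a - c)"
  have D: "b + d - a - c > 0" using abcd by linarith
  have xD: "x * (b + d - a - c) = b * d - a * c" using D by (simp add: x_def)
  have "(x - b) * (b + d - a - c) = (b - a) * (c - b)" using xD by (simp add: algebra_simps)
  moreover have "(b - a) * (c - b) > 0" using abcd by simp
  ultimately have xb: "b < x" using D by (metis diff_gt_0_iff_gt zero_less_mult_pos2)
  have "(c - x) * (b + d - a - c) = (d - c) * (c - b)" using xD by (simp add: algebra_simps)
  moreover have "(d - c) * (c - b) > 0" using abcd by simp
  ultimately have xc: "x < c" using D by (metis diff_gt_0_iff_gt zero_less_mult_pos2)
  define z :: plane where "z = (\<chi> j. if j = 1 then x else (a + c) * x - a * c)"
  have z: "z $ 1 = x" "z $ 2 = (a + c) * x - a * c" by (simp_all add: z_def)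
  have z2: "z $ 2 = (b + d) * x - b * d" unfolding z(2) using xD by (simp add: algebra_simps)
  have "z \<in> open_segment (parabola i) (parabola k)"
    by (rule parabola_chord[of i x k]) (use abcd xb xc z in \<open>auto simp: a_def b_def c_def d_def\<close>)
  moreover have "z \<in> open_segment (parabola j) (parabola l)"
    by (rule parabola_chord[of j x l]) (use abcd xb xc z(1) z2 in \<open>auto simp: a_def b_def c_def d_def\<close>)
  moreover have "{parabola i, parabola k} \<noteq> {parabola j, parabola l}" using assms by (auto simp: doubleton_eq_iff)
  ultimately show ?thesis unfolding edges_cross_def by blast
qed

lemma successively_exit:
  assumes "successively A (x # xs)" "P x" "\<not> P (last (x # xs))"
  shows "\<exists>p q. A p q \<and> P p \<and> \<not> P q \<and> p \<in> set (x # xs) \<and> q \<in> set (x # xs)"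
  using assms
proof (induction xs arbitrary: x)
  case (Cons y ys)
  show ?case
  proof (cases "P y")
    case True
    then have "\<exists>p q. A p q \<and> P p \<and> \<not> P q \<and> p \<in> set (y # ys) \<and> q \<in> set (y # ys)"
      using Cons by (intro Cons.IH) auto
    then show ?thesis by auto
  next
    case False
    then show ?thesis using Cons.prems by (intro exI[of _ x] exI[of _ y]) simp
  qed
qed simp

text \<open>The chord \<open>{u, b}\<close> separates the points on a circle into two classes. A walk from \<open>a\<close> to \<open>w\<close> that
  avoids \<open>u\<close> and \<open>b\<close> and starts and ends in different classes has an edge that crosses the chord. The
  circular order is read from \<open>w\<close> onwards: numbers below \<open>w\<close> are shifted by \<open>M\<close>, so that \<open>w\<close> comes
  first and \<open>u\<close> last.\<close>

lemma noncrossing_walk_trapped: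
  fixes A :: "nat \<Rightarrow> nat \<Rightarrow> bool"
  assumes sym_all: "\<forall>p q. A p q \<longrightarrow> A q p"
    and nonint_all: "\<forall>p q r s. A p r \<and> A q s \<longrightarrow> \<not> (p < q \<and> q < r \<and> r < s)"
    and walk: "successively A (a # xs)" "last (a # xs) = w"
    and ub: "A u b" and avoid: "u \<notin> set (a # xs)" "b \<notin> set (a # xs)"
    and uw: "u < w" "\<And>x. x \<in> insert b (set (a # xs)) \<Longrightarrow> x < u \<or> w \<le> x"
    and M: "\<And>x. x \<in> insert b (set (a # xs)) \<Longrightarrow> x < M"
    and key: "(if w \<le> b then b else b + M) < (if w \<le> a then a else a + M)"
    and bw: "w \<noteq> b" "u < M"
  shows False
proof -
  have sym: "A q p" if "A p q" for p q using sym_all that by blast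
  have nonint: False if "A p r" "A q s" "p < q" "q < r" "r < s" for p q r s using nonint_all that by blast
  let ?k = "\<lambda>x. if w \<le> x then x else x + M"
  have "w < M" using M[of w] walk(2) last_in_set[of "a # xs"] by auto
  \<comment> \<open>The end \<open>w\<close> of the walk is not beyond \<open>b\<close>, while its start \<open>a\<close> is.\<close>
  then have "\<not> ?k b < ?k w" by auto
  then obtain p q where pq: "A p q" "?k b < ?k p" "\<not> ?k b < ?k q" "p \<in> set (a # xs)" "q \<in> set (a # xs)"
    using successively_exit[OF walk(1), of "\<lambda>x. ?k b < ?k x"] walk(2) key by auto
  have ne: "p \<noteq> u" "q \<noteq> u" "q \<noteq> b" using pq avoid by auto
  have rng: "p < u \<or> w \<le> p" "q < u \<or> w \<le> q" "b < u \<or> w \<le> b" "p < M" "q < M" "b < M"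
    using uw(2)[of p] uw(2)[of q] uw(2)[of b] M[of p] M[of q] M[of b] pq by auto
  have ap: "A q p" "A b u" using sym pq ub by auto
  have "?k q < ?k b" using pq(3) ne rng uw(1) by (auto split: if_splits)
  \<comment> \<open>In circular order \<open>q\<close>, \<open>b\<close>, \<open>p\<close>, \<open>u\<close>; the four cases are the rotations of this order.\<close>
  then consider "u < q" "q < b" "b < p" | "p < u" "u < q" "q < b" | "b < p" "p < u" "u < q" | "q < b" "b < p" "p < u"
    using pq(2) rng uw(1) by (auto split: if_splits)
  then show False
  proof cases
    case 1 then show ?thesis using nonint[OF ub ap(1)] by blast
  next
    case 2 then show ?thesis using nonint[OF pq(1) ub] by blast
  next
    case 3 then show ?thesis using nonint[OF ap(2) pq(1)] by blast
  next
    case 4 then show ?thesis using nonint[OF ap(1) ap(2)] by blast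
  qed
qed

text \<open>If \<open>u\<close> and \<open>w\<close> are consecutive points of a non-crossing cycle without being joined, both parts of
  the cycle between them have a first vertex, \<open>a\<close> and \<open>b\<close>, after \<open>u\<close>. The part starting with the one
  that is further from \<open>w\<close> in circular order has to cross the edge from \<open>u\<close> to the other.\<close>

lemma noncrossing_cycle_joins_neighbours:
  fixes A :: "nat \<Rightarrow> nat \<Rightarrow> bool"
  assumes sym_all: "\<forall>p q. A p q \<longrightarrow> A q p"
    and nonint_all: "\<forall>p q r s. A p r \<and> A q s \<longrightarrow> \<not> (p < q \<and> q < r \<and> r < s)"
    and dist: "distinct (u # as @ w # bs)" and cyc: "successively A (u # as @ w # bs @ [u])"
    and uw: "u < w" "\<And>x. x \<in> set (as @ w # bs) \<Longrightarrow> x < u \<or> w \<le> x"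
  shows "A u w"
proof (rule ccontr)
  assume nA: "\<not> A u w"
  have sym: "A q p" if "A p q" for p q using sym_all that by blast
  have nonint: False if "A p r" "A q s" "p < q" "q < r" "r < s" for p q r s using nonint_all that by blast
  have "as \<noteq> []" using nA cyc by (cases as) auto
  then obtain a as' where as: "as = a # as'" by (cases as) auto
  have "bs \<noteq> []"
  proof
    assume "bs = []"
    then have "successively A ((u # as) @ [w, u])" using cyc by simp
    then have "A w u" by (simp only: successively_append_iff) simp
    then show False using nA sym by blast
  qed
  then obtain bs' b where bs: "bs = bs' @ [b]" by (metis rev_exhaust)
  have ua: "A u a" using cyc by (simp add: as)
  have "successively A ((u # as @ w # bs') @ [b, u])" using cyc by (simp add: bs)
  then have "A b u" by (simp only: successively_append_iff) simp
  then have bu: "A u b" by (rule sym)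
  have w1: "successively A (a # as' @ [w])"
  proof -
    have "successively A ((u # a # as' @ [w]) @ bs @ [u])" using cyc by (simp add: as)
    then show ?thesis by (simp only: successively_append_iff) simp
  qed
  have "successively A (w # bs)"
  proof -
    have "successively A ((u # as) @ (w # bs) @ [u])" using cyc by simp
    then show ?thesis by (simp only: successively_append_iff)
  qed
  then have "successively (\<lambda>x y. A y x) (rev (w # bs))" by (simp only: successively_rev)
  then have "successively A (rev (w # bs))" by (rule successively_mono) (rule sym)
  then have w2: "successively A (b # rev bs' @ [w])" by (simp add: bs)
  define M where "M = Suc (Max (set (u # as @ w # bs)))"
  have M: "x < M" if "x \<in> set (u # as @ w # bs)" for x
    unfolding M_def using that by (meson List.finite_set Max_ge le_imp_less_Suc)
  let ?k = "\<lambda>x. if w \<le> x then x else x + M"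
  have ab: "a \<noteq> b" "a < M" "b < M" "u < M" using dist M[of a] M[of b] M[of u] by (auto simp: as bs)
  then have "?k a \<noteq> ?k b" by auto
  moreover have "\<not> ?k b < ?k a"
  proof
    assume k: "?k b < ?k a"
    have sub: "set (a # as' @ [w]) \<subseteq> set (as @ w # bs)" "b \<in> set (as @ w # bs)" by (auto simp: as bs)
    show False
    proof (rule noncrossing_walk_trapped[OF sym_all nonint_all w1 _ bu _ _ uw(1) _ _ k])
      show "u \<notin> set (a # as' @ [w])" "b \<notin> set (a # as' @ [w])" "w \<noteq> b" using dist by (auto simp: as bs)
      show "x < u \<or> w \<le> x" if "x \<in> insert b (set (a # as' @ [w]))" for x using uw(2)[of x] that sub by blast
      show "x < M" if "x \<in> insert b (set (a # as' @ [w]))" for x using M[of x] that sub by auto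
    qed (use ab in simp_all)
  qed
  moreover have "\<not> ?k a < ?k b"
  proof
    assume k: "?k a < ?k b"
    have sub: "set (b # rev bs' @ [w]) \<subseteq> set (as @ w # bs)" "a \<in> set (as @ w # bs)" by (auto simp: as bs)
    show False
    proof (rule noncrossing_walk_trapped[OF sym_all nonint_all w2 _ ua _ _ uw(1) _ _ k])
      show "u \<notin> set (b # rev bs' @ [w])" "a \<notin> set (b # rev bs' @ [w])" "w \<noteq> a" using dist by (auto simp: as bs)
      show "x < u \<or> w \<le> x" if "x \<in> insert a (set (b # rev bs' @ [w]))" for x using uw(2)[of x] that sub by blast
      show "x < M" if "x \<in> insert a (set (b # rev bs' @ [w]))" for x using M[of x] that sub by auto
    qed (use ab in simp_all)
  qed
  ultimately show False by linarith
qed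

lemma successively_path_edges: "successively (\<lambda>x y. {x, y} \<in> E) xs \<longleftrightarrow> path_edges xs \<subseteq> E"
  by (induction xs rule: path_edges.induct) auto

text \<open>The abscissa of \<open>parabola i\<close> is \<open>i\<close>, so the points with the same quotient \<open>i div k\<close> form the
  runs of \<open>k\<close> consecutive points, and an edge is red if it stays inside a run.\<close>

definition block_colouring :: "nat \<Rightarrow> plane set \<Rightarrow> colour" where
  "block_colouring k e = (if \<exists>g. \<forall>p\<in>e. nat \<lfloor>p $ 1\<rfloor> div k = g then Red else Blue)"

lemma block_colouring_parabola:
  "block_colouring k {parabola i, parabola j} = (if i div k = j div k then Red else Blue)"
  by (auto simp: block_colouring_def)

text \<open>A connected red graph stays inside one run, which has at most \<open>k\<close> points.\<close>

lemma block_colouring_no_red_connected_copy: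
  assumes con: "connected_graph T" and n: "card (verts T) = Suc k" and N: "N \<le> k * r"
  shows "\<not> has_mono_non_crossing_copy (parabola ` {..<N}) (block_colouring k) Red T"
proof
  assume "has_mono_non_crossing_copy (parabola ` {..<N}) (block_colouring k) Red T"
  then obtain S where S: "subgraph S (complete_geometric_graph (parabola ` {..<N}))"
    and red: "\<forall>e\<in>edges S. block_colouring k e = Red" and iso: "graph_iso S T"
    unfolding has_mono_non_crossing_copy_def by blast
  obtain f where f: "bij_betw f (verts S) (verts T)" "(\<lambda>e. f ` e) ` edges S = edges T"
    using iso unfolding graph_iso_def by blast
  have VP: "verts S \<subseteq> parabola ` {..<N}" and sgS: "simple_graph S"
    using S unfolding subgraph_def complete_geometric_graph_def fst_conv by blast+
  define grp where "grp p = nat \<lfloor>(p :: plane) $ 1\<rfloor> div k" for p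
  have grp: "grp (parabola i) = i div k" for i by (simp add: grp_def)
  obtain v where v: "v \<in> verts T" using con unfolding connected_graph_def by blast
  have fim: "f ` verts S = verts T" and finj: "inj_on f (verts S)" using f(1) by (simp_all add: bij_betw_def)
  from v have "v \<in> f ` verts S" unfolding fim .
  then obtain p where p: "p \<in> verts S" "f p = v" by (elim imageE) simp
  define C where "C = f ` {q \<in> verts S. grp q = grp p}"
  have "verts T \<subseteq> C"
  proof (rule connected_closed_set[OF con, of v])
    show "v \<in> C" using p by (auto simp: C_def)
    show "C \<subseteq> verts T" unfolding fim[symmetric] C_def by blast
    fix x y assume x: "x \<in> C" and e: "{x, y} \<in> edges T"
    then obtain q where q: "q \<in> verts S" "grp q = grp p" "f q = x" by (auto simp: C_def)
    have "{x, y} \<in> (\<lambda>e. f ` e) ` edges S" unfolding f(2) by (rule e)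
    then obtain d where d: "{x, y} = f ` d" "d \<in> edges S" by (rule imageE)
    have dV: "d \<subseteq> verts S" using d(2) sgS by (auto simp: simple_graph_def)
    have "x \<in> f ` d" "y \<in> f ` d" unfolding d(1)[symmetric] by simp_all
    then obtain q' r where q': "q' \<in> d" "f q' = x" and r: "r \<in> d" "f r = y" by blast
    have "q' = q" using q q' dV by (intro inj_onD[OF finj]) auto
    have "block_colouring k d = Red" using red d(2) by blast
    then have "\<exists>g. \<forall>p\<in>d. grp p = g" unfolding block_colouring_def grp_def by (simp split: if_splits)
    then obtain g where "\<forall>p\<in>d. grp p = g" by blast
    then have "grp r = grp p" using q' r q(2) \<open>q' = q\<close> by simp
    then show "y \<in> C" using r dV by (auto simp: C_def)
  qed
  have "Suc k \<le> card C"
    using card_mono[OF _ \<open>verts T \<subseteq> C\<close>] n VP finite_subset[OF VP] by (simp add: C_def)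
  also have "\<dots> \<le> card {q \<in> verts S. grp q = grp p}"
    unfolding C_def using finite_subset[OF VP] by (intro card_image_le) simp
  also have "\<dots> \<le> card (parabola ` {i \<in> {..<N}. i div k = grp p})"
    using VP by (intro card_mono) (auto simp: grp)
  also have "\<dots> \<le> card {i \<in> {..<N}. i div k = grp p}" by (intro card_image_le) simp
  also have "\<dots> \<le> k"
  proof (cases "k = 0")
    case True
    then show ?thesis using N by simp
  next
    case False
    have "{i \<in> {..<N}. i div k = grp p} \<subseteq> {grp p * k..<grp p * k + k}"
    proof
      fix i assume "i \<in> {i \<in> {..<N}. i div k = grp p}"
      then have "i div k = grp p" by simp
      then have "grp p * k + i mod k = i" using div_mult_mod_eq[of i k] by simp
      moreover have "i mod k < k" using False by simp
      ultimately show "i \<in> {grp p * k..<grp p * k + k}" by (metis atLeastLessThan_iff le_add1 nat_add_left_cancel_less)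
    qed
    then have "card {i \<in> {..<N}. i div k = grp p} \<le> card {grp p * k..<grp p * k + k}" by (intro card_mono) auto
    then show ?thesis by simp
  qed
  finally show False by simp
qed

text \<open>There are at most \<open>r\<close> runs, so two of the \<open>Suc r\<close> vertices share one. Then a vertex and its
  successor share one as well, and the cycle joins them by an edge, which is red.\<close>

lemma block_colouring_no_blue_Hamiltonian_copy:
  assumes ham: "has_Hamilton_cycle H" and m: "card (verts H) = Suc r" and N: "N \<le> k * r"
  shows "\<not> has_mono_non_crossing_copy (parabola ` {..<N}) (block_colouring k) Blue H"
proof
  assume "has_mono_non_crossing_copy (parabola ` {..<N}) (block_colouring k) Blue H"
  then obtain S where S: "subgraph S (complete_geometric_graph (parabola ` {..<N}))"
    and blue: "\<forall>e\<in>edges S. block_colouring k e = Blue" and nc: "non_crossing S" and iso: "graph_iso S H"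
    unfolding has_mono_non_crossing_copy_def by blast
  obtain f where f: "bij_betw f (verts S) (verts H)" "(\<lambda>e. f ` e) ` edges S = edges H"
    using iso unfolding graph_iso_def by blast
  have VP: "verts S \<subseteq> parabola ` {..<N}" and sgS: "simple_graph S"
    using S unfolding subgraph_def complete_geometric_graph_def fst_conv by blast+
  obtain xs where xs: "is_cycle H xs" "set xs = verts H" using ham unfolding has_Hamilton_cycle_def by blast
  have dxs: "distinct xs" "length xs \<ge> 3" using xs(1) unfolding is_cycle_def by blast+
  have fim: "f ` verts S = verts H" and finj: "inj_on f (verts S)" using f(1) by (simp_all add: bij_betw_def)
  define A where "A i j \<longleftrightarrow> {parabola i, parabola j} \<in> edges S" for i j
  define idx where "idx v = (SOME i. i < N \<and> parabola i \<in> verts S \<and> f (parabola i) = v)" for v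
  have idx: "idx v < N" "parabola (idx v) \<in> verts S" "f (parabola (idx v)) = v" if "v \<in> verts H" for v
  proof -
    from that have "v \<in> f ` verts S" unfolding fim .
    then obtain q where q: "q \<in> verts S" "f q = v" by (elim imageE) simp
    then obtain i where "i < N" "q = parabola i" using VP by blast
    then have "\<exists>i. i < N \<and> parabola i \<in> verts S \<and> f (parabola i) = v" using q by blast
    then have "idx v < N \<and> parabola (idx v) \<in> verts S \<and> f (parabola (idx v)) = v"
      unfolding idx_def by (rule someI_ex)
    then show "idx v < N" "parabola (idx v) \<in> verts S" "f (parabola (idx v)) = v" by blast+
  qed
  have A_idx: "A (idx v) (idx w)" if e: "{v, w} \<in> edges H" for v w
  proof -
    have "{v, w} \<in> (\<lambda>e. f ` e) ` edges S" unfolding f(2) by (rule e)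
    then obtain d where d: "{v, w} = f ` d" "d \<in> edges S" by (rule imageE)
    have dV: "d \<subseteq> verts S" using d(2) sgS by (auto simp: simple_graph_def)
    have "{v, w} \<subseteq> verts H" unfolding fim[symmetric] d(1) using dV by (rule image_mono)
    then have vw: "v \<in> verts H" "w \<in> verts H" by auto
    have "f ` {parabola (idx v), parabola (idx w)} = f ` d" using idx vw d by simp
    moreover have "{parabola (idx v), parabola (idx w)} \<subseteq> verts S" using idx vw by simp
    ultimately have "{parabola (idx v), parabola (idx w)} = d"
      using inj_on_image_eq_iff[OF finj] dV by blast
    then show ?thesis using d by (simp add: A_def)
  qed
  have symA: "A j i" if "A i j" for i j using that by (simp add: A_def insert_commute)
  have nonint: False if "A i k" "A j l" "i < j" "j < k" "k < l" for i j k l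
    using parabola_chords_cross[OF that(3-5)] that(1,2) nc unfolding non_crossing_def A_def by blast
  define V where "V = idx ` verts H"
  have injidx: "inj_on idx (verts H)" by (rule inj_on_inverseI[of _ "f \<circ> parabola"]) (use idx(3) in simp)
  have finH: "finite (verts H)" using xs(2) by (metis List.finite_set)
  have cV: "card V = Suc r" unfolding V_def using m injidx by (simp add: card_image)
  have finV: "finite V" using finH by (simp add: V_def)
  have "(\<lambda>i. i div k) ` V \<subseteq> {..<r}"
  proof
    fix g assume "g \<in> (\<lambda>i. i div k) ` V"
    then obtain i where "i \<in> V" "g = i div k" by blast
    then have "i < k * r" "g = i div k" using idx(1) N unfolding V_def by force+
    then show "g \<in> {..<r}" by (simp add: less_mult_imp_div_less mult.commute)
  qed
  then have "card ((\<lambda>i. i div k) ` V) \<le> r" by (metis card_lessThan card_mono finite_lessThan)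
  then have "card ((\<lambda>i. i div k) ` V) < card V" using cV by simp
  then have ninj: "\<not> inj_on (\<lambda>i. i div k) V" by (rule pigeonhole)
  obtain u z where uz: "u \<in> V" "z \<in> V" "u < z" "u div k = z div k"
  proof -
    from ninj obtain x y where "x \<in> V" "y \<in> V" "x div k = y div k" "x \<noteq> y" unfolding inj_on_def by blast
    then show ?thesis using that[of x y] that[of y x] by (cases "x < y") auto
  qed
  \<comment> \<open>The successor \<open>w\<close> of \<open>u\<close> in \<open>V\<close> lies between \<open>u\<close> and \<open>z\<close>, hence in the same run.\<close>
  define w where "w = Min {x \<in> V. u < x}"
  have W: "finite {x \<in> V. u < x}" "{x \<in> V. u < x} \<noteq> {}" using finV uz by auto
  have "w \<in> {x \<in> V. u < x}" unfolding w_def using W by (rule Min_in)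
  then have w: "w \<in> V" "u < w" by auto
  have wmin: "w \<le> x" if "x \<in> V" "u < x" for x unfolding w_def using W that by (intro Min_le) auto
  have "u div k \<le> w div k" "w div k \<le> z div k" using w wmin[OF uz(2,3)] by (auto intro: div_le_mono)
  then have same: "u div k = w div k" using uz(4) by simp
  have "path_edges (xs @ [hd xs]) \<subseteq> edges H" by (rule is_cycle_path_edges[OF xs(1)])
  obtain u' where u': "u' \<in> set xs" "u = idx u'" using uz(1) xs(2) unfolding V_def by auto
  then obtain l1 l2 where l: "xs = l1 @ u' # l2" by (meson split_list)
  obtain w' where w': "w' \<in> set xs" "w = idx w'" using w(1) xs(2) unfolding V_def by auto
  have "w' \<noteq> u'" using w u' w' by auto
  then have "w' \<in> set (l2 @ l1)" using w' l by auto
  then obtain as bs where ab: "l2 @ l1 = as @ w' # bs" by (meson split_list)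
  have "path_edges ((u' # l2) @ l1 @ [hd ((u' # l2) @ l1)]) = path_edges (l1 @ (u' # l2) @ [hd (l1 @ (u' # l2))])"
    by (rule path_edges_rotate)
  then have "path_edges (u' # as @ w' # bs @ [u']) = path_edges (xs @ [hd xs])"
    using ab l by (metis append.assoc append_Cons list.sel(1))
  then have "successively (\<lambda>x y. {x, y} \<in> edges H) (u' # as @ w' # bs @ [u'])"
    using is_cycle_path_edges[OF xs(1)] by (simp only: successively_path_edges)
  then have "successively (\<lambda>x y. A (idx x) (idx y)) (u' # as @ w' # bs @ [u'])"
    by (rule successively_mono) (rule A_idx)
  then have cyc: "successively A (map idx (u' # as @ w' # bs @ [u']))" by (simp only: successively_map)
  have perm: "set (u' # as @ w' # bs) = verts H" "distinct (u' # as @ w' # bs)"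
    using dxs(1) xs(2) unfolding l ab[symmetric] by auto
  have "A u w"
  proof (rule noncrossing_cycle_joins_neighbours[of A u "map idx as" w "map idx bs"])
    have "distinct (map idx (u' # as @ w' # bs))" using perm injidx by (simp only: distinct_map)
    then show "distinct (u # map idx as @ w # map idx bs)" using u'(2) w'(2) by simp
    show "successively A (u # map idx as @ w # map idx bs @ [u])" using cyc u'(2) w'(2) by simp
    fix x assume "x \<in> set (map idx as @ w # map idx bs)"
    then have "x \<in> idx ` set (as @ w' # bs)" using w'(2) by auto
    then have "x \<in> V" "x \<noteq> u" using perm injidx u'(2) unfolding V_def perm(1)[symmetric] by (auto simp: inj_on_def)
    then show "x < u \<or> w \<le> x" using wmin[of x] by linarith
  next
    show "\<forall>p q. A p q \<longrightarrow> A q p" using symA by blast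
    show "\<forall>p q r s. A p r \<and> A q s \<longrightarrow> \<not> (p < q \<and> q < r \<and> r < s)" using nonint by blast
  qed (rule w(2))
  then have "block_colouring k {parabola u, parabola w} = Blue" using blue by (simp add: A_def)
  then show False using same by (simp add: block_colouring_parabola)
qed

section \<open>The Ramsey numbers\<close>

lemma least_forcing_eqI:
  assumes "ramsey_forcing pos T H N" "\<And>M. M < N \<Longrightarrow> \<not> ramsey_forcing pos T H M"
  shows "(INF N \<in> {N. ramsey_forcing pos T H N}. enat N) = enat N"
proof (rule antisym)
  show "(INF N \<in> {N. ramsey_forcing pos T H N}. enat N) \<le> enat N" using assms(1) by (intro INF_lower) simp
  show "enat N \<le> (INF N \<in> {N. ramsey_forcing pos T H N}. enat N)"
  proof (rule INF_greatest)
    fix M assume "M \<in> {N. ramsey_forcing pos T H N}"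
    then have "\<not> M < N" using assms(2)[of M] by blast
    then show "enat N \<le> enat M" by simp
  qed
qed

lemma not_forcing_below_product:
  assumes pos: "\<And>P. convex_position P \<Longrightarrow> pos P"
    and con: "connected_graph T" and n: "card (verts T) = n" "n \<ge> 1"
    and ham: "has_Hamilton_cycle H" and m: "card (verts H) = m" "m \<ge> 1"
    and M: "M < (n - 1) * (m - 1) + 1"
  shows "\<not> ramsey_forcing pos T H M"
proof
  assume f: "ramsey_forcing pos T H M"
  let ?P = "parabola ` {..<M}"
  have "finite ?P" "card ?P = M" "pos ?P"
    using pos[OF convex_position_parabola[of "{..<M}"]] by (simp_all add: card_image inj_parabola)
  then have "has_mono_non_crossing_copy ?P (block_colouring (n - 1)) Red T \<or>
      has_mono_non_crossing_copy ?P (block_colouring (n - 1)) Blue H"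
    using f unfolding ramsey_forcing_def by blast
  moreover have M': "M \<le> (n - 1) * (m - 1)" using M by simp
  have "card (verts T) = Suc (n - 1)" "card (verts H) = Suc (m - 1)" using n m by simp_all
  then have "\<not> has_mono_non_crossing_copy ?P (block_colouring (n - 1)) Red T"
    "\<not> has_mono_non_crossing_copy ?P (block_colouring (n - 1)) Blue H"
    using block_colouring_no_red_connected_copy[OF con _ M'] block_colouring_no_blue_Hamiltonian_copy[OF ham _ M']
    by simp_all
  ultimately show False by simp
qed

lemma blue_copy_or_red_edge:
  assumes out: "outerplanar H" and ham: "has_Hamilton_cycle H" and m: "card (verts H) = m"
    and gp: "general_position P" and noblue: "\<not> has_mono_non_crossing_copy P c Blue H"
    and I: "I \<subseteq> P" "card I = m"
  shows "\<exists>x\<in>I. \<exists>y\<in>I. x \<noteq> y \<and> c {x, y} = Red"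
proof (rule ccontr)
  assume "\<not> ?thesis"
  then have notred: "c {x, y} \<noteq> Red" if "x \<in> I" "y \<in> I" "x \<noteq> y" for x y using that by blast
  have blue: "c {x, y} = Blue" if "x \<in> I" "y \<in> I" "x \<noteq> y" for x y
    using notred[OF that] by (cases "c {x, y}") simp_all
  have "has_mono_non_crossing_copy P c Blue H"
  proof (rule mono_clique_has_outerplanar_copy[OF out ham I(1) general_position_subset[OF gp I(1)]])
    show "card I = card (verts H)" using I(2) m by simp
  qed (rule blue)
  then show False using noblue by blast
qed

text \<open>Otherwise every nonempty subset has a point of small red degree, and the greedy selection yields a blue clique.\<close>

lemma dense_red_subset:
  assumes out: "outerplanar H" and ham: "has_Hamilton_cycle H" and m: "card (verts H) = m" "m \<ge> 1"
    and gp: "general_position P" and noblue: "\<not> has_mono_non_crossing_copy P c Blue H"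
    and large: "k * (m - 1) < card P"
  shows "\<exists>Q\<subseteq>P. Q \<noteq> {} \<and> (\<forall>v\<in>Q. k \<le> card {u \<in> Q. u \<noteq> v \<and> c {v, u} = Red})"
proof (rule ccontr)
  assume "\<not> ?thesis"
  then have no: "\<not> (\<forall>v\<in>X. k \<le> card {u \<in> X. u \<noteq> v \<and> c {v, u} = Red})" if "X \<subseteq> P" "X \<noteq> {}" for X
    using that by blast
  have fin: "finite P" using gp by (simp add: general_position_def)
  have "\<exists>I\<subseteq>P. card I = Suc (m - 1) \<and> (\<forall>x\<in>I. \<forall>y\<in>I. x \<noteq> y \<longrightarrow> \<not> c {x, y} = Red)"
  proof (rule sparse_has_independent_set[OF fin large])
    show "c {y, x} = Red" if "c {x, y} = Red" for x y using that by (simp add: insert_commute)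
    show "\<exists>v\<in>X. card {u \<in> X. u \<noteq> v \<and> c {v, u} = Red} < k" if "X \<subseteq> P" "X \<noteq> {}" for X
      using no[OF that] by (meson linorder_not_less)
  qed
  then obtain I where I: "I \<subseteq> P" "card I = Suc (m - 1)" "\<forall>x\<in>I. \<forall>y\<in>I. x \<noteq> y \<longrightarrow> \<not> c {x, y} = Red" by blast
  have "card I = m" using I(2) m(2) by simp
  from blue_copy_or_red_edge[OF out ham m(1) gp noblue I(1) this]
  obtain x y where "x \<in> I" "y \<in> I" "x \<noteq> y" "c {x, y} = Red" by blast
  then show False using I(3) by simp
qed

lemma mono_copy_mono:
  assumes "has_mono_non_crossing_copy Q c k G" "Q \<subseteq> P"
  shows "has_mono_non_crossing_copy P c k G"
proof -
  have "subgraph S (complete_geometric_graph P)" if S: "subgraph S (complete_geometric_graph Q)" for S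
    using S assms(2) unfolding subgraph_def complete_geometric_graph_def fst_conv snd_conv by blast
  then show ?thesis using assms(1) unfolding has_mono_non_crossing_copy_def by blast
qed

text \<open>The dense red subset has at least \<open>n - 1\<close> oriented edges per point, one more than the number
  \<open>n - 2\<close> of steps of the zigzag. The one-vertex tree has no edge to start a zigzag with and is
  treated separately.\<close>

lemma convex_forcing:
  assumes cat: "caterpillar T" and n: "card (verts T) = n" "n \<ge> 1"
    and out: "outerplanar H" and ham: "has_Hamilton_cycle H" and m: "card (verts H) = m" "m \<ge> 1"
  shows "ramsey_forcing convex_position T H ((n - 1) * (m - 1) + 1)"
  unfolding ramsey_forcing_def
proof (intro allI impI)
  fix P :: "plane set" and c
  assume P: "finite P \<and> card P = (n - 1) * (m - 1) + 1 \<and> convex_position P"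
  have sg: "simple_graph T" and tree: "tree T" using cat by (auto simp: caterpillar_def tree_def)
  have gp: "general_position P" using P convex_position_imp_general_position by blast
  show "has_mono_non_crossing_copy P c Red T \<or> has_mono_non_crossing_copy P c Blue H"
  proof (cases "n = 1")
    case True
    then obtain v where v: "verts T = {v}" using n(1) by (auto simp: card_1_singleton_iff)
    have E: "edges T = {}"
    proof (rule equals0I)
      fix e assume "e \<in> edges T"
      then have "e \<subseteq> {v}" "card e = 2" using sg v by (auto simp: simple_graph_def)
      then show False using card_mono[of "{v}" e] by simp
    qed
    have "P \<noteq> {}" using P by auto
    then obtain p where p: "p \<in> P" by blast
    have "has_mono_non_crossing_copy P c Red T"
      by (rule has_mono_non_crossing_copyI[OF sg, of "\<lambda>_. p"]) (use p v E in auto)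
    then show ?thesis by blast
  next
    case False
    then have n2: "n \<ge> 2" using n by simp
    obtain cs p q xs where code: "length xs = length cs" "distinct (p # q # xs)" "verts T = set (p # q # xs)"
      "edges T = (\<lambda>(a, b). {a, b}) ` zigzag cs p q xs"
    proof (cases "n = 2")
      case True
      then have "card (verts T) = 2" using n(1) by simp
      then obtain p q where pq: "p \<noteq> q" "verts T = {p, q}" "edges T = {{p, q}}"
        by (rule tree_two_vertices[OF tree])
      show thesis by (rule that[of "[]" "[]" p q]) (use pq in simp_all)
    next
      case False
      then have "card (verts T) \<ge> 3" using n2 n(1) by simp
      then show thesis by (rule caterpillar_zigzag[OF cat]) (rule that)
    qed
    have len: "n - 1 = Suc (length cs)" using distinct_card[OF code(2)] code(1,3) n(1) by simp
    show ?thesis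
    proof (rule disjCI)
      assume noblue: "\<not> has_mono_non_crossing_copy P c Blue H"
      have "(n - 1) * (m - 1) < card P" using P by simp
      from dense_red_subset[OF out ham m gp noblue this]
      obtain Q where Q: "Q \<subseteq> P" "Q \<noteq> {}" and dense: "\<forall>v\<in>Q. n - 1 \<le> card {u \<in> Q. u \<noteq> v \<and> c {v, u} = Red}" by blast
      have finQ: "finite Q" using Q P finite_subset by blast
      define N where "N v = {u \<in> Q. u \<noteq> v \<and> c {v, u} = Red}" for v
      define E where "E = Sigma Q N"
      have "card Q * (n - 1) = (\<Sum>v\<in>Q. n - 1)" by simp
      also have "\<dots> \<le> (\<Sum>v\<in>Q. card (N v))" using dense by (intro sum_mono) (simp add: N_def)
      also have "\<dots> = card E" unfolding E_def using finQ by (subst card_SigmaI) (auto simp: N_def)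
      finally have "card Q * Suc (length cs) \<le> card E" unfolding len .
      moreover have "card Q > 0" using Q(2) finQ by (simp add: card_gt_0_iff)
      ultimately have big: "length cs * card Q < card E" by (simp add: mult.commute)
      have tr: "transitive_rotation Q"
        using convex_position_transitive_rotation[of P] P Q(1) unfolding transitive_rotation_def by blast
      obtain p' q' xs' where z: "length xs' = length cs" "distinct (p' # q' # xs')" "set (p' # q' # xs') \<subseteq> Q"
          "zigzag cs p' q' xs' \<subseteq> E" "noncrossing_pairs (zigzag cs p' q' xs')"
      proof (rule dense_convex_graph_contains_zigzag[OF general_position_subset[OF gp Q(1)] tr _ _ _ big])
        show "E \<subseteq> Q \<times> Q" by (auto simp: E_def N_def)
        show "(p, p) \<notin> E" for p by (simp add: E_def N_def)
        show "(q, p) \<in> E" if "(p, q) \<in> E" for p q using that by (auto simp: E_def N_def insert_commute)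
      qed
      have "\<forall>(a, b)\<in>zigzag cs p' q' xs'. c {a, b} = Red" using z(4) by (auto simp: E_def N_def)
      then show "has_mono_non_crossing_copy P c Red T"
        by (intro zigzag_copy[OF sg code(2,3,4) z(2) _ _ _ z(5)]) (use z(1,3) code(1) Q(1) in auto)
    qed
  qed
qed

lemma general_forcing:
  assumes cat: "caterpillar T" and n: "card (verts T) \<ge> 3"
    and out: "outerplanar H" and ham: "has_Hamilton_cycle H" and m: "card (verts H) = m" "m \<ge> 1"
  shows "ramsey_forcing general_position T H (max_degree T * card (nonleaves T) * m\<^sup>2)"
  unfolding ramsey_forcing_def
proof (intro allI impI disjCI)
  fix P :: "plane set" and c
  assume P: "finite P \<and> card P = max_degree T * card (nonleaves T) * m\<^sup>2 \<and> general_position P"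
    and noblue: "\<not> has_mono_non_crossing_copy P c Blue H"
  have sg: "simple_graph T" using cat by (simp add: caterpillar_def tree_def)
  define d where "d = max_degree T"
  obtain cs p q xs where code: "length xs = length cs" "distinct (p # q # xs)" "verts T = set (p # q # xs)"
    "edges T = (\<lambda>(a, b). {a, b}) ` zigzag cs p q xs"
    and sw: "Suc (count_list cs True) = card (nonleaves T)" and runs: "stays cs < d" "runs_below d cs"
    unfolding d_def by (rule caterpillar_zigzag[OF cat n])
  have "m \<le> m\<^sup>2" unfolding power2_eq_square by (rule le_square)
  then have "m - 1 < m\<^sup>2" using m(2) by linarith
  moreover have "0 < d * card (nonleaves T)" using runs(1) unfolding sw[symmetric] by simp
  ultimately have "d * card (nonleaves T) * (m - 1) < d * card (nonleaves T) * m\<^sup>2" by (rule mult_strict_left_mono)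
  then have large: "Suc (count_list cs True) * (d * (m - 1)) < card P" using P unfolding sw d_def by (simp only: ac_simps)
  have gp: "general_position P" using P by blast
  have noind: "\<exists>x\<in>I. \<exists>y\<in>I. x \<noteq> y \<and> c {x, y} = Red" if "I \<subseteq> P" "card I = Suc (m - 1)" for I
    using blue_copy_or_red_edge[OF out ham m(1) gp noblue that(1)] that(2) m(2) by simp
  obtain p' q' xs' where z: "length xs' = length cs" "distinct (p' # q' # xs')" "set (p' # q' # xs') \<subseteq> P"
      "\<forall>(a, b)\<in>zigzag cs p' q' xs'. c {a, b} = Red" "noncrossing_pairs (zigzag cs p' q' xs')"
  proof (rule large_set_contains_sorted_zigzag[OF gp _ _ large runs, of "\<lambda>x y. c {x, y} = Red"])
    show "c {y, x} = Red" if "c {x, y} = Red" for x y using that by (simp add: insert_commute)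
  qed (use noind in blast)+
  show "has_mono_non_crossing_copy P c Red T"
    by (intro zigzag_copy[OF sg code(2,3,4) z(2) _ z(3,4,5)]) (use z(1) code(1) in simp)
qed

lemma double_star_forcing:
  assumes cat: "caterpillar T" and two: "card (nonleaves T) = 2" and n: "card (verts T) = n"
    and out: "outerplanar H" and ham: "has_Hamilton_cycle H" and m: "card (verts H) = m" "m \<ge> 1"
  shows "ramsey_forcing general_position T H ((n - 1) * (m - 1) + 1)"
  unfolding ramsey_forcing_def
proof (intro allI impI disjCI)
  fix P :: "plane set" and c
  assume P: "finite P \<and> card P = (n - 1) * (m - 1) + 1 \<and> general_position P"
    and noblue: "\<not> has_mono_non_crossing_copy P c Blue H"
  have gp: "general_position P" using P by blast
  have sg: "simple_graph T" and tree: "tree T" using cat by (auto simp: caterpillar_def tree_def)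
  have "card (nonleaves T) \<le> card (verts T)"
    using sg by (intro card_mono) (auto simp: nonleaves_def simple_graph_def)
  moreover have "card (verts T) \<noteq> 2"
  proof
    assume "card (verts T) = 2"
    then obtain p q where pq: "p \<noteq> q" "verts T = {p, q}" "edges T = {{p, q}}" by (rule tree_two_vertices[OF tree])
    have "{e \<in> edges T. p \<in> e} = {{p, q}}" unfolding pq(3) by blast
    then have "leaf T p" using pq(2) by (simp add: leaf_def degree_def)
    then have "nonleaves T \<subseteq> {q}" using pq by (auto simp: nonleaves_def)
    then show False using two card_mono[of "{q}" "nonleaves T"] by simp
  qed
  ultimately have n3: "card (verts T) \<ge> 3" using two by simp
  obtain ys L where ys: "distinct ys" "set ys = nonleaves T" "ys \<noteq> []" "distinct (concat (map L ys))"
    "set ys \<inter> set (concat (map L ys)) = {}" "verts T = set ys \<union> set (concat (map L ys))"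
    "edges T = path_edges ys \<union> {{v, l} | v l. v \<in> set ys \<and> l \<in> set (L v)}"
    by (rule caterpillar_structure[OF cat n3])
  have "length ys = 2" using ys(1,2) two distinct_card by metis
  then obtain u v where uv: "ys = [u, v]" by (auto simp: numeral_2_eq_2 length_Suc_conv)
  define A B where "A = set (L u)" and "B = set (L v)"
  have V: "verts T = {u, v} \<union> A \<union> B" using ys(6) unfolding uv A_def B_def by auto
  have E: "edges T = insert {u, v} ({{u, l} | l. l \<in> A} \<union> {{v, l} | l. l \<in> B})"
    using ys(7) unfolding uv A_def B_def by auto
  have disj: "u \<noteq> v" "u \<notin> A" "v \<notin> A" "u \<notin> B" "v \<notin> B" "A \<inter> B = {}"
    using ys(1,4,5) unfolding uv A_def B_def by auto
  have "card (verts T) = Suc (Suc (card A + card B))"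
    unfolding V using disj by (simp add: A_def B_def card_Un_disjoint Un_assoc)
  then have nab: "n - 1 = Suc (card A + card B)" using n by simp
  have "(n - 1) * (m - 1) < card P" using P by simp
  from dense_red_subset[OF out ham m gp noblue this]
  obtain Q where Q: "Q \<subseteq> P" "Q \<noteq> {}" and dense: "\<forall>v\<in>Q. n - 1 \<le> card {u \<in> Q. u \<noteq> v \<and> c {v, u} = Red}" by blast
  have gpQ: "general_position Q" by (rule general_position_subset[OF gp Q(1)])
  obtain x y A' B' s where z: "x \<in> Q" "y \<in> Q" "x \<noteq> y" "c {x, y} = Red" "A' \<subseteq> Q" "B' \<subseteq> Q" "card A' = card A"
    "card B' = card B" "s \<noteq> (0::real)"
    "\<forall>p\<in>A'. c {x, p} = Red \<and> s * orient x y p > 0" "\<forall>p\<in>B'. c {y, p} = Red \<and> s * orient x y p < 0"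
  proof (rule dense_graph_contains_double_star[OF gpQ Q(2) dense[unfolded nab]])
    show "c {y, x} = Red" if "c {x, y} = Red" for x y using that by (simp add: insert_commute)
  qed
  have "has_mono_non_crossing_copy Q c Red T"
    by (rule double_star_copy[OF sg V E disj gpQ z(1-3,5-11) z(4)])
  then show "has_mono_non_crossing_copy P c Red T" using Q(1) by (rule mono_copy_mono)
qed

theorem theorem5:
  fixes T :: "'a ugraph" and H :: "'b ugraph" and n m :: nat
  assumes "n \<ge> 1" and "m \<ge> 1"
    and "caterpillar T" and "card (verts T) = n"
    and "outerplanar H" and "card (verts H) = m" and "has_Hamilton_cycle H"
  shows "R_c T H = enat ((n - 1) * (m - 1) + 1)
    \<and> (n \<ge> 3 \<longrightarrow> R_g T H \<le> enat (max_degree T * card (nonleaves T) * m\<^sup>2))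
    \<and> (card (nonleaves T) = 2 \<longrightarrow> R_g T H = enat ((n - 1) * (m - 1) + 1))"
proof (intro conjI impI)
  have con: "connected_graph T" using assms(3) by (simp add: caterpillar_def tree_def)
  have below: "\<not> ramsey_forcing pos T H M"
    if "\<And>P. convex_position P \<Longrightarrow> pos P" "M < (n - 1) * (m - 1) + 1" for pos M
    by (rule not_forcing_below_product[OF that(1) con assms(4,1,7,6,2) that(2)])
  show "R_c T H = enat ((n - 1) * (m - 1) + 1)"
    unfolding R_c_def by (rule least_forcing_eqI[OF convex_forcing[OF assms(3,4,1,5,7,6,2)] below])
  show "R_g T H = enat ((n - 1) * (m - 1) + 1)" if "card (nonleaves T) = 2"
    unfolding R_g_def
    by (rule least_forcing_eqI[OF double_star_forcing[OF assms(3) that assms(4,5,7,6,2)] below[OF convex_position_imp_general_position]])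
  show "R_g T H \<le> enat (max_degree T * card (nonleaves T) * m\<^sup>2)" if "n \<ge> 3"
  proof -
    have "card (verts T) \<ge> 3" using assms(4) that by simp
    from general_forcing[OF assms(3) this assms(5,7,6,2)]
    show ?thesis unfolding R_g_def by (intro INF_lower) simp
  qed
qed

end
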